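(* Let $(\mathbf u,p)$ solve the linear stochastic Stokes system $$d\mathbf u(t)+[\nabla p(t)-\nu\Delta\mathbf u(t)]\,dt=\Phi\,dW(t),\qquad\operatorname{div}\mathbf u(t)=0,\qquad\mathbf u(0)=\mathbf u_0\qquad\text{on }\mathbb T^2\times(0,T],$$ and assume that $\mathbf y=\mathbf u-\Phi W$ satisfies $\mathbf y\in L^2(\Omega;C([0,T];\mathbb H^2(\mathbb T^2)^2))\cap C^1([0,T];L^4(\Omega;\mathbb V))$ and $\partial_t\mathbf y\in C^{1/2}([0,T];L^2(\Omega;\mathbb V))$. Let $\{(\mathbf u_n,p_n)\}$ be the approximations generated by the Crank–Nicolson scheme described in the context. Then there exists a constant $C>0$, independent of $\tau$ and $N$, such that $$\max_{0\le n\le N}\mathbb E\big[\|\mathbf u(t_n)-\mathbf u_n\|_{L^2(\mathbb T^2)^2}^2\big]\le C\tau^3$$ and $$\nu\,\tau\sum_{n=0}^{N-1}\mathbb E\Big[\big\|\nabla\big(\tfrac12(\mathbf u(t_n)+\mathbf u(t_{n+1}))-\tfrac12(\mathbf u_n+\mathbf u_{n+1})\big)\big\|_{L^2(\mathbb T^2)^4}^2\Big]\le C\tau^3 .$$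
   Context: $\mathbb T^2$ is the two-dimensional torus; $\mathbb H^k(\mathbb T^2)$ are $L^2$-based Sobolev spaces of periodic functions; $Q=\{q\in L^2(\mathbb T^2):\int q=0\}$; $\mathbb V=\{\mathbf v\in\mathbb H^1(\mathbb T^2)^2:\operatorname{div}\mathbf v=0\}$ with the $\mathbb H^1$ norm; $(\cdot,\cdot)$ is the $L^2(\mathbb T^2)$ inner product. $T,\nu>0$. $(\Omega,\mathfrak F,(\mathfrak F_t)_{t\ge0},\mathbb P)$ is a stochastic basis with complete right-continuous filtration; $W=\sum_kW_k\mathfrak e_k$ is a cylindrical Wiener process ($(W_k)$ independent standard real $(\mathfrak F_t)$-Wiener processes, $(\mathfrak e_k)$ an orthonormal basis of a separable Hilbert space $\mathfrak U$). $\Phi$ is deterministic, Hilbert–Schmidt from $\mathfrak U$ to $\mathbb H^2(\mathbb T^2)^2$, with each $\Phi\mathfrak e_k$ divergence-free; $\Phi W(t)=\sum_kW_k(t)\Phi\mathfrak e_k$. $\mathbf u_0$ is $\mathfrak F_0$-measurable and $\mathbb V$-valued. The velocity is understood in the weak pathwise sense: $\mathbf u$ is adapted with paths in $C([0,T];L^2(\mathbb T^2)^2)\cap L^2(0,T;\mathbb V)$ and $(\mathbf u(t),\boldsymbol\varphi)-(\mathbf u_0,\boldsymbol\varphi)=-\nu\int_0^t(\nabla\mathbf u,\nabla\boldsymbol\varphi)ds+(\Phi W(t),\boldsymbol\varphi)$ a.s. for all $t$ and $\boldsymbol\varphi\in\mathbb V$. **Scheme.** $\tau=T/N$, $t_n=n\tau$,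 with $M=\tau^{-1}$ an integer; $t_{n,\ell}=t_n+\ell\tau^2$; $\mathcal I_n^W=\tau\sum_{\ell=1}^MW(t_{n,\ell})$; $\mathcal J^{n+\frac12}=\mathcal I_n^W-\frac12(W(t_{n+1})+W(t_n))$; $\Delta_{n+1}W=W(t_{n+1})-W(t_n)$. Starting from the given $\mathbf u_0$, for $n=0,\dots,N-1$ the pair $(\mathbf u_{n+1},p_{n+1})\in\mathbb H^1(\mathbb T^2)^2\times Q$ is determined by: for all $(\boldsymbol\varphi,q)\in\mathbb H^1(\mathbb T^2)^2\times Q$, with $\mathbf u^{n+\frac12}=\frac12(\mathbf u_{n+1}+\mathbf u_n)$, $$\Big(\tfrac{\mathbf u_{n+1}-\mathbf u_n}\tau,\boldsymbol\varphi\Big)+\nu\big(\nabla(\mathbf u^{n+\frac12}+\Phi\mathcal J^{n+\frac12}),\nabla\boldsymbol\varphi\big)-(p_{n+1},\operatorname{div}\boldsymbol\varphi)=\tfrac1\tau(\Phi\Delta_{n+1}W,\boldsymbol\varphi),\qquad(\operatorname{div}\mathbf u_{n+1},q)=0.$$ *)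

theory Defs
  imports "HOL-Probability.Probability"
begin

section \<open>The Hilbert space of square-integrable functions on the torus\<close>

text \<open>The torus is the quotient of the plane by the integer lattice, carried by its unit cell.  Up to
  null sets, a function on the torus is a function on the cell.\<close>

definition torus :: "(real^2) measure" where
  "torus = restrict_space lborel (cbox 0 1)"

definition square_integrable :: "(real^2 \<Rightarrow> real) \<Rightarrow> bool" where
  "square_integrable f \<longleftrightarrow> f \<in> borel_measurable torus \<and> integrable torus (\<lambda>x. (f x)\<^sup>2)"

definition l2_eq :: "(real^2 \<Rightarrow> real) \<Rightarrow> (real^2 \<Rightarrow> real) \<Rightarrow> bool" where
  "l2_eq f g \<longleftrightarrow> square_integrable f \<and> square_integrable g \<and> (AE x in torus. f x = g x)"

lemma square_integrable_zero: "square_integrable (\<lambda>x. 0)"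
  by (simp add: square_integrable_def)

lemma square_integrable_mult:
  assumes "square_integrable f" "square_integrable g"
  shows "integrable torus (\<lambda>x. f x * g x)"
proof (rule Bochner_Integration.integrable_bound)
  show "integrable torus (\<lambda>x. (f x)\<^sup>2 + (g x)\<^sup>2)"
    using assms by (simp add: square_integrable_def)
  show "(\<lambda>x. f x * g x) \<in> borel_measurable torus"
    using assms by (auto simp: square_integrable_def)
  have "\<bar>a * b\<bar> \<le> a\<^sup>2 + b\<^sup>2" for a b :: real
    using sum_squares_bound[of a b] sum_squares_bound[of a "- b"]
    by (auto simp: abs_le_iff intro: order_trans[OF _ zero_le_power2])
  then show "AE x in torus. norm (f x * g x) \<le> norm ((f x)\<^sup>2 + (g x)\<^sup>2)"
    by simp
qed

lemma square_integrable_add: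
  assumes "square_integrable f" "square_integrable g"
  shows "square_integrable (\<lambda>x. f x + g x)"
  using assms square_integrable_mult[OF assms]
  by (auto simp: square_integrable_def power2_sum mult.assoc)

lemma square_integrable_scale:
  assumes "square_integrable f"
  shows "square_integrable (\<lambda>x. c * f x)"
  using assms by (auto simp: square_integrable_def power_mult_distrib)

lemma square_integrable_diff:
  assumes "square_integrable f" "square_integrable g"
  shows "square_integrable (\<lambda>x. f x - g x)"
  using square_integrable_add[OF assms(1) square_integrable_scale[OF assms(2), of "-1"]] by simp

lemma part_equivp_l2_eq: "part_equivp l2_eq"
proof (rule part_equivpI)
  show "\<exists>f. l2_eq f f"
    using square_integrable_zero by (auto simp: l2_eq_def)
  show "symp l2_eq"
    by (rule sympI) (auto simp: l2_eq_def)
  show "transp l2_eq"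
    by (rule transpI) (auto simp: l2_eq_def)
qed

quotient_type l2_torus = "real^2 \<Rightarrow> real" / partial: l2_eq
  by (rule part_equivp_l2_eq)

lemma l2_eq_integral_cong:
  assumes "l2_eq f f'" "l2_eq g g'"
  shows "(LINT x|torus. f x * g x) = (LINT x|torus. f' x * g' x)"
  using assms by (intro integral_cong_AE) (auto simp: l2_eq_def square_integrable_def)

instantiation l2_torus :: real_inner
begin

lift_definition zero_l2_torus :: l2_torus is "\<lambda>x. 0"
  by (simp add: l2_eq_def square_integrable_zero)

lift_definition plus_l2_torus :: "l2_torus \<Rightarrow> l2_torus \<Rightarrow> l2_torus" is "\<lambda>f g x. f x + g x"
  by (auto simp: l2_eq_def intro: square_integrable_add)

lift_definition minus_l2_torus :: "l2_torus \<Rightarrow> l2_torus \<Rightarrow> l2_torus" is "\<lambda>f g x. f x - g x"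
  by (auto simp: l2_eq_def intro: square_integrable_diff)

lift_definition uminus_l2_torus :: "l2_torus \<Rightarrow> l2_torus" is "\<lambda>f x. - f x"
  using square_integrable_scale[of _ "-1"] by (auto simp: l2_eq_def)

lift_definition scaleR_l2_torus :: "real \<Rightarrow> l2_torus \<Rightarrow> l2_torus" is "\<lambda>c f x. c * f x"
  by (auto simp: l2_eq_def intro: square_integrable_scale)

lift_definition inner_l2_torus :: "l2_torus \<Rightarrow> l2_torus \<Rightarrow> real" is "\<lambda>f g. LINT x|torus. f x * g x"
  by (rule l2_eq_integral_cong)

definition norm_l2_torus :: "l2_torus \<Rightarrow> real" where
  "norm_l2_torus f = sqrt (inner f f)"

definition sgn_l2_torus :: "l2_torus \<Rightarrow> l2_torus" where
  "sgn_l2_torus f = inverse (norm f) *\<^sub>R f"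

definition dist_l2_torus :: "l2_torus \<Rightarrow> l2_torus \<Rightarrow> real" where
  "dist_l2_torus f g = norm (f - g)"

definition uniformity_l2_torus :: "(l2_torus \<times> l2_torus) filter" where
  "uniformity_l2_torus = (INF e\<in>{0<..}. principal {(f, g). dist f g < e})"

definition open_l2_torus :: "l2_torus set \<Rightarrow> bool" where
  "open_l2_torus U \<longleftrightarrow> (\<forall>f\<in>U. eventually (\<lambda>(f', g). f' = f \<longrightarrow> g \<in> U) uniformity)"

instance
proof
  fix a b c :: l2_torus and r s :: real
  show "a + b + c = a + (b + c)"
    by transfer (auto simp: l2_eq_def add.assoc intro: square_integrable_add)
  show "a + b = b + a"
    by transfer (auto simp: l2_eq_def add.commute intro: square_integrable_add)
  show "0 + a = a"
    by transfer (auto simp: l2_eq_def)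
  show "- a + a = 0"
    by transfer (auto simp: l2_eq_def square_integrable_zero)
  show "a - b = a + - b"
    by transfer (auto simp: l2_eq_def intro: square_integrable_diff)
  show "r *\<^sub>R (a + b) = r *\<^sub>R a + r *\<^sub>R b"
    by transfer (auto simp: l2_eq_def distrib_left intro!: square_integrable_add square_integrable_scale)
  show "(r + s) *\<^sub>R a = r *\<^sub>R a + s *\<^sub>R a"
    by transfer (auto simp: l2_eq_def distrib_right intro!: square_integrable_add square_integrable_scale)
  show "r *\<^sub>R s *\<^sub>R a = (r * s) *\<^sub>R a"
    by transfer (auto simp: l2_eq_def mult.assoc intro!: square_integrable_scale)
  show "1 *\<^sub>R a = a"
    by transfer (auto simp: l2_eq_def)
  show "sgn a = inverse (norm a) *\<^sub>R a"
    by (rule sgn_l2_torus_def)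
  show "dist a b = norm (a - b)"
    by (rule dist_l2_torus_def)
  show "uniformity = (INF e\<in>{0<..}. principal {(f :: l2_torus, g). dist f g < e})"
    by (rule uniformity_l2_torus_def)
  show "open U \<longleftrightarrow> (\<forall>f\<in>U. eventually (\<lambda>(f', g). f' = f \<longrightarrow> g \<in> U) uniformity)" for U :: "l2_torus set"
    by (rule open_l2_torus_def)
  show "inner a b = inner b a"
    by transfer (simp add: mult.commute)
  show "inner (a + b) c = inner a c + inner b c"
    by transfer (simp add: l2_eq_def distrib_right square_integrable_mult)
  show "inner (r *\<^sub>R a) b = r * inner a b"
    by transfer (simp add: mult.assoc)
  show "0 \<le> inner a a"
    by transfer simp
  show "inner a a = 0 \<longleftrightarrow> a = 0"
  proof (transfer, goal_cases)
    case (1 a)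
    then have "(LINT x|torus. a x * a x) = 0 \<longleftrightarrow> (AE x in torus. a x * a x = 0)"
      by (intro integral_nonneg_eq_0_iff_AE) (auto simp: l2_eq_def square_integrable_mult)
    with 1 show ?case
      by (simp add: l2_eq_def square_integrable_zero)
  qed
  show "norm a = sqrt (inner a a)"
    by (rule norm_l2_torus_def)
qed

end

lift_definition torus_integral :: "l2_torus \<Rightarrow> real" is "\<lambda>f. LINT x|torus. f x"
  by (intro integral_cong_AE) (auto simp: l2_eq_def square_integrable_def)

section \<open>Weak derivatives and Sobolev spaces\<close>

definition partial_deriv :: "2 \<Rightarrow> (real^2 \<Rightarrow> real) \<Rightarrow> real^2 \<Rightarrow> real" where
  "partial_deriv j \<phi> x = frechet_derivative \<phi> (at x) (axis j 1)"

primrec k_times_cont_diff :: "nat \<Rightarrow> (real^2 \<Rightarrow> real) \<Rightarrow> bool" where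
  "k_times_cont_diff 0 \<phi> \<longleftrightarrow> continuous_on UNIV \<phi>"
| "k_times_cont_diff (Suc k) \<phi> \<longleftrightarrow>
     (\<forall>x. \<phi> differentiable at x) \<and> (\<forall>j. k_times_cont_diff k (partial_deriv j \<phi>))"

definition test_function :: "(real^2 \<Rightarrow> real) \<Rightarrow> bool" where
  "test_function \<phi> \<longleftrightarrow>
     (\<forall>k. k_times_cont_diff k \<phi>) \<and> (\<forall>j x. \<phi> (x + axis j 1) = \<phi> x)"

lift_definition has_weak_deriv :: "2 \<Rightarrow> l2_torus \<Rightarrow> l2_torus \<Rightarrow> bool" is
  "\<lambda>j f g. \<forall>\<phi>. test_function \<phi> \<longrightarrow>
     (LINT x|torus. f x * partial_deriv j \<phi> x) = - (LINT x|torus. g x * \<phi> x)"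
proof goal_cases
  case (1 j f f' g g')
  have diff: "continuous_on UNIV \<phi> \<and> continuous_on UNIV (partial_deriv j \<phi>)"
    if "test_function \<phi>" for \<phi>
  proof -
    from that have "k_times_cont_diff 0 \<phi>" "k_times_cont_diff (Suc 0) \<phi>"
      unfolding test_function_def by blast+
    then show ?thesis by simp
  qed
  have meas: "h \<in> borel_measurable torus" if "continuous_on UNIV h" for h :: "real^2 \<Rightarrow> real"
    using borel_measurable_continuous_onI[OF that] unfolding torus_def
    by (intro measurable_restrict_space1) simp
  have "(LINT x|torus. f x * h x) = (LINT x|torus. f' x * h x)"
    "(LINT x|torus. g x * h x) = (LINT x|torus. g' x * h x)"
    if "continuous_on UNIV h" for h
    using 1 meas[OF that] by (auto intro!: integral_cong_AE simp: l2_eq_def square_integrable_def)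
  with diff show ?case by auto
qed

text \<open>A weak derivative in the sense of square-integrable functions is unique; the operator below is
  meaningful only on functions possessing one.\<close>

definition weak_deriv :: "2 \<Rightarrow> l2_torus \<Rightarrow> l2_torus" where
  "weak_deriv j f = (THE g. has_weak_deriv j f g)"

primrec sobolev :: "nat \<Rightarrow> l2_torus set" where
  "sobolev 0 = UNIV"
| "sobolev (Suc k) = {f. \<forall>j. (\<exists>g. has_weak_deriv j f g) \<and> weak_deriv j f \<in> sobolev k}"

type_synonym field = "l2_torus^2"

definition Hk :: "nat \<Rightarrow> field set" where
  "Hk k = {v. \<forall>i. v $ i \<in> sobolev k}"

definition grad :: "field \<Rightarrow> l2_torus^2^2" where
  "grad v = (\<chi> i j. weak_deriv j (v $ i))"

definition hess :: "field \<Rightarrow> l2_torus^2^2^2" where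
  "hess v = (\<chi> i j k. weak_deriv k (weak_deriv j (v $ i)))"

definition divergence :: "field \<Rightarrow> l2_torus" where
  "divergence v = (\<Sum>i\<in>UNIV. weak_deriv i (v $ i))"

definition V :: "field set" where
  "V = {v \<in> Hk 1. divergence v = 0}"

definition Q :: "l2_torus set" where
  "Q = {q. torus_integral q = 0}"

text \<open>The Sobolev norms of orders 1 and 2 are the norms of the following jets.  On the Sobolev space
  of order k the k-jet is thus an isometry onto a closed subspace of a product of copies of
  \<^typ>\<open>l2_torus\<close>, and continuity, measurability, boundedness and limits with respect to the Sobolev
  norm are expressed as those of the jet.\<close>

definition jet1 :: "field \<Rightarrow> field \<times> (l2_torus^2^2)" where
  "jet1 v = (v, grad v)"

definition jet2 :: "field \<Rightarrow> field \<times> (l2_torus^2^2) \<times> (l2_torus^2^2^2)" where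
  "jet2 v = (v, grad v, hess v)"

section \<open>Bochner spaces\<close>

text \<open>These are applied only to separable value spaces, where Borel measurability coincides with
  strong measurability.\<close>

definition Lp_fun :: "nat \<Rightarrow> 'a measure \<Rightarrow> ('a \<Rightarrow> 'x::real_normed_vector) \<Rightarrow> bool" where
  "Lp_fun p M f \<longleftrightarrow> f \<in> borel_measurable M \<and> integrable M (\<lambda>x. norm (f x) ^ p)"

definition Lp_norm :: "nat \<Rightarrow> 'a measure \<Rightarrow> ('a \<Rightarrow> 'x::real_normed_vector) \<Rightarrow> real" where
  "Lp_norm p M f = root p (LINT x|M. norm (f x) ^ p)"

definition Lp_continuous_on ::
  "nat \<Rightarrow> 'a measure \<Rightarrow> real set \<Rightarrow> (real \<Rightarrow> 'a \<Rightarrow> 'x::real_normed_vector) \<Rightarrow> bool" where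
  "Lp_continuous_on p M S f \<longleftrightarrow>
     (\<forall>t\<in>S. Lp_fun p M (f t) \<and> ((\<lambda>s. Lp_norm p M (\<lambda>x. f s x - f t x)) \<longlongrightarrow> 0) (at t within S))"

definition Lp_C1_on ::
  "nat \<Rightarrow> 'a measure \<Rightarrow> real set \<Rightarrow> (real \<Rightarrow> 'a \<Rightarrow> 'x::real_normed_vector) \<Rightarrow> (real \<Rightarrow> 'a \<Rightarrow> 'x) \<Rightarrow> bool"
where
  "Lp_C1_on p M S f f' \<longleftrightarrow>
     Lp_continuous_on p M S f \<and> Lp_continuous_on p M S f' \<and>
     (\<forall>t\<in>S. ((\<lambda>s. Lp_norm p M (\<lambda>x. (f s x - f t x) /\<^sub>R (s - t) - f' t x)) \<longlongrightarrow> 0) (at t within S))"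

definition Lp_hoelder_on ::
  "nat \<Rightarrow> 'a measure \<Rightarrow> real set \<Rightarrow> real \<Rightarrow> (real \<Rightarrow> 'a \<Rightarrow> 'x::real_normed_vector) \<Rightarrow> bool" where
  "Lp_hoelder_on p M S \<alpha> f \<longleftrightarrow>
     (\<forall>t\<in>S. Lp_fun p M (f t)) \<and>
     (\<exists>L. \<forall>s\<in>S. \<forall>t\<in>S. Lp_norm p M (\<lambda>x. f t x - f s x) \<le> L * \<bar>t - s\<bar> powr \<alpha>)"

section \<open>Stochastic basis and noise\<close>

text \<open>Only the times \<open>t \<ge> 0\<close> of a filtration are relevant; the clipping by \<open>max 0\<close> ignores the others.\<close>

definition stochastic_basis :: "'w measure \<Rightarrow> (real \<Rightarrow> 'w measure) \<Rightarrow> bool" where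
  "stochastic_basis P F \<longleftrightarrow>
     prob_space P \<and>
     filtration (space P) (\<lambda>t. F (max 0 t)) \<and>
     (\<forall>t\<ge>0. subalgebra P (F t)) \<and>
     (\<forall>A. (\<exists>B\<in>null_sets P. A \<subseteq> B) \<longrightarrow> A \<in> sets (F 0)) \<and>
     (\<forall>t\<ge>0. sets (F t) = (\<Inter>s\<in>{t<..}. sets (F s)))"

definition wiener_process ::
  "'w measure \<Rightarrow> (real \<Rightarrow> 'w measure) \<Rightarrow> (real \<Rightarrow> 'w \<Rightarrow> real) \<Rightarrow> bool" where
  "wiener_process P F B \<longleftrightarrow>
     (AE \<omega> in P. B 0 \<omega> = 0) \<and>
     (AE \<omega> in P. continuous_on {0..} (\<lambda>t. B t \<omega>)) \<and>
     (\<forall>t\<ge>0. B t \<in> borel_measurable (F t)) \<and>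
     (\<forall>s t. 0 \<le> s \<longrightarrow> s < t \<longrightarrow>
        distributed P lborel (\<lambda>\<omega>. B t \<omega> - B s \<omega>) (\<lambda>x. ennreal (normal_density 0 (sqrt (t - s)) x)) \<and>
        prob_space.indep_set P (sets (F s))
          {(\<lambda>\<omega>. B t \<omega> - B s \<omega>) -` A \<inter> space P | A. A \<in> sets borel})"

definition independent_wiener_processes ::
  "'w measure \<Rightarrow> (real \<Rightarrow> 'w measure) \<Rightarrow> ('k \<Rightarrow> real \<Rightarrow> 'w \<Rightarrow> real) \<Rightarrow> bool" where
  "independent_wiener_processes P F W \<longleftrightarrow>
     (\<forall>k. wiener_process P F (W k)) \<and>
     prob_space.indep_vars P (\<lambda>_. PiM {0..} (\<lambda>_. borel)) (\<lambda>k \<omega>. \<lambda>t\<in>{0..}. W k t \<omega>) UNIV"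

definition orthonormal_basis :: "('k \<Rightarrow> 'u::real_inner) \<Rightarrow> bool" where
  "orthonormal_basis e \<longleftrightarrow>
     (\<forall>j k. inner (e j) (e k) = (if j = k then 1 else 0)) \<and> closure (span (range e)) = UNIV"

definition hilbert_schmidt ::
  "('k \<Rightarrow> 'u::real_inner) \<Rightarrow> ('u \<Rightarrow> 'x::real_normed_vector) \<Rightarrow> bool" where
  "hilbert_schmidt e A \<longleftrightarrow> bounded_linear A \<and> (\<lambda>k. (norm (A (e k)))\<^sup>2) summable_on UNIV"

text \<open>The cylindrical process \<open>W = (\<Sum>k. W\<^sub>k e\<^sub>k)\<close> itself has no values in the Hilbert space of the \<open>e\<^sub>k\<close>.
  The series \<open>(\<Sum>k. W\<^sub>k(t) \<Phi> e\<^sub>k)\<close> converges in mean square in the Sobolev space of order 2; \<open>Z\<close> is an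
  adapted, pathwise continuous process of such limits, which determines it up to
  indistinguishability.\<close>

definition noise_process ::
  "'w measure \<Rightarrow> (real \<Rightarrow> 'w measure) \<Rightarrow> ('k \<Rightarrow> 'u) \<Rightarrow> ('k \<Rightarrow> real \<Rightarrow> 'w \<Rightarrow> real) \<Rightarrow>
   ('u \<Rightarrow> field) \<Rightarrow> (real \<Rightarrow> 'w \<Rightarrow> field) \<Rightarrow> bool" where
  "noise_process P F e W \<Phi> Z \<longleftrightarrow>
     (\<forall>t\<ge>0. (\<lambda>\<omega>. jet2 (Z t \<omega>)) \<in> borel_measurable (F t)) \<and>
     (AE \<omega> in P. (\<forall>t\<ge>0. Z t \<omega> \<in> Hk 2) \<and> continuous_on {0..} (\<lambda>t. jet2 (Z t \<omega>))) \<and>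
     (\<forall>t\<ge>0. Lp_fun 2 P (\<lambda>\<omega>. jet2 (Z t \<omega>)) \<and>
        ((\<lambda>K. Lp_norm 2 P (\<lambda>\<omega>. jet2 (Z t \<omega> - (\<Sum>k\<in>K. W k t \<omega> *\<^sub>R \<Phi> (e k))))) \<longlongrightarrow> 0)
          (finite_subsets_at_top UNIV))"

section \<open>The stochastic Stokes system and its Crank--Nicolson discretisation\<close>

text \<open>Throughout, \<open>Z\<close> stands for the process \<open>\<Phi>W\<close>.\<close>

definition stokes_velocity ::
  "'w measure \<Rightarrow> (real \<Rightarrow> 'w measure) \<Rightarrow> real \<Rightarrow> real \<Rightarrow> (real \<Rightarrow> 'w \<Rightarrow> field) \<Rightarrow> ('w \<Rightarrow> field) \<Rightarrow>
   (real \<Rightarrow> 'w \<Rightarrow> field) \<Rightarrow> bool" where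
  "stokes_velocity P F T \<nu> Z u0 u \<longleftrightarrow>
     (\<forall>t\<in>{0..T}. u t \<in> borel_measurable (F t)) \<and>
     (AE \<omega> in P.
        continuous_on {0..T} (\<lambda>t. u t \<omega>) \<and>
        (AE t in lebesgue_on {0..T}. u t \<omega> \<in> V) \<and>
        Lp_fun 2 (lebesgue_on {0..T}) (\<lambda>t. jet1 (u t \<omega>))) \<and>
     (AE \<omega> in P. \<forall>t\<in>{0..T}. \<forall>\<phi>\<in>V.
        inner (u t \<omega>) \<phi> - inner (u0 \<omega>) \<phi> =
          - \<nu> * (LINT s|lebesgue_on {0..t}. inner (grad (u s \<omega>)) (grad \<phi>)) + inner (Z t \<omega>) \<phi>)"

definition L2_C_H2 :: "'w measure \<Rightarrow> real \<Rightarrow> (real \<Rightarrow> 'w \<Rightarrow> field) \<Rightarrow> bool" where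
  "L2_C_H2 P T y \<longleftrightarrow>
     (\<forall>t\<in>{0..T}. (\<lambda>\<omega>. jet2 (y t \<omega>)) \<in> borel_measurable P) \<and>
     (AE \<omega> in P. (\<forall>t\<in>{0..T}. y t \<omega> \<in> Hk 2) \<and> continuous_on {0..T} (\<lambda>t. jet2 (y t \<omega>))) \<and>
     (\<integral>\<^sup>+\<omega>. (SUP t\<in>{0..T}. ennreal ((norm (jet2 (y t \<omega>)))\<^sup>2)) \<partial>P) < \<infinity>"

definition C1_L4_V ::
  "'w measure \<Rightarrow> real \<Rightarrow> (real \<Rightarrow> 'w \<Rightarrow> field) \<Rightarrow> (real \<Rightarrow> 'w \<Rightarrow> field) \<Rightarrow> bool" where
  "C1_L4_V P T y y' \<longleftrightarrow>
     (\<forall>t\<in>{0..T}. AE \<omega> in P. y t \<omega> \<in> V \<and> y' t \<omega> \<in> V) \<and>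
     Lp_C1_on 4 P {0..T} (\<lambda>t \<omega>. jet1 (y t \<omega>)) (\<lambda>t \<omega>. jet1 (y' t \<omega>))"

text \<open>By linearity, \<open>\<Phi>\<close> applied to a finite linear combination of values of \<open>W\<close> is the same combination
  of values of \<open>Z\<close>; so the quadrature and correction terms of the scheme are formed from \<open>Z\<close>.\<close>

definition noise_average :: "(real \<Rightarrow> 'w \<Rightarrow> field) \<Rightarrow> real \<Rightarrow> nat \<Rightarrow> nat \<Rightarrow> 'w \<Rightarrow> field" where
  "noise_average Z \<tau> M n \<omega> = \<tau> *\<^sub>R (\<Sum>l = 1..M. Z (real n * \<tau> + real l * \<tau>\<^sup>2) \<omega>)"

definition noise_correction :: "(real \<Rightarrow> 'w \<Rightarrow> field) \<Rightarrow> real \<Rightarrow> nat \<Rightarrow> nat \<Rightarrow> 'w \<Rightarrow> field" where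
  "noise_correction Z \<tau> M n \<omega> =
     noise_average Z \<tau> M n \<omega> - (1/2) *\<^sub>R (Z (real (Suc n) * \<tau>) \<omega> + Z (real n * \<tau>) \<omega>)"

definition crank_nicolson ::
  "'w measure \<Rightarrow> real \<Rightarrow> (real \<Rightarrow> 'w \<Rightarrow> field) \<Rightarrow> ('w \<Rightarrow> field) \<Rightarrow> real \<Rightarrow> nat \<Rightarrow> nat \<Rightarrow>
   (nat \<Rightarrow> 'w \<Rightarrow> field) \<Rightarrow> (nat \<Rightarrow> 'w \<Rightarrow> l2_torus) \<Rightarrow> bool" where
  "crank_nicolson P \<nu> Z u0 \<tau> M N un pn \<longleftrightarrow>
     (AE \<omega> in P. un 0 \<omega> = u0 \<omega> \<and>
       (\<forall>n<N. un (Suc n) \<omega> \<in> Hk 1 \<and> pn (Suc n) \<omega> \<in> Q \<and>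
         (\<forall>\<phi>\<in>Hk 1. \<forall>q\<in>Q.
            inner ((un (Suc n) \<omega> - un n \<omega>) /\<^sub>R \<tau>) \<phi>
            + \<nu> * inner (grad ((1/2) *\<^sub>R (un (Suc n) \<omega> + un n \<omega>) + noise_correction Z \<tau> M n \<omega>)) (grad \<phi>)
            - inner (pn (Suc n) \<omega>) (divergence \<phi>)
              = (1/\<tau>) * inner (Z (real (Suc n) * \<tau>) \<omega> - Z (real n * \<tau>) \<omega>) \<phi> \<and>
            inner (divergence (un (Suc n) \<omega>)) q = 0)))"

end

theory Submission
  imports Defs
begin

text \<open>Subtracting the scheme from the weak equation and testing with the mean of two consecutive errors
  gives, path by path, an energy inequality whose right-hand side is the local defect
  \<open>\<tau> (\<nabla>y(t\<^sub>n) + \<nabla>y(t\<^sub>n\<^sub>+\<^sub>1)) / 2 - \<integral>\<nabla>y\<close> plus \<open>\<tau>\<^sup>2 \<Sum>\<^sub>l \<nabla>Z(t\<^sub>n\<^sub>,\<^sub>l) - \<integral>\<nabla>Z\<close>. The first part is \<open>O(\<tau>\<^bsup>5/2\<^esup>)\<close>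
  in mean square by the Hoelder continuity of \<open>\<partial>\<^sub>t y\<close> and the symmetry of the trapezoidal rule, the
  second because the covariance of \<open>\<nabla>Z\<close> is a multiple of \<open>min s t\<close>, so that its increments over
  disjoint cells are uncorrelated.

  No Bochner integral in time is formed: integrals of scalar products are limits of midpoint sums,
  the mean-square bounds are proved for these finite sums, and Fatou's lemma transfers them to
  the limit. The numerical solution need not be measurable, so the integrals
  of its errors are only used through monotonicity and superadditivity.

  That weak derivatives are unique, hence that \<open>weak_deriv\<close> is linear, and that \<open>l2_torus\<close> is
  separable, hence that sums and inner products of random fields are measurable, both follow
  from the density of trigonometric polynomials.\<close>

section \<open>Square-integrable functions on the torus and bounded multipliers\<close>

text \<open>The order 3 is a count of powers. Young's inequality absorbs half of the dissipation at
  the price of a factor \<open>1 / \<tau>\<close>; a defect of mean square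
  \<open>O(\<tau> ^ 5)\<close> thus costs \<open>O(\<tau> ^ 4)\<close> per step, and
  \<open>T / \<tau>\<close> steps leave \<open>O(\<tau> ^ 3)\<close>. The defect does not contain
  the error, so no Gronwall argument and no exponential constant enter. The two claimed bounds are
  the two terms on the left of the same summed inequality.

  The correction in the scheme subtracts the trapezoidal mean of the noise, which cancels the one
  contained in the mean error: only \<open>y\<close>, not \<open>u\<close>, is smooth enough in time
  for the trapezoidal rule. What is left of the noise is a Riemann sum of step
  \<open>\<tau>\<^sup>2\<close>; its error has variance of order
  \<open>\<tau> * (\<tau>\<^sup>2)\<^sup>2\<close>, which matches the trapezoidal part.

  The obstacle is that \<open>y\<close> is differentiable in time only in the mean, while the energy
  argument runs along paths. The defect is therefore merely tested against gradients on each path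
  and its size is measured only in the mean; finite midpoint sums serve both purposes.\<close>

lemma second_countable_if_countable_dense:
  fixes D :: "'a::metric_space set"
  assumes "countable D" and "closure D = UNIV"
  shows "\<exists>B :: 'a set set. countable B \<and> open = generate_topology B"
proof -
  define B where "B = (\<lambda>(d, n). ball d (1 / Suc n)) ` (D \<times> (UNIV :: nat set))"
  have "topological_basis B"
  proof (rule topological_basisI)
    fix U and x :: 'a
    assume "open U" "x \<in> U"
    then obtain \<epsilon> where \<epsilon>: "\<epsilon> > 0" "ball x \<epsilon> \<subseteq> U"
      using open_contains_ball by blast
    obtain n :: nat where n: "1 / Suc n < \<epsilon> / 2"
      using \<epsilon>(1) nat_approx_posE[of "\<epsilon> / 2"] by auto
    have "x \<in> closure D"
      using assms(2) by simp
    then obtain d where d: "d \<in> D" "dist d x < 1 / Suc n"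
      unfolding closure_approachable by (metis of_nat_0_less_iff zero_less_Suc zero_less_divide_1_iff)
    have "ball d (1 / Suc n) \<subseteq> ball x \<epsilon>"
    proof
      fix z assume "z \<in> ball d (1 / Suc n)"
      then have "dist d z < 1 / Suc n" by simp
      then have "dist x z < \<epsilon>"
        using d(2) n dist_triangle[of x z d] by (simp add: dist_commute)
      then show "z \<in> ball x \<epsilon>" by simp
    qed
    with d \<epsilon>(2) show "\<exists>B'\<in>B. x \<in> B' \<and> B' \<subseteq> U"
      unfolding B_def by (intro bexI[of _ "ball d (1 / Suc n)"]) auto
  qed (auto simp: B_def)
  moreover have "countable B"
    unfolding B_def using assms(1) by auto
  ultimately show ?thesis
    using topological_basis_imp_subbasis by blast
qed

text \<open>Without \<open>metric_space\<close> in the argument sort, this arity would clash with the first countability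
  that \<open>vec\<close> inherits from being a metric space.\<close>

instance vec :: ("{metric_space, second_countable_topology}", finite) second_countable_topology
proof
  obtain C :: "'a set set" where C: "countable C" "topological_basis C"
    using ex_countable_basis by blast
  define B where "B = (\<lambda>A. {y :: 'a ^ 'b. \<forall>i. y $ i \<in> A i}) ` (PiE UNIV (\<lambda>_. C))"
  have "topological_basis B"
  proof (rule topological_basisI)
    fix S assume "S \<in> B"
    then obtain A where "A \<in> PiE UNIV (\<lambda>_. C)" "S = {y. \<forall>i. y $ i \<in> A i}"
      unfolding B_def by blast
    then show "open S"
      using C(2) unfolding open_vec_def topological_basis_def
      by (auto intro!: exI[of _ A])
  next
    fix U and x :: "'a ^ 'b"
    assume "open U" "x \<in> U"
    then obtain A where A: "\<And>i. open (A i) \<and> x $ i \<in> A i" "\<And>y. \<forall>i. y $ i \<in> A i \<Longrightarrow> y \<in> U"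
      unfolding open_vec_def by blast
    have "\<exists>c. c \<in> C \<and> x $ i \<in> c \<and> c \<subseteq> A i" for i
      using C(2) A(1)[of i] by (meson topological_basisE)
    then obtain c where c: "\<And>i. c i \<in> C \<and> x $ i \<in> c i \<and> c i \<subseteq> A i"
      by metis
    show "\<exists>B'\<in>B. x \<in> B' \<and> B' \<subseteq> U"
      unfolding B_def using c A(2)
      by (intro bexI[of _ "{y. \<forall>i. y $ i \<in> c i}"]) (auto simp: subset_iff)
  qed
  moreover have "countable B"
    unfolding B_def by (intro countable_image countable_PiE) (auto simp: C(1))
  ultimately show "\<exists>B :: ('a ^ 'b) set set. countable B \<and> open = generate_topology B"
    using topological_basis_imp_subbasis by blast
qed

section \<open>Representatives of square-integrable classes\<close>

lemma space_torus: "space torus = cbox 0 1"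
  by (simp add: torus_def)

lemma measurable_torus: "f \<in> borel_measurable borel \<Longrightarrow> f \<in> borel_measurable torus"
  unfolding torus_def by (intro measurable_restrict_space1) simp

lemma finite_measure_torus: "finite_measure torus"
  unfolding torus_def using emeasure_lborel_cbox_finite[of 0 "1 :: real^2"]
  by (intro finite_measureI) (auto simp: emeasure_restrict_space)

text \<open>The value zero off the square-integrable functions makes this a total map onto the
  quotient, so that operations on classes can be computed on representatives.\<close>

lift_definition l2_of :: "(real^2 \<Rightarrow> real) \<Rightarrow> l2_torus"
  is "\<lambda>f. if square_integrable f then f else (\<lambda>_. 0)"
  by (auto simp: l2_eq_def square_integrable_zero)

lemma l2_torus_cases:
  obtains f where "square_integrable f" "F = l2_of f"
proof -
  have "\<exists>f. square_integrable f \<and> F = l2_of f"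
  proof -
    obtain f where f: "l2_eq f f" "F = abs_l2_torus f"
      using Quotient_rep_abs_eq by (metis Quotient_l2_torus Quotient_def)
    then show ?thesis
      by (intro exI[of _ f]) (auto simp: l2_of.abs_eq l2_eq_def l2_of_def)
  qed
  with that show ?thesis by blast
qed

lemma l2_of_eq:
  assumes "square_integrable f" "square_integrable g" "AE x in torus. f x = g x"
  shows "l2_of f = l2_of g"
  using assms by transfer (simp add: l2_eq_def)

lemma inner_l2_of:
  "square_integrable f \<Longrightarrow> square_integrable g \<Longrightarrow> inner (l2_of f) (l2_of g) = (LINT x|torus. f x * g x)"
  by transfer simp

lemma norm_l2_of_sq: "square_integrable f \<Longrightarrow> (norm (l2_of f))\<^sup>2 = (LINT x|torus. (f x)\<^sup>2)"
  unfolding power2_norm_eq_inner by (simp add: inner_l2_of power2_eq_square)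

lemma l2_of_add:
  assumes "square_integrable f" "square_integrable g"
  shows "l2_of f + l2_of g = l2_of (\<lambda>x. f x + g x)"
  using assms square_integrable_add[OF assms] by transfer (auto simp: l2_eq_def)

lemma l2_of_diff:
  assumes "square_integrable f" "square_integrable g"
  shows "l2_of f - l2_of g = l2_of (\<lambda>x. f x - g x)"
  using assms square_integrable_diff[OF assms] by transfer (auto simp: l2_eq_def)

lemma l2_of_scale:
  assumes "square_integrable f"
  shows "c *\<^sub>R l2_of f = l2_of (\<lambda>x. c * f x)"
  using assms square_integrable_scale[OF assms, of c] by transfer (auto simp: l2_eq_def)

text \<open>The bound is asked for at every point of the plane; trigonometric functions and
  indicators satisfy it, and products need no exceptional null sets.\<close>

definition bdd_torus :: "(real^2 \<Rightarrow> real) \<Rightarrow> bool" where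
  "bdd_torus m \<longleftrightarrow> m \<in> borel_measurable torus \<and> (\<exists>C. \<forall>x. \<bar>m x\<bar> \<le> C)"

lemma bdd_torus_const [simp]: "bdd_torus (\<lambda>_. c)"
  unfolding bdd_torus_def by auto

lemma bdd_torus_add: "bdd_torus m \<Longrightarrow> bdd_torus n \<Longrightarrow> bdd_torus (\<lambda>x. m x + n x)"
  unfolding bdd_torus_def by (auto, metis abs_triangle_ineq add_mono order_trans)

lemma bdd_torus_mult:
  assumes "bdd_torus m" "bdd_torus n"
  shows "bdd_torus (\<lambda>x. m x * n x)"
proof -
  obtain C D where C: "\<And>x. \<bar>m x\<bar> \<le> C" "\<And>x. \<bar>n x\<bar> \<le> D"
    using assms unfolding bdd_torus_def by blast
  have "\<bar>m x * n x\<bar> \<le> C * D" for x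
    unfolding abs_mult by (intro mult_mono C) (use C(1)[of x] in auto)
  then show ?thesis
    using assms unfolding bdd_torus_def by (auto intro!: exI[of _ "C * D"])
qed

lemma bdd_torus_indicator: "A \<in> sets borel \<Longrightarrow> bdd_torus (indicator A)"
  unfolding bdd_torus_def by (auto intro!: measurable_torus exI[of _ 1] simp: indicator_def)

lemma square_integrable_bdd_mult:
  assumes "bdd_torus m" "square_integrable f"
  shows "square_integrable (\<lambda>x. m x * f x)"
proof -
  obtain C where C: "\<And>x. \<bar>m x\<bar> \<le> C"
    using assms unfolding bdd_torus_def by blast
  have "integrable torus (\<lambda>x. (m x * f x)\<^sup>2)"
  proof (rule Bochner_Integration.integrable_bound)
    show "integrable torus (\<lambda>x. C\<^sup>2 * (f x)\<^sup>2)"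
      using assms(2) by (simp add: square_integrable_def)
    have "(m x)\<^sup>2 \<le> C\<^sup>2" for x
      using C[of x] by (metis abs_ge_zero power2_abs power_mono)
    then show "AE x in torus. norm ((m x * f x)\<^sup>2) \<le> norm (C\<^sup>2 * (f x)\<^sup>2)"
      by (simp add: power_mult_distrib mult_right_mono)
  qed (use assms in \<open>auto simp: bdd_torus_def square_integrable_def\<close>)
  then show ?thesis
    using assms by (auto simp: bdd_torus_def square_integrable_def)
qed

lemma square_integrable_bdd: "bdd_torus m \<Longrightarrow> square_integrable m"
  using square_integrable_bdd_mult[of m "\<lambda>_. 1"]
    finite_measure.integrable_const[OF finite_measure_torus, of "1 :: real"]
  by (simp add: square_integrable_def)

lift_definition l2_mult :: "(real^2 \<Rightarrow> real) \<Rightarrow> l2_torus \<Rightarrow> l2_torus"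
  is "\<lambda>m f. if bdd_torus m then (\<lambda>x. m x * f x) else (\<lambda>_. 0)"
  by (auto simp: l2_eq_def square_integrable_zero intro: square_integrable_bdd_mult)

lemma l2_mult_of:
  "bdd_torus m \<Longrightarrow> square_integrable f \<Longrightarrow> l2_mult m (l2_of f) = l2_of (\<lambda>x. m x * f x)"
  using square_integrable_bdd_mult[of m f] by transfer (auto simp: l2_eq_def)

lemma l2_mult_const: "l2_mult (\<lambda>_. c) F = c *\<^sub>R F"
  by (cases F rule: l2_torus_cases) (simp add: l2_mult_of l2_of_scale)

lemma l2_mult_add:
  "bdd_torus m \<Longrightarrow> bdd_torus n \<Longrightarrow> l2_mult (\<lambda>x. m x + n x) F = l2_mult m F + l2_mult n F"
  by (cases F rule: l2_torus_cases)
    (simp add: l2_mult_of l2_of_add square_integrable_bdd_mult bdd_torus_add distrib_right)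

lemma l2_mult_mult:
  "bdd_torus m \<Longrightarrow> bdd_torus n \<Longrightarrow> l2_mult (\<lambda>x. m x * n x) F = l2_mult m (l2_mult n F)"
  by (cases F rule: l2_torus_cases)
    (simp add: l2_mult_of square_integrable_bdd_mult bdd_torus_mult mult.assoc)

lemma l2_mult_diff_right: "bdd_torus m \<Longrightarrow> l2_mult m (F - G) = l2_mult m F - l2_mult m G"
  by (cases F rule: l2_torus_cases, cases G rule: l2_torus_cases)
    (simp add: l2_mult_of square_integrable_bdd_mult l2_of_diff square_integrable_diff right_diff_distrib)

text \<open>Dominated convergence for \<open>(h n x - f x)\<^sup>2\<close> with majorant
  \<open>(2 * g x)\<^sup>2\<close>: the limit \<open>f\<close> inherits the bound
  \<open>g\<close>.\<close>

lemma tendsto_l2_dominated: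
  assumes g: "square_integrable g" and f: "square_integrable f" and h: "\<And>n. square_integrable (h n)"
    and bound: "\<And>n x. x \<in> space torus \<Longrightarrow> \<bar>h n x\<bar> \<le> g x"
    and lim: "\<And>x. x \<in> space torus \<Longrightarrow> (\<lambda>n. h n x) \<longlonglongrightarrow> f x"
  shows "(\<lambda>n. l2_of (h n)) \<longlonglongrightarrow> l2_of f"
proof -
  have "(\<lambda>n. LINT x|torus. (h n x - f x)\<^sup>2) \<longlonglongrightarrow> (LINT x|torus. 0)"
  proof (rule integral_dominated_convergence)
    show "integrable torus (\<lambda>x. (2 * g x)\<^sup>2)"
      using square_integrable_scale[OF g, of 2] by (simp add: square_integrable_def)
    show "(\<lambda>x. (h n x - f x)\<^sup>2) \<in> borel_measurable torus" for n
      using h[of n] f by (auto simp: square_integrable_def)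
    show "AE x in torus. (\<lambda>n. (h n x - f x)\<^sup>2) \<longlonglongrightarrow> 0"
    proof (rule AE_I2)
      fix x assume "x \<in> space torus"
      from tendsto_power[OF tendsto_diff[OF lim[OF this] tendsto_const[of "f x"]], of 2]
      show "(\<lambda>n. (h n x - f x)\<^sup>2) \<longlonglongrightarrow> 0" by simp
    qed
    show "AE x in torus. norm ((h n x - f x)\<^sup>2) \<le> (2 * g x)\<^sup>2" for n
    proof (rule AE_I2)
      fix x assume x: "x \<in> space torus"
      have "\<bar>f x\<bar> \<le> g x"
        by (rule tendsto_upperbound[OF tendsto_rabs[OF lim[OF x]]]) (auto simp: bound x)
      then have "\<bar>h n x - f x\<bar> \<le> 2 * g x"
        using bound[OF x, of n] by simp
      then have "(h n x - f x)\<^sup>2 \<le> (2 * g x)\<^sup>2"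
        by (metis abs_ge_zero power2_abs power_mono)
      then show "norm ((h n x - f x)\<^sup>2) \<le> (2 * g x)\<^sup>2" by simp
    qed
  qed simp
  then have "(\<lambda>n. (norm (l2_of (h n) - l2_of f))\<^sup>2) \<longlonglongrightarrow> 0"
    by (simp add: l2_of_diff h f norm_l2_of_sq square_integrable_diff)
  then have "(\<lambda>n. sqrt ((norm (l2_of (h n) - l2_of f))\<^sup>2)) \<longlonglongrightarrow> sqrt 0"
    by (rule tendsto_real_sqrt)
  then show ?thesis
    by (simp add: LIM_zero_iff tendsto_norm_zero_iff)
qed

lemma tendsto_l2_mult:
  assumes m: "bdd_torus m" and n: "\<And>k. bdd_torus (n k)"
    and bound: "\<And>k x. x \<in> space torus \<Longrightarrow> \<bar>n k x\<bar> \<le> C"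
    and lim: "\<And>x. x \<in> space torus \<Longrightarrow> (\<lambda>k. n k x) \<longlonglongrightarrow> m x"
  shows "(\<lambda>k. l2_mult (n k) F) \<longlonglongrightarrow> l2_mult m F"
proof (cases F rule: l2_torus_cases)
  case (1 f)
  have "square_integrable (\<lambda>x. \<bar>f x\<bar>)"
    using 1(1) by (auto simp: square_integrable_def)
  then have "square_integrable (\<lambda>x. C * \<bar>f x\<bar>)"
    by (rule square_integrable_scale)
  then have "(\<lambda>k. l2_of (\<lambda>x. n k x * f x)) \<longlonglongrightarrow> l2_of (\<lambda>x. m x * f x)"
  proof (rule tendsto_l2_dominated)
    show "\<bar>n k x * f x\<bar> \<le> C * \<bar>f x\<bar>" if "x \<in> space torus" for k x
      using bound[OF that, of k] by (simp add: abs_mult mult_right_mono)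
    show "(\<lambda>k. n k x * f x) \<longlonglongrightarrow> m x * f x" if "x \<in> space torus" for x
      by (intro tendsto_intros lim that)
  qed (use 1 m n in \<open>auto intro: square_integrable_bdd_mult\<close>)
  then show ?thesis
    using 1 m n by (simp add: l2_mult_of)
qed

lemma continuous_on_l2_mult:
  assumes "bdd_torus m"
  shows "continuous_on UNIV (l2_mult m)"
proof -
  obtain C where C: "\<And>x. \<bar>m x\<bar> \<le> C"
    using assms unfolding bdd_torus_def by blast
  have C0: "C \<ge> 0" using C[of 0] by simp
  have bound: "norm (l2_mult m F) \<le> C * norm F" for F
  proof (cases F rule: l2_torus_cases)
    case (1 f)
    have "(LINT x|torus. (m x * f x)\<^sup>2) \<le> (LINT x|torus. C\<^sup>2 * (f x)\<^sup>2)"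
    proof (rule integral_mono)
      have "(m x)\<^sup>2 \<le> C\<^sup>2" for x
        using C[of x] by (metis abs_ge_zero power2_abs power_mono)
      then show "(m x * f x)\<^sup>2 \<le> C\<^sup>2 * (f x)\<^sup>2" for x
        by (simp add: power_mult_distrib mult_right_mono)
    qed (use square_integrable_bdd_mult[OF assms 1(1)] 1(1) in \<open>auto simp: square_integrable_def\<close>)
    then have "(norm (l2_mult m F))\<^sup>2 \<le> (C * norm F)\<^sup>2"
      using 1 assms by (simp add: l2_mult_of norm_l2_of_sq square_integrable_bdd_mult power_mult_distrib)
    then show ?thesis
      using C0 by (meson mult_nonneg_nonneg norm_ge_zero power2_le_imp_le)
  qed
  show ?thesis
  proof (rule continuous_on_iff[THEN iffD2], intro ballI allI impI)
    fix F :: l2_torus and \<epsilon> :: real assume "\<epsilon> > 0"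
    show "\<exists>d>0. \<forall>G\<in>UNIV. dist G F < d \<longrightarrow> dist (l2_mult m G) (l2_mult m F) < \<epsilon>"
    \<comment> \<open>\<open>C\<close> may vanish, hence the denominator
      \<open>C + 1\<close>.\<close>
    proof (intro exI[of _ "\<epsilon> / (C + 1)"] conjI ballI impI)
      show "\<epsilon> / (C + 1) > 0" using \<open>\<epsilon> > 0\<close> C0 by simp
      fix G assume *: "dist G F < \<epsilon> / (C + 1)"
      have "dist (l2_mult m G) (l2_mult m F) \<le> C * dist G F"
        using bound[of "G - F"] assms by (simp add: dist_norm l2_mult_diff_right)
      also have "\<dots> \<le> (C + 1) * dist G F" by (simp add: mult_right_mono)
      also have "\<dots> < \<epsilon>" using * C0 by (simp add: field_simps)
      finally show "dist (l2_mult m G) (l2_mult m F) < \<epsilon>" .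
    qed
  qed
qed

section \<open>Density of trigonometric polynomials\<close>

definition circ :: "bool \<Rightarrow> 2 \<Rightarrow> real^2 \<Rightarrow> real" where
  "circ b i x = (if b then cos (2 * pi * x $ i) else sin (2 * pi * x $ i))"

text \<open>In the applications \<open>K\<close> is a set of constants. Rational constants keep the
  algebra countable, which gives separability; all real constants make it stable under
  differentiation, which gives test functions. Products supply the higher harmonics.\<close>

inductive_set trig_poly :: "(real^2 \<Rightarrow> real) set \<Rightarrow> (real^2 \<Rightarrow> real) set"
  for K where
  base: "f \<in> K \<Longrightarrow> f \<in> trig_poly K"
| circ: "circ b i \<in> trig_poly K"
| add: "f \<in> trig_poly K \<Longrightarrow> g \<in> trig_poly K \<Longrightarrow> (\<lambda>x. f x + g x) \<in> trig_poly K"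
| mult: "f \<in> trig_poly K \<Longrightarrow> g \<in> trig_poly K \<Longrightarrow> (\<lambda>x. f x * g x) \<in> trig_poly K"

lemma countable_trig_poly:
  assumes "countable K"
  shows "countable (trig_poly K)"
proof -
  define step where "step A = A \<union> (\<lambda>(f, g) x. f x + g x) ` (A \<times> A) \<union> (\<lambda>(f, g) x. f x * g x) ` (A \<times> A)"
    for A :: "(real^2 \<Rightarrow> real) set"
  define L where "L n = (step ^^ n) (K \<union> range (\<lambda>(b, i). circ b i))" for n
  have L_mono: "f \<in> L m \<Longrightarrow> m \<le> n \<Longrightarrow> f \<in> L n" for f m n
    by (rule subsetD[OF lift_Suc_mono_le[of L]]) (auto simp: L_def step_def)
  have "countable (L n)" for n
    by (induction n) (auto simp: L_def step_def assms)
  moreover have "f \<in> (\<Union>n. L n)" if "f \<in> trig_poly K" for f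
    using that
  proof induction
    case (base f)
    then have "f \<in> L 0" by (simp add: L_def)
    then show ?case by blast
  next
    case (circ b i)
    have "circ b i \<in> L 0" by (auto simp: L_def intro: rev_image_eqI[of "(b, i)"])
    then show ?case by blast
  next
    case (add f g)
    then obtain m n where "f \<in> L m" "g \<in> L n" by blast
    then have "f \<in> L (max m n)" "g \<in> L (max m n)"
      by (auto intro: L_mono)
    then have "(\<lambda>x. f x + g x) \<in> L (Suc (max m n))"
      by (auto simp: L_def step_def intro!: rev_image_eqI[of "(f, g)"])
    then show ?case by blast
  next
    case (mult f g)
    then obtain m n where "f \<in> L m" "g \<in> L n" by blast
    then have "f \<in> L (max m n)" "g \<in> L (max m n)"
      by (auto intro: L_mono)
    then have "(\<lambda>x. f x * g x) \<in> L (Suc (max m n))"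
      by (auto simp: L_def step_def intro!: rev_image_eqI[of "(f, g)"])
    then show ?case by blast
  qed
  ultimately show ?thesis
    by (meson countable_UN countable_subset countableI_type subsetI)
qed

definition rat_trig :: "(real^2 \<Rightarrow> real) set" where
  "rat_trig = trig_poly ((\<lambda>q _. q) ` \<rat>)"

lemma bdd_torus_circ: "bdd_torus (circ b i)"
proof -
  have "circ b i \<in> borel_measurable borel"
    unfolding circ_def by (cases b) (auto intro!: borel_measurable_continuous_onI continuous_intros)
  then show ?thesis
    unfolding bdd_torus_def by (auto intro!: measurable_torus exI[of _ 1] simp: circ_def)
qed

lemma bdd_torus_rat_trig: "f \<in> rat_trig \<Longrightarrow> bdd_torus f"
  unfolding rat_trig_def
proof (induction rule: trig_poly.induct)
  case (base f)
  then obtain q where "f = (\<lambda>_. q)" by blast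
  then show ?case by simp
next
  case (circ b i)
  show ?case by (rule bdd_torus_circ)
next
  case (add f g)
  show ?case by (rule bdd_torus_add[OF add.IH])
next
  case (mult f g)
  show ?case by (rule bdd_torus_mult[OF mult.IH])
qed

definition trig_closure :: "l2_torus set" where
  "trig_closure = closure (l2_of ` rat_trig)"

lemma trig_closureI: "f \<in> rat_trig \<Longrightarrow> l2_of f \<in> trig_closure"
  unfolding trig_closure_def by (rule subsetD[OF closure_subset imageI])

lemma trig_closure_seq:
  "F \<in> trig_closure \<longleftrightarrow> (\<exists>f. (\<forall>n. f n \<in> rat_trig) \<and> (\<lambda>n. l2_of (f n)) \<longlonglongrightarrow> F)"
proof
  assume "F \<in> trig_closure"
  then obtain X where X: "\<forall>n. X n \<in> l2_of ` rat_trig" "X \<longlonglongrightarrow> F"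
    unfolding trig_closure_def closure_sequential by blast
  then obtain f where f: "\<And>n. f n \<in> rat_trig \<and> X n = l2_of (f n)"
    unfolding image_iff by metis
  then have "X = (\<lambda>n. l2_of (f n))" by auto
  with X(2) f show "\<exists>f. (\<forall>n. f n \<in> rat_trig) \<and> (\<lambda>n. l2_of (f n)) \<longlonglongrightarrow> F"
    by auto
next
  assume "\<exists>f. (\<forall>n. f n \<in> rat_trig) \<and> (\<lambda>n. l2_of (f n)) \<longlonglongrightarrow> F"
  then obtain f where "\<And>n. f n \<in> rat_trig" "(\<lambda>n. l2_of (f n)) \<longlonglongrightarrow> F"
    by blast
  then show "F \<in> trig_closure"
    unfolding trig_closure_def closure_sequential by (intro exI[of _ "\<lambda>n. l2_of (f n)"]) auto
qed

lemma trig_closure_lim: "(\<And>n. X n \<in> trig_closure) \<Longrightarrow> X \<longlonglongrightarrow> F \<Longrightarrow> F \<in> trig_closure"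
  unfolding trig_closure_def by (meson closed_closure closed_sequentially)

lemma rat_trig_bdd_sq: "f \<in> rat_trig \<Longrightarrow> square_integrable f"
  by (intro square_integrable_bdd bdd_torus_rat_trig)

lemma trig_closure_add:
  assumes "F \<in> trig_closure" "G \<in> trig_closure"
  shows "F + G \<in> trig_closure"
proof -
  obtain f g where fg: "\<And>n. f n \<in> rat_trig" "(\<lambda>n. l2_of (f n)) \<longlonglongrightarrow> F"
    "\<And>n. g n \<in> rat_trig" "(\<lambda>n. l2_of (g n)) \<longlonglongrightarrow> G"
    using assms unfolding trig_closure_seq by blast
  have "(\<lambda>n. l2_of (\<lambda>x. f n x + g n x)) \<longlonglongrightarrow> F + G"
    using tendsto_add[OF fg(2,4)] by (simp add: l2_of_add rat_trig_bdd_sq fg)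
  then show ?thesis
    using fg(1,3) unfolding trig_closure_seq rat_trig_def
    by (intro exI[of _ "\<lambda>n x. f n x + g n x"]) (auto intro: trig_poly.add)
qed

lemma const_rat_trig: "q \<in> \<rat> \<Longrightarrow> (\<lambda>_. q) \<in> rat_trig"
  unfolding rat_trig_def by (auto intro: trig_poly.base)

lemma rat_trig_mult: "f \<in> rat_trig \<Longrightarrow> g \<in> rat_trig \<Longrightarrow> (\<lambda>x. f x * g x) \<in> rat_trig"
  unfolding rat_trig_def by (rule trig_poly.mult)

text \<open>Only rational constants belong to \<open>rat_trig\<close>, so a real scalar is
  approximated by rationals simultaneously with \<open>F\<close>.\<close>

lemma trig_closure_scale:
  assumes "F \<in> trig_closure"
  shows "c *\<^sub>R F \<in> trig_closure"
proof -
  obtain f where f: "\<And>n. f n \<in> rat_trig" "(\<lambda>n. l2_of (f n)) \<longlonglongrightarrow> F"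
    using assms unfolding trig_closure_seq by blast
  have "c \<in> closure \<rat>" by (simp add: Rats_closure_real)
  then obtain q where q: "\<And>n. q n \<in> \<rat>" "q \<longlonglongrightarrow> c"
    unfolding closure_sequential by blast
  have "(\<lambda>n. l2_of (\<lambda>x. q n * f n x)) \<longlonglongrightarrow> c *\<^sub>R F"
    using tendsto_scaleR[OF q(2) f(2)] by (simp add: l2_of_scale rat_trig_bdd_sq f)
  then show ?thesis
    using rat_trig_mult[OF const_rat_trig[OF q(1)] f(1)] unfolding trig_closure_seq
    by (intro exI[of _ "\<lambda>n x. q n * f n x"]) auto
qed

lemma trig_closure_sum: "(\<And>i. i \<in> I \<Longrightarrow> F i \<in> trig_closure) \<Longrightarrow> (\<Sum>i\<in>I. F i) \<in> trig_closure"
proof (induction I rule: infinite_finite_induct)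
  case (insert i I)
  then show ?case by (auto intro: trig_closure_add)
qed (use trig_closureI[OF const_rat_trig[of 0]] trig_closure_scale[of _ 0] in auto)

text \<open>The multipliers of the closure of the trigonometric polynomials form an algebra that is stable
  under bounded pointwise limits; hence their indicators form a \<open>\<sigma>\<close>-algebra, which is seen
  to contain every Borel set.\<close>

definition multiplier :: "(real^2 \<Rightarrow> real) \<Rightarrow> bool" where
  "multiplier m \<longleftrightarrow> bdd_torus m \<and> (\<forall>F\<in>trig_closure. l2_mult m F \<in> trig_closure)"

lemma multiplier_const: "multiplier (\<lambda>_. c)"
  by (simp add: multiplier_def l2_mult_const trig_closure_scale)

lemma multiplier_add: "multiplier m \<Longrightarrow> multiplier n \<Longrightarrow> multiplier (\<lambda>x. m x + n x)"
  by (simp add: multiplier_def bdd_torus_add l2_mult_add trig_closure_add)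

lemma multiplier_mult: "multiplier m \<Longrightarrow> multiplier n \<Longrightarrow> multiplier (\<lambda>x. m x * n x)"
  by (simp add: multiplier_def bdd_torus_mult l2_mult_mult)

lemma multiplier_power: "multiplier m \<Longrightarrow> multiplier (\<lambda>x. m x ^ (k::nat))"
  by (induction k) (auto intro: multiplier_const multiplier_mult)

lemma multiplier_sum: "(\<And>i. i \<in> I \<Longrightarrow> multiplier (m i)) \<Longrightarrow> multiplier (\<lambda>x. \<Sum>i\<in>I. m i x)"
  by (induction I rule: infinite_finite_induct) (auto intro: multiplier_const multiplier_add)

lemma multiplier_circ: "multiplier (circ b i)"
proof -
  have "l2_mult (circ b i) F \<in> trig_closure" if "F \<in> trig_closure" for F
  proof -
    obtain f where f: "\<And>n. f n \<in> rat_trig" "(\<lambda>n. l2_of (f n)) \<longlonglongrightarrow> F"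
      using \<open>F \<in> trig_closure\<close> unfolding trig_closure_seq by blast
    have "(\<lambda>n. l2_mult (circ b i) (l2_of (f n))) \<longlonglongrightarrow> l2_mult (circ b i) F"
      using continuous_on_tendsto_compose[OF continuous_on_l2_mult[OF bdd_torus_circ] f(2)] by simp
    then have "(\<lambda>n. l2_of (\<lambda>x. circ b i x * f n x)) \<longlonglongrightarrow> l2_mult (circ b i) F"
      by (simp add: l2_mult_of bdd_torus_circ rat_trig_bdd_sq f)
    then show ?thesis
      using f(1) unfolding trig_closure_seq rat_trig_def
      by (intro exI[of _ "\<lambda>n x. circ b i x * f n x"]) (auto intro: trig_poly.intros)
  qed
  then show ?thesis
    by (simp add: multiplier_def bdd_torus_circ)
qed

text \<open>By dominated convergence the products \<open>l2_mult (n k) F\<close> converge to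
  \<open>l2_mult m F\<close>, and \<open>trig_closure\<close> is closed.\<close>

lemma multiplier_lim:
  assumes "\<And>k. multiplier (n k)" "bdd_torus m"
    and "\<And>k x. x \<in> space torus \<Longrightarrow> \<bar>n k x\<bar> \<le> C"
    and "\<And>x. x \<in> space torus \<Longrightarrow> (\<lambda>k. n k x) \<longlonglongrightarrow> m x"
  shows "multiplier m"
  unfolding multiplier_def
proof (intro conjI ballI)
  fix F assume "F \<in> trig_closure"
  then show "l2_mult m F \<in> trig_closure"
    using assms by (intro trig_closure_lim[OF _ tendsto_l2_mult[of m n C]]) (auto simp: multiplier_def)
qed fact

lemma circ_range: "circ b i x \<in> {-1..1}"
  by (auto simp: circ_def)

text \<open>The ramps \<open>c k\<close> tend pointwise to the indicator and vanish up to and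
  including \<open>d\<close>. Weierstrass replaces the ramp \<open>c k\<close> by a polynomial
  within \<open>1 / Suc k\<close> on the range of \<open>circ\<close>. The bound 2 is 1 for the ramp
  plus an error of at most 1.\<close>

lemma polynomial_approx_indicator_greater:
  fixes d :: real
  shows "\<exists>p. (\<forall>k. real_polynomial_function (p k)) \<and> (\<forall>k. \<forall>t\<in>{-1..1}. \<bar>p k t\<bar> \<le> 2) \<and>
    (\<forall>t\<in>{-1..1}. (\<lambda>k. p k t) \<longlonglongrightarrow> (indicator {d<..} t :: real))"
proof -
  define c where "c k t = min 1 (max 0 (real k * (t - d)))" for k t
  have "\<exists>p. real_polynomial_function p \<and> (\<forall>t\<in>{-1..1}. \<bar>c k t - p t\<bar> < 1 / Suc k)" for k
  proof -
    have "continuous_on {-1..1} (c k)"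
      unfolding c_def by (intro continuous_intros)
    from Stone_Weierstrass_real_polynomial_function[OF compact_Icc this, of "1 / Suc k"]
    show ?thesis by (metis of_nat_0_less_iff zero_less_Suc zero_less_divide_1_iff)
  qed
  then obtain p where p: "\<And>k. real_polynomial_function (p k)"
    "\<And>k t. t \<in> {-1..1} \<Longrightarrow> \<bar>c k t - p k t\<bar> < 1 / Suc k"
    by metis
  have "\<bar>p k t\<bar> \<le> 2" if "t \<in> {-1..1}" for k t
  proof -
    have "0 \<le> c k t" "c k t \<le> 1" "1 / real (Suc k) \<le> 1"
      by (auto simp: c_def)
    with p(2)[OF that, of k] show ?thesis by linarith
  qed
  moreover have "(\<lambda>k. p k t) \<longlonglongrightarrow> indicator {d<..} t" if t: "t \<in> {-1..1}" for t
  proof -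
    have "(\<lambda>k. c k t) \<longlonglongrightarrow> indicator {d<..} t"
    proof (cases "t > d")
      case True
      obtain k0 :: nat where k0: "1 / (t - d) < k0"
        using reals_Archimedean2 by blast
      have "c k t = 1" if "k \<ge> k0" for k
      proof -
        have "1 < real k0 * (t - d)"
          using k0 True by (simp add: field_simps)
        also have "\<dots> \<le> real k * (t - d)"
          using that True by (intro mult_right_mono) auto
        finally show ?thesis by (simp add: c_def)
      qed
      then have "eventually (\<lambda>k. c k t = indicator {d<..} t) sequentially"
        using True by (auto simp: eventually_sequentially)
      then show ?thesis by (rule tendsto_eventually)
    next
      case False
      then have "real k * (t - d) \<le> 0" for k
        by (simp add: mult_nonneg_nonpos)
      then have "c k t = 0" for k
        by (simp add: c_def max_absorb1)
      then show ?thesis using False by simp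
    qed
    moreover have "(\<lambda>k. c k t - p k t) \<longlonglongrightarrow> 0"
    proof (rule tendsto_rabs_zero_cancel, rule tendsto_sandwich[OF _ _ tendsto_const])
      show "(\<lambda>k. 1 / real (Suc k)) \<longlonglongrightarrow> 0"
        by (rule LIMSEQ_Suc[OF lim_1_over_n])
      show "\<forall>\<^sub>F k in sequentially. \<bar>c k t - p k t\<bar> \<le> 1 / real (Suc k)"
        using less_imp_le[OF p(2)[OF t]] by (intro always_eventually allI)
    qed auto
    ultimately show ?thesis
      using tendsto_diff[of "\<lambda>k. c k t" _ sequentially "\<lambda>k. c k t - p k t" 0] by simp
  qed
  ultimately show ?thesis using p(1) by blast
qed

text \<open>Polynomials in a multiplier are multipliers, and the indicator of a superlevel set is a
  bounded pointwise limit of such polynomials.\<close>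

lemma multiplier_circ_greater: "multiplier (indicator {x. d < circ b i x})"
proof -
  obtain p where p: "\<And>k. real_polynomial_function (p k)"
    "\<And>k t. t \<in> {-1..1} \<Longrightarrow> \<bar>p k t\<bar> \<le> (2 :: real)"
    "\<And>t. t \<in> {-1..1} \<Longrightarrow> (\<lambda>k. p k t) \<longlonglongrightarrow> indicator {d<..} t"
    using polynomial_approx_indicator_greater[of d] by blast
  show ?thesis
  proof (rule multiplier_lim[where n = "\<lambda>k x. p k (circ b i x)" and C = 2])
    fix k
    obtain a n where "p k = (\<lambda>t. \<Sum>i\<le>(n::nat). a i * t ^ i)"
      using p(1)[of k] unfolding real_polynomial_function_iff_sum by blast
    then show "multiplier (\<lambda>x. p k (circ b i x))"
      by (auto intro!: multiplier_sum multiplier_mult multiplier_power multiplier_circ multiplier_const)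
  next
    have "{x. d < circ b i x} \<in> sets borel"
      unfolding circ_def by (cases b) (auto intro!: borel_open open_Collect_less continuous_intros)
    then show "bdd_torus (indicator {x. d < circ b i x})"
      by (rule bdd_torus_indicator)
  next
    fix x
    show "(\<lambda>k. p k (circ b i x)) \<longlonglongrightarrow> indicator {x. d < circ b i x} x"
      using p(3)[OF circ_range] by (simp add: indicator_def)
  qed (use p(2) circ_range in auto)
qed

definition mult_sets :: "(real^2) set set" where
  "mult_sets = {A \<in> sets borel. multiplier (indicator A)}"

text \<open>Complements correspond to one minus the indicator, finite unions to products of
  indicators of complements, and countable unions are bounded pointwise limits of finite
  ones.\<close>

lemma sigma_algebra_mult_sets: "sigma_algebra UNIV mult_sets"
  unfolding sigma_algebra_iff2
proof (intro conjI ballI allI impI)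
  show "mult_sets \<subseteq> Pow UNIV" by simp
  show "{} \<in> mult_sets"
    using multiplier_const[of 0] by (simp add: mult_sets_def indicator_def[abs_def])
  have compl: "UNIV - A \<in> mult_sets" if "A \<in> mult_sets" for A
  proof -
    have "multiplier (\<lambda>x. 1 + (-1) * indicator A x)"
      using that by (intro multiplier_add multiplier_mult multiplier_const) (simp add: mult_sets_def)
    moreover have "(\<lambda>x. 1 + (-1) * indicator A x) = (indicator (UNIV - A) :: real^2 \<Rightarrow> real)"
      by (auto simp: indicator_def)
    ultimately show ?thesis using that by (auto simp: mult_sets_def Compl_eq_Diff_UNIV[symmetric])
  qed
  then show "UNIV - A \<in> mult_sets" if "A \<in> mult_sets" for A
    using that .
  fix A :: "nat \<Rightarrow> (real^2) set" assume "range A \<subseteq> mult_sets"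
  then have A: "\<And>n. A n \<in> mult_sets" by blast
  have Un: "(\<Union>i<n. A i) \<in> mult_sets" for n
  proof (induction n)
    case (Suc n)
    have "multiplier (\<lambda>x. 1 + (-1) * (indicator (UNIV - A n) x * indicator (UNIV - (\<Union>i<n. A i)) x))"
      using compl[OF Suc] compl[OF A, of n]
      by (intro multiplier_add multiplier_mult multiplier_const) (auto simp: mult_sets_def)
    moreover have "(\<lambda>x. 1 + (-1) * (indicator (UNIV - A n) x * indicator (UNIV - (\<Union>i<n. A i)) x)) =
        (indicator (\<Union>i<Suc n. A i) :: real^2 \<Rightarrow> real)"
      by (rule ext) (auto split: split_indicator simp: less_Suc_eq)
    ultimately show ?case
      using A by (auto simp: mult_sets_def)
  qed (use \<open>{} \<in> mult_sets\<close> in simp)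
  have "multiplier (indicator (\<Union>i. A i))"
  proof (rule multiplier_lim[where n = "\<lambda>n. indicator (\<Union>i<n. A i)" and C = 1])
    show "bdd_torus (indicator (\<Union>i. A i))"
      using A by (intro bdd_torus_indicator) (auto simp: mult_sets_def)
    show "(\<lambda>n. indicator (\<Union>i<n. A i) x) \<longlonglongrightarrow> (indicator (\<Union>i. A i) x :: real)" for x
      by (rule LIMSEQ_indicator_UN)
  qed (use Un in \<open>auto simp: mult_sets_def indicator_def\<close>)
  then show "(\<Union>i. A i) \<in> mult_sets"
    using A by (auto simp: mult_sets_def)
qed

text \<open>The functions \<open>circ\<close> take equal values on opposite edges of the closed
  cell. Off a null set a point lies in the half-open cell, whose points they separate.\<close>

lemma AE_torus_less_1: "AE x in torus. x $ i < 1"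
proof -
  have "negligible {x :: real^2. x $ i = 1}"
    using negligible_standard_hyperplane[of "axis i (1 :: real)" 1]
    by (simp add: inner_axis axis_in_Basis_iff)
  moreover have "closed {x :: real^2. x $ i = 1}"
    by (intro closed_Collect_eq continuous_intros)
  ultimately have "{x :: real^2. x $ i = 1} \<in> null_sets lborel"
    by (simp add: negligible_iff_null_sets null_sets_completion_iff borel_closed)
  from AE_not_in[OF this] have "AE x in (lborel :: (real^2) measure). x $ i \<noteq> 1"
    by simp
  then show ?thesis
    unfolding torus_def by (subst AE_restrict_space_iff) (auto simp: mem_box_cart less_le)
qed

text \<open>\<open>arccos\<close> inverts the cosine on the first half of the period; a negative
  sine marks the second half, which is reflected by \<open>1 - t\<close>.\<close>

lemma recover_coordinate:
  assumes "0 \<le> t" "t < 1"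
  shows "t = (if sin (2 * pi * t) \<ge> 0 then arccos (cos (2 * pi * t)) / (2 * pi)
    else 1 - arccos (cos (2 * pi * t)) / (2 * pi))"
proof (cases "t \<le> 1 / 2")
  case True
  have "sin (2 * pi * t) \<ge> 0"
    using assms True by (intro sin_ge_zero) auto
  moreover have "arccos (cos (2 * pi * t)) = 2 * pi * t"
    using assms True by (intro arccos_cos) auto
  ultimately show ?thesis by simp
next
  case False
  have "2 * pi * t < 2 * pi * 1"
    using assms by (intro mult_strict_left_mono) auto
  moreover have "2 * pi * (1 / 2) < 2 * pi * t"
    using False by (intro mult_strict_left_mono) auto
  ultimately have "sin (2 * pi * t) < 0"
    by (intro sin_lt_zero) auto
  moreover have "cos (2 * pi * t) = cos (2 * pi * (1 - t))"
    using cos_2pi_minus[of "2 * pi * t"] by (simp add: right_diff_distrib)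
  moreover have "arccos (cos (2 * pi * (1 - t))) = 2 * pi * (1 - t)"
    using assms False by (intro arccos_cos) auto
  ultimately show ?thesis by simp
qed

text \<open>The map \<open>H\<close> rebuilds a point from the values of \<open>circ\<close>. It is
  therefore measurable for the \<sigma>-algebra of multiplier sets, and it is the identity almost
  everywhere on the cell. Hence \<open>A\<close> coincides up to a null set with its preimage under
  \<open>H\<close>, and \<open>l2_mult\<close> does not see null sets.\<close>

lemma multiplier_borel:
  assumes "A \<in> sets borel"
  shows "multiplier (indicator A)"
proof -
  define M where "M = sigma UNIV mult_sets"
  interpret S: sigma_algebra UNIV mult_sets by (rule sigma_algebra_mult_sets)
  have M: "space M = UNIV" "sets M = mult_sets"
    unfolding M_def by (simp_all add: S.sigma_sets_eq)
  have meas [measurable]: "circ b i \<in> borel_measurable M" for b i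
    unfolding borel_measurable_iff_greater M
  proof (intro allI)
    fix d
    have "{x. d < circ b i x} \<in> sets borel"
      unfolding circ_def by (cases b) (auto intro!: borel_open open_Collect_less continuous_intros)
    then show "{w \<in> UNIV. d < circ b i w} \<in> mult_sets"
      using multiplier_circ_greater by (simp add: mult_sets_def)
  qed
  \<comment> \<open>Clipping the argument makes \<open>ac\<close> continuous on the whole line,
    hence Borel; on the range of the cosine it is \<open>arccos\<close>.\<close>
  define ac where "ac t = arccos (max (-1) (min 1 t))" for t :: real
  have "continuous_on UNIV ac"
    unfolding ac_def by (intro continuous_on_arccos continuous_intros) auto
  then have [measurable]: "ac \<in> borel_measurable borel"
    by (rule borel_measurable_continuous_onI)
  define h where "h i x = (if circ False i x \<ge> 0 then ac (circ True i x) / (2 * pi)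
    else 1 - ac (circ True i x) / (2 * pi))" for i x
  have [measurable]: "h i \<in> borel_measurable M" for i
    unfolding h_def by measurable
  define H where "H x = (\<chi> i. h i x)" for x
  have "H = (\<lambda>x. \<Sum>i\<in>UNIV. h i x *\<^sub>R axis i 1)"
    unfolding H_def by (auto simp: vec_eq_iff axis_def if_distrib cong: if_cong)
  then have "H \<in> borel_measurable M" by simp
  from measurable_sets[OF this assms] have HA: "H -` A \<in> mult_sets"
    unfolding M by simp
  have h: "h i x = x $ i" if "x \<in> space torus" "x $ i < 1" for i x
  proof -
    have "ac (cos (2 * pi * x $ i)) = arccos (cos (2 * pi * x $ i))"
      by (simp add: ac_def)
    moreover have "0 \<le> x $ i"
      using that(1) by (simp add: space_torus mem_box_cart)
    ultimately show ?thesis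
      using recover_coordinate[of "x $ i", OF _ that(2), symmetric] unfolding h_def circ_def
      by (simp only: simp_thms if_True if_False)
  qed
  have "AE x in torus. \<forall>i. x $ i < 1"
    using AE_torus_less_1 by (simp add: AE_all_countable)
  then have eq: "AE x in torus. indicator A x = (indicator (H -` A) x :: real)"
  proof (rule AE_mp, intro AE_I2 impI)
    fix x :: "real^2" assume "x \<in> space torus" "\<forall>i. x $ i < 1"
    then have "H x = x" by (simp add: H_def h vec_eq_iff)
    then show "indicator A x = (indicator (H -` A) x :: real)"
      by (simp add: indicator_def)
  qed
  have bdd: "bdd_torus (indicator A)" "bdd_torus (indicator (H -` A))"
    using assms HA by (auto intro: bdd_torus_indicator simp: mult_sets_def)
  have "l2_mult (indicator A) F = l2_mult (indicator (H -` A)) F" for F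
  proof (cases F rule: l2_torus_cases)
    case (1 f)
    then show ?thesis
      using bdd eq by (auto simp: l2_mult_of square_integrable_bdd_mult intro!: l2_of_eq)
  qed
  then show ?thesis
    using HA bdd by (simp add: multiplier_def mult_sets_def)
qed

text \<open>The constant 1 is a trigonometric polynomial, and multiplying it by an indicator stays
  in the closure. Simple functions follow by linearity and all others by dominated
  convergence.\<close>

lemma trig_closure_eq_UNIV: "trig_closure = UNIV"
proof (intro equalityI subset_UNIV subsetI)
  fix F
  have ind: "l2_of (indicator A) \<in> trig_closure" if "A \<in> sets borel" for A
  proof -
    have "l2_mult (indicator A) (l2_of (\<lambda>_. 1)) \<in> trig_closure"
      using multiplier_borel[OF that] trig_closureI[OF const_rat_trig[of 1]]
      by (simp add: multiplier_def)
    then show ?thesis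
      by (simp add: l2_mult_of bdd_torus_indicator that square_integrable_bdd)
  qed
  obtain f where f: "square_integrable f" "F = l2_of f"
    by (rule l2_torus_cases)
  then have "f \<in> borel_measurable torus" by (simp add: square_integrable_def)
  \<comment> \<open>With 0 as base point the distance bound on the approximants becomes the majorant
    \<open>2 * \<bar>f x\<bar>\<close>.\<close>
  from borel_measurable_implies_sequence_metric[OF this, of 0]
  obtain G where G: "\<And>i. simple_function torus (G i)"
    "\<And>x. x \<in> space torus \<Longrightarrow> (\<lambda>i. G i x) \<longlonglongrightarrow> f x"
    "\<And>i x. x \<in> space torus \<Longrightarrow> \<bar>G i x\<bar> \<le> 2 * \<bar>f x\<bar>"
    unfolding dist_real_def diff_0_right by blast
  have sq: "square_integrable (\<lambda>x. 2 * \<bar>f x\<bar>)"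
    using f(1) by (intro square_integrable_scale) (auto simp: square_integrable_def)
  have simple: "square_integrable g \<and> l2_of g \<in> trig_closure" if g: "simple_function torus g" for g
  proof -
    define A where "A y = g -` {y} \<inter> space torus" for y
    have fin: "finite (g ` space torus)"
      using g by (simp add: simple_function_def)
    have A: "A y \<in> sets borel" for y
    proof -
      have "A y \<in> sets torus"
        unfolding A_def using borel_measurable_simple_function[OF g] by measurable
      then show ?thesis
        by (auto simp: torus_def sets_restrict_space)
    qed
    define s where "s x = (\<Sum>y\<in>g ` space torus. y * indicator (A y) x)" for x
    have *: "square_integrable (\<lambda>x. \<Sum>y\<in>Y. y * indicator (A y) x) \<and>
        l2_of (\<lambda>x. \<Sum>y\<in>Y. y * indicator (A y) x) = (\<Sum>y\<in>Y. y *\<^sub>R l2_of (indicator (A y)))"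
      if "finite Y" for Y
      using that
    proof induction
      case empty
      then show ?case
        using l2_of_scale[OF square_integrable_zero, of 0] by (simp add: square_integrable_zero)
    next
      case (insert y Y)
      have "square_integrable (\<lambda>x. y * indicator (A y) x)"
        by (intro square_integrable_scale square_integrable_bdd bdd_torus_indicator A)
      moreover have "(\<lambda>x. \<Sum>z\<in>insert y Y. z * indicator (A z) x) =
          (\<lambda>x. y * indicator (A y) x + (\<Sum>z\<in>Y. z * indicator (A z) x))"
        by (simp only: sum.insert[OF insert.hyps])
      ultimately show ?case
        using insert.hyps insert.IH l2_of_scale[OF square_integrable_bdd[OF bdd_torus_indicator[OF A]], of y y]
        by (simp only: l2_of_add[symmetric] square_integrable_add sum.insert simp_thms)
    qed
    have s: "square_integrable s" "l2_of s \<in> trig_closure"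
      using *[OF fin] by (auto simp: s_def[abs_def] intro!: trig_closure_sum trig_closure_scale ind A)
    have "g x = s x" if "x \<in> space torus" for x
    proof -
      have "s x = (\<Sum>y\<in>g ` space torus. if y = g x then y else 0)"
        unfolding s_def by (intro sum.cong) (auto simp: A_def that indicator_def)
      then show ?thesis using fin that by simp
    qed
    moreover have "square_integrable g"
      using s(1) borel_measurable_simple_function[OF g] calculation
      unfolding square_integrable_def by (auto cong: Bochner_Integration.integrable_cong)
    ultimately show ?thesis
      using s l2_of_eq[of g s] by auto
  qed
  have "(\<lambda>i. l2_of (G i)) \<longlonglongrightarrow> l2_of f"
    by (rule tendsto_l2_dominated[OF sq f(1)]) (use simple G in auto)
  then show "F \<in> trig_closure"
    using simple[OF G(1)] f(2) by (auto intro: trig_closure_lim[where X = "\<lambda>i. l2_of (G i)"])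
qed

instance l2_torus :: second_countable_topology
proof
  have "countable rat_trig"
    unfolding rat_trig_def by (intro countable_trig_poly countable_image countable_rat)
  then show "\<exists>B :: l2_torus set set. countable B \<and> open = generate_topology B"
    using trig_closure_eq_UNIV unfolding trig_closure_def
    by (intro second_countable_if_countable_dense[of "l2_of ` rat_trig"]) auto
qed

section \<open>Weak derivatives\<close>

lemma trig_poly_has_derivative:
  assumes "f \<in> trig_poly (range (\<lambda>c _. c))"
  shows "\<exists>g. (\<forall>x. (f has_derivative (\<lambda>h. \<Sum>j\<in>UNIV. g j x * h $ j)) (at x)) \<and>
    (\<forall>j. g j \<in> trig_poly (range (\<lambda>c _. c)))"
  using assms
proof induction
  case (base f)
  then obtain c where "f = (\<lambda>_. c)" by blast
  then show ?case by (intro exI[of _ "\<lambda>_ _. 0"]) (auto intro: trig_poly.base)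
next
  case (circ b i)
  define c where "c = (if b then - 2 * pi else 2 * pi)"
  define g where "g j = (if j = i then (\<lambda>x. c * circ (\<not> b) i x) else (\<lambda>_. 0))" for j
  have eq: "(\<Sum>j\<in>UNIV. g j x * h $ j) = c * circ (\<not> b) i x * h $ i" for x h
    by (simp add: g_def if_distrib[of "\<lambda>f. f x * _"] cong: if_cong)
  have "(circ b i has_derivative (\<lambda>h. \<Sum>j\<in>UNIV. g j x * h $ j)) (at x)" for x
    unfolding eq
  proof (cases b)
    case True
    have "((\<lambda>x. cos (2 * pi * x $ i)) has_derivative (\<lambda>h. - sin (2 * pi * x $ i) * (2 * pi * h $ i))) (at x)"
      by (auto intro!: derivative_eq_intros bounded_linear_imp_has_derivative
          bounded_linear_vec_nth simp: algebra_simps)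
    then show "(circ b i has_derivative (\<lambda>h. c * circ (\<not> b) i x * h $ i)) (at x)"
      using True by (simp add: circ_def[abs_def] c_def mult_ac)
  next
    case False
    have "((\<lambda>x. sin (2 * pi * x $ i)) has_derivative (\<lambda>h. cos (2 * pi * x $ i) * (2 * pi * h $ i))) (at x)"
      by (auto intro!: derivative_eq_intros bounded_linear_imp_has_derivative
          bounded_linear_vec_nth simp: algebra_simps)
    then show "(circ b i has_derivative (\<lambda>h. c * circ (\<not> b) i x * h $ i)) (at x)"
      using False by (simp add: circ_def[abs_def] c_def mult_ac)
  qed
  moreover have "g j \<in> trig_poly (range (\<lambda>c _. c))" for j
    unfolding g_def by (auto intro!: trig_poly.mult trig_poly.circ intro: trig_poly.base)
  ultimately show ?case by blast
next
  case (add f1 f2)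
  then obtain g1 g2 where "\<forall>x. (f1 has_derivative (\<lambda>h. \<Sum>j\<in>UNIV. g1 j x * h $ j)) (at x)"
    "\<forall>x. (f2 has_derivative (\<lambda>h. \<Sum>j\<in>UNIV. g2 j x * h $ j)) (at x)"
    "\<forall>j. g1 j \<in> trig_poly (range (\<lambda>c _. c))" "\<forall>j. g2 j \<in> trig_poly (range (\<lambda>c _. c))"
    by blast
  then show ?case
    by (intro exI[of _ "\<lambda>j x. g1 j x + g2 j x"])
      (auto simp: distrib_right sum.distrib intro!: has_derivative_add trig_poly.add)
next
  case (mult f1 f2)
  then obtain g1 g2 where g: "\<And>x. (f1 has_derivative (\<lambda>h. \<Sum>j\<in>UNIV. g1 j x * h $ j)) (at x)"
    "\<And>x. (f2 has_derivative (\<lambda>h. \<Sum>j\<in>UNIV. g2 j x * h $ j)) (at x)"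
    "\<And>j. g1 j \<in> trig_poly (range (\<lambda>c _. c))" "\<And>j. g2 j \<in> trig_poly (range (\<lambda>c _. c))"
    by blast
  have "((\<lambda>x. f1 x * f2 x) has_derivative (\<lambda>h. \<Sum>j\<in>UNIV. (f1 x * g2 j x + g1 j x * f2 x) * h $ j)) (at x)"
    for x
    by (rule has_derivative_eq_rhs[OF has_derivative_mult[OF g(1,2)]])
      (simp add: distrib_right sum.distrib sum_distrib_left sum_distrib_right distrib_left mult_ac)
  moreover have "(\<lambda>x. f1 x * g2 j x + g1 j x * f2 x) \<in> trig_poly (range (\<lambda>c _. c))" for j
    by (rule trig_poly.add[OF trig_poly.mult[OF mult.hyps(1) g(4)] trig_poly.mult[OF g(3) mult.hyps(2)]])
  ultimately show ?case
    by (intro exI[of _ "\<lambda>j x. f1 x * g2 j x + g1 j x * f2 x"]) blast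
qed

lemma partial_deriv_eqI:
  assumes "(f has_derivative (\<lambda>h. \<Sum>j\<in>UNIV. g j * h $ j)) (at x)"
  shows "partial_deriv i f x = g i"
  unfolding partial_deriv_def frechet_derivative_at[OF assms, symmetric]
  by (simp add: axis_def if_distrib cong: if_cong)

lemma trig_poly_k_times_cont_diff:
  "f \<in> trig_poly (range (\<lambda>c _. c)) \<Longrightarrow> k_times_cont_diff k f"
proof (induction k arbitrary: f)
  case 0
  then show ?case
    using trig_poly_has_derivative[OF 0]
    by (auto intro!: differentiable_imp_continuous_on differentiableI simp: differentiable_on_def
        intro: differentiable_at_withinI)
next
  case (Suc k)
  obtain g where g: "\<And>x. (f has_derivative (\<lambda>h. \<Sum>j\<in>UNIV. g j x * h $ j)) (at x)"
    "\<And>j. g j \<in> trig_poly (range (\<lambda>c _. c))"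
    using trig_poly_has_derivative[OF Suc.prems] by blast
  have "partial_deriv j f = g j" for j
    using partial_deriv_eqI[OF g(1)] by blast
  then show ?case
    using g by (auto intro: differentiableI Suc.IH)
qed

lemma trig_poly_periodic:
  "f \<in> trig_poly (range (\<lambda>c _. c)) \<Longrightarrow> f (x + axis j 1) = f x"
proof (induction rule: trig_poly.induct)
  case (circ b i)
  have "cos (2 * pi * (t + 1)) = cos (2 * pi * t)" "sin (2 * pi * (t + 1)) = sin (2 * pi * t)" for t
    by (simp_all add: distrib_left)
  then show ?case by (simp add: circ_def axis_def)
qed auto

lemma trig_poly_mono: "f \<in> trig_poly K \<Longrightarrow> K \<subseteq> L \<Longrightarrow> f \<in> trig_poly L"
  by (induction rule: trig_poly.induct) (auto intro: trig_poly.intros)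

lemma test_function_rat_trig:
  assumes "f \<in> rat_trig"
  shows "test_function f"
proof -
  have "f \<in> trig_poly (range (\<lambda>c _. c))"
    using assms unfolding rat_trig_def by (rule trig_poly_mono) auto
  then show ?thesis
    by (simp add: test_function_def trig_poly_k_times_cont_diff trig_poly_periodic)
qed

lemma square_integrable_continuous:
  assumes "continuous_on UNIV f"
  shows "square_integrable f"
proof -
  have "continuous_on (cbox 0 1) (\<lambda>x. (f x)\<^sup>2)"
    by (intro continuous_intros continuous_on_subset[OF assms]) auto
  then have "compact ((\<lambda>x. (f x)\<^sup>2) ` cbox 0 1)"
    by (rule compact_continuous_image) simp
  then obtain B where B: "\<And>x. x \<in> cbox 0 1 \<Longrightarrow> norm ((f x)\<^sup>2) \<le> B"
    using bounded_iff compact_imp_bounded by (metis image_eqI)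
  have f: "f \<in> borel_measurable torus"
    by (intro measurable_torus borel_measurable_continuous_onI assms)
  then have "integrable torus (\<lambda>x. (f x)\<^sup>2)"
    by (intro finite_measure.integrable_const_bound[OF finite_measure_torus, where B = B] AE_I2)
      (use B in \<open>auto simp: space_torus\<close>)
  with f show ?thesis by (simp add: square_integrable_def)
qed

lemma test_function_square_integrable:
  assumes "test_function \<phi>"
  shows "square_integrable \<phi>" "square_integrable (partial_deriv j \<phi>)"
proof -
  have "k_times_cont_diff 0 \<phi>" "k_times_cont_diff (Suc 0) \<phi>"
    using assms unfolding test_function_def by blast+
  then show "square_integrable \<phi>" "square_integrable (partial_deriv j \<phi>)"
    by (auto intro: square_integrable_continuous)
qed

text \<open>In this form the defining identity is visibly linear in \<open>F\<close> and
  \<open>G\<close>, and linearity and uniqueness of weak derivatives become statements about inner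
  products.\<close>

lemma has_weak_deriv_iff:
  "has_weak_deriv j F G \<longleftrightarrow>
    (\<forall>\<phi>. test_function \<phi> \<longrightarrow> inner F (l2_of (partial_deriv j \<phi>)) = - inner G (l2_of \<phi>))"
proof -
  obtain f g where "square_integrable f" "F = l2_of f" "square_integrable g" "G = l2_of g"
    using l2_torus_cases by metis
  moreover from calculation have "has_weak_deriv j F G \<longleftrightarrow> (\<forall>\<phi>. test_function \<phi> \<longrightarrow>
      (LINT x|torus. f x * partial_deriv j \<phi> x) = - (LINT x|torus. g x * \<phi> x))"
    by (simp, transfer, simp)
  ultimately show ?thesis
    by (simp add: inner_l2_of test_function_square_integrable)
qed

text \<open>\<open>F\<close> is itself a limit of rational trigonometric polynomials, so
  \<open>inner F F\<close> is a limit of zeros.\<close>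

lemma inner_rat_trig_eq_0:
  assumes "\<And>\<phi>. \<phi> \<in> rat_trig \<Longrightarrow> inner F (l2_of \<phi>) = 0"
  shows "F = 0"
proof -
  have "F \<in> trig_closure" by (simp add: trig_closure_eq_UNIV)
  then obtain f where f: "\<And>n. f n \<in> rat_trig" "(\<lambda>n. l2_of (f n)) \<longlonglongrightarrow> F"
    unfolding trig_closure_seq by blast
  have "(\<lambda>n. inner F (l2_of (f n))) \<longlonglongrightarrow> inner F F"
    by (intro tendsto_intros f)
  then have "(\<lambda>n. 0) \<longlonglongrightarrow> inner F F"
    using assms[OF f(1)] by simp
  then show ?thesis
    by (metis LIMSEQ_const_iff inner_eq_zero_iff)
qed

lemma has_weak_deriv_unique:
  assumes "has_weak_deriv j F G" "has_weak_deriv j F H"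
  shows "G = H"
proof -
  have "inner (G - H) (l2_of \<phi>) = 0" if "\<phi> \<in> rat_trig" for \<phi>
    using assms test_function_rat_trig[OF that] unfolding has_weak_deriv_iff inner_diff_left
    by (metis add.inverse_inverse right_minus_eq)
  from inner_rat_trig_eq_0[OF this] show ?thesis by simp
qed

lemma weak_deriv_eqI: "has_weak_deriv j F G \<Longrightarrow> weak_deriv j F = G"
  unfolding weak_deriv_def by (rule the_equality) (auto intro: has_weak_deriv_unique)

lemma has_weak_deriv_weak_deriv:
  assumes "F \<in> sobolev (Suc k)"
  shows "has_weak_deriv j F (weak_deriv j F)"
proof -
  obtain G where "has_weak_deriv j F G"
    using assms by auto
  then show ?thesis using weak_deriv_eqI by metis
qed

section \<open>Linearity of weak derivatives, gradients and jets\<close>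

lemma has_weak_deriv_add:
  "has_weak_deriv j F F' \<Longrightarrow> has_weak_deriv j G G' \<Longrightarrow> has_weak_deriv j (F + G) (F' + G')"
  by (simp add: has_weak_deriv_iff inner_add_left)

lemma has_weak_deriv_scale: "has_weak_deriv j F F' \<Longrightarrow> has_weak_deriv j (c *\<^sub>R F) (c *\<^sub>R F')"
  by (simp add: has_weak_deriv_iff)

lemma has_weak_deriv_zero: "has_weak_deriv j 0 0"
  by (simp add: has_weak_deriv_iff)

lemma weak_deriv_add:
  "F \<in> sobolev (Suc k) \<Longrightarrow> G \<in> sobolev (Suc k) \<Longrightarrow>
    weak_deriv j (F + G) = weak_deriv j F + weak_deriv j G"
  by (intro weak_deriv_eqI has_weak_deriv_add has_weak_deriv_weak_deriv)

lemma weak_deriv_scale: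
  "F \<in> sobolev (Suc k) \<Longrightarrow> weak_deriv j (c *\<^sub>R F) = c *\<^sub>R weak_deriv j F"
  by (intro weak_deriv_eqI has_weak_deriv_scale has_weak_deriv_weak_deriv)

lemma subspace_sobolev: "subspace (sobolev k)"
proof (induction k)
  case (Suc k)
  show ?case
  proof (rule subspaceI)
    show "0 \<in> sobolev (Suc k)"
      using weak_deriv_eqI[OF has_weak_deriv_zero] has_weak_deriv_zero subspace_0[OF Suc] by auto
    show "F + G \<in> sobolev (Suc k)" if FG: "F \<in> sobolev (Suc k)" "G \<in> sobolev (Suc k)" for F G
    proof -
      have "weak_deriv j (F + G) \<in> sobolev k" for j
        using FG by (subst weak_deriv_add[OF FG]) (auto intro: subspace_add[OF Suc])
      then show ?thesis
        using has_weak_deriv_add[OF FG[THEN has_weak_deriv_weak_deriv]] by auto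
    qed
    show "c *\<^sub>R F \<in> sobolev (Suc k)" if F: "F \<in> sobolev (Suc k)" for c F
    proof -
      have "weak_deriv j (c *\<^sub>R F) \<in> sobolev k" for j
        using F by (subst weak_deriv_scale[OF F]) (auto intro: subspace_scale[OF Suc])
      then show ?thesis
        using has_weak_deriv_scale[OF F[THEN has_weak_deriv_weak_deriv]] by auto
    qed
  qed
qed simp

lemma sobolev_Suc: "F \<in> sobolev (Suc k) \<Longrightarrow> F \<in> sobolev k"
  by (induction k arbitrary: F) auto

lemma subspace_Hk: "subspace (Hk k)"
  by (rule subspaceI)
    (auto simp: Hk_def subspace_0[OF subspace_sobolev] subspace_add[OF subspace_sobolev]
      subspace_scale[OF subspace_sobolev])

lemma Hk_2_imp_1: "v \<in> Hk 2 \<Longrightarrow> v \<in> Hk 1"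
  unfolding Hk_def numeral_2_eq_2 One_nat_def using sobolev_Suc by blast

lemma grad_add: "v \<in> Hk 1 \<Longrightarrow> w \<in> Hk 1 \<Longrightarrow> grad (v + w) = grad v + grad w"
  by (auto simp: grad_def vec_eq_iff Hk_def weak_deriv_add[where k = 0])

lemma grad_scale: "v \<in> Hk 1 \<Longrightarrow> grad (c *\<^sub>R v) = c *\<^sub>R grad v"
  by (auto simp: grad_def vec_eq_iff Hk_def weak_deriv_scale[where k = 0])

lemma grad_diff: "v \<in> Hk 1 \<Longrightarrow> w \<in> Hk 1 \<Longrightarrow> grad (v - w) = grad v - grad w"
  using grad_add[of v "(-1) *\<^sub>R w"] grad_scale[of w "-1"] subspace_scale[OF subspace_Hk, of w 1 "-1"]
  by simp

lemma grad_zero: "grad 0 = 0"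
  using grad_scale[OF subspace_0[OF subspace_Hk], of 0] by simp

lemma grad_sum: "(\<And>i. i \<in> I \<Longrightarrow> v i \<in> Hk 1) \<Longrightarrow> grad (\<Sum>i\<in>I. v i) = (\<Sum>i\<in>I. grad (v i))"
  by (induction I rule: infinite_finite_induct)
    (auto simp: grad_zero grad_add subspace_sum[OF subspace_Hk])

lemma Hk_2_weak_deriv: "v \<in> Hk 2 \<Longrightarrow> weak_deriv j (v $ i) \<in> sobolev (Suc 0)"
  by (auto simp: Hk_def numeral_2_eq_2)

lemma Hk_2_nth: "v \<in> Hk 2 \<Longrightarrow> v $ i \<in> sobolev (Suc (Suc 0))"
  by (simp add: Hk_def numeral_2_eq_2)

lemma hess_add: "v \<in> Hk 2 \<Longrightarrow> w \<in> Hk 2 \<Longrightarrow> hess (v + w) = hess v + hess w"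
  by (simp add: hess_def vec_eq_iff weak_deriv_add[OF Hk_2_nth Hk_2_nth]
      weak_deriv_add[OF Hk_2_weak_deriv Hk_2_weak_deriv])

lemma hess_scale: "v \<in> Hk 2 \<Longrightarrow> hess (c *\<^sub>R v) = c *\<^sub>R hess v"
  by (simp add: hess_def vec_eq_iff weak_deriv_scale[OF Hk_2_nth]
      weak_deriv_scale[OF Hk_2_weak_deriv])

lemma jet2_add: "v \<in> Hk 2 \<Longrightarrow> w \<in> Hk 2 \<Longrightarrow> jet2 (v + w) = jet2 v + jet2 w"
  by (simp add: jet2_def grad_add[OF Hk_2_imp_1 Hk_2_imp_1] hess_add)

lemma jet2_scale: "v \<in> Hk 2 \<Longrightarrow> jet2 (c *\<^sub>R v) = c *\<^sub>R jet2 v"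
  by (simp add: jet2_def grad_scale[OF Hk_2_imp_1] hess_scale)

lemma jet2_diff: "v \<in> Hk 2 \<Longrightarrow> w \<in> Hk 2 \<Longrightarrow> jet2 (v - w) = jet2 v - jet2 w"
  using jet2_add[of v "(-1) *\<^sub>R w"] jet2_scale[of w "-1"] subspace_scale[OF subspace_Hk, of w 2 "-1"]
  by simp

lemma jet2_sum: "(\<And>i. i \<in> I \<Longrightarrow> v i \<in> Hk 2) \<Longrightarrow> jet2 (\<Sum>i\<in>I. v i) = (\<Sum>i\<in>I. jet2 (v i))"
  using jet2_scale[OF subspace_0[OF subspace_Hk], of 0]
  by (induction I rule: infinite_finite_induct) (auto simp: jet2_add subspace_sum[OF subspace_Hk])

lemma divergence_grad: "divergence v = (\<Sum>i\<in>UNIV. grad v $ i $ i)"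
  by (simp add: divergence_def grad_def)

lemma V_iff: "v \<in> V \<longleftrightarrow> v \<in> Hk 1 \<and> (\<Sum>i\<in>UNIV. grad v $ i $ i) = 0"
  by (simp add: V_def divergence_grad)

lemma subspace_V: "subspace V"
proof (rule subspaceI)
  show "0 \<in> V"
    by (simp add: V_iff subspace_0[OF subspace_Hk] grad_zero)
  show "v + w \<in> V" if "v \<in> V" "w \<in> V" for v w
    using that by (auto simp: V_iff subspace_add[OF subspace_Hk] grad_add sum.distrib)
  show "c *\<^sub>R v \<in> V" if "v \<in> V" for c v
    using that by (auto simp: V_iff subspace_scale[OF subspace_Hk] grad_scale scaleR_right.sum[symmetric])
qed

lemma torus_integral_eq_inner: "torus_integral F = inner F (l2_of (\<lambda>_. 1))"
proof -
  obtain f where "square_integrable f" "F = l2_of f"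
    by (rule l2_torus_cases)
  moreover from calculation have "torus_integral F = (LINT x|torus. f x)"
    by (simp, transfer, simp)
  ultimately show ?thesis
    by (simp add: inner_l2_of square_integrable_bdd)
qed

text \<open>Each weak derivative is tested with the constant 1, whose partial derivatives vanish.
  The divergence of a numerical velocity is thus an admissible \<open>q\<close> in the
  scheme.\<close>

lemma divergence_in_Q:
  assumes "v \<in> Hk 1"
  shows "divergence v \<in> Q"
proof -
  have "inner (weak_deriv i (v $ i)) (l2_of (\<lambda>_. 1)) = 0" for i
  proof -
    have "has_weak_deriv i (v $ i) (weak_deriv i (v $ i))"
      using assms by (intro has_weak_deriv_weak_deriv[of _ 0]) (simp add: Hk_def)
    moreover have "test_function (\<lambda>_. 1)"
      by (intro test_function_rat_trig const_rat_trig) simp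
    ultimately have "inner (v $ i) (l2_of (partial_deriv i (\<lambda>_. 1))) =
        - inner (weak_deriv i (v $ i)) (l2_of (\<lambda>_. 1))"
      unfolding has_weak_deriv_iff by blast
    moreover have "partial_deriv i (\<lambda>_. 1) = (\<lambda>_. 0)"
      by (simp add: partial_deriv_def[abs_def])
    moreover have "l2_of (\<lambda>_. 0) = 0"
      using l2_of_scale[OF square_integrable_zero, of 0] by simp
    ultimately show ?thesis by simp
  qed
  then show ?thesis
    by (simp add: Q_def torus_integral_eq_inner divergence_def inner_sum_left)
qed

section \<open>Mean-square inner product and covariance of the noise\<close>

lemma Lp_fun_2_inner_integrable:
  fixes X Y :: "'w \<Rightarrow> 'x::{real_inner, second_countable_topology}"
  assumes "Lp_fun 2 P X" "Lp_fun 2 P Y"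
  shows "integrable P (\<lambda>\<omega>. inner (X \<omega>) (Y \<omega>))"
proof (rule Bochner_Integration.integrable_bound)
  show "integrable P (\<lambda>\<omega>. (norm (X \<omega>))\<^sup>2 + (norm (Y \<omega>))\<^sup>2)"
    using assms by (simp add: Lp_fun_def)
  show "(\<lambda>\<omega>. inner (X \<omega>) (Y \<omega>)) \<in> borel_measurable P"
    using assms by (auto simp: Lp_fun_def)
  have "\<bar>inner a b\<bar> \<le> (norm a)\<^sup>2 + (norm b)\<^sup>2" for a b :: 'x
  proof -
    have "2 * (norm a * norm b) \<le> (norm a)\<^sup>2 + (norm b)\<^sup>2"
      using sum_squares_bound[of "norm a" "norm b"] by simp
    moreover have "0 \<le> norm a * norm b" by simp
    ultimately show ?thesis
      using Cauchy_Schwarz_ineq2[of a b] by linarith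
  qed
  then show "AE \<omega> in P. norm (inner (X \<omega>) (Y \<omega>)) \<le> norm ((norm (X \<omega>))\<^sup>2 + (norm (Y \<omega>))\<^sup>2)"
    by (simp add: abs_of_nonneg)
qed

lemma Lp_fun_2_add:
  fixes X Y :: "'w \<Rightarrow> 'x::{real_inner, second_countable_topology}"
  assumes "Lp_fun 2 P X" "Lp_fun 2 P Y"
  shows "Lp_fun 2 P (\<lambda>\<omega>. X \<omega> + Y \<omega>)"
proof -
  have "(norm (a + b))\<^sup>2 = (norm a)\<^sup>2 + (norm b)\<^sup>2 + 2 * inner a b" for a b :: 'x
    by (simp add: power2_norm_eq_inner inner_add_left inner_add_right inner_commute)
  then show ?thesis
    using assms Lp_fun_2_inner_integrable[OF assms] by (auto simp: Lp_fun_def)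
qed

lemma Lp_fun_2_scale: "Lp_fun 2 P X \<Longrightarrow> Lp_fun 2 P (\<lambda>\<omega>. c *\<^sub>R X \<omega>)"
  for X :: "'w \<Rightarrow> 'x::{real_inner, second_countable_topology}"
  by (auto simp: Lp_fun_def power_mult_distrib)

lemma Lp_fun_2_diff:
  fixes X Y :: "'w \<Rightarrow> 'x::{real_inner, second_countable_topology}"
  assumes "Lp_fun 2 P X" "Lp_fun 2 P Y"
  shows "Lp_fun 2 P (\<lambda>\<omega>. X \<omega> - Y \<omega>)"
  using Lp_fun_2_add[OF assms(1) Lp_fun_2_scale[OF assms(2), of "-1"]] by simp

lemma Lp_fun_2_sum:
  fixes X :: "'i \<Rightarrow> 'w \<Rightarrow> 'x::{real_inner, second_countable_topology}"
  assumes "\<And>i. i \<in> I \<Longrightarrow> Lp_fun 2 P (X i)"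
  shows "Lp_fun 2 P (\<lambda>\<omega>. \<Sum>i\<in>I. X i \<omega>)"
  using assms
proof (induction I rule: infinite_finite_induct)
  case (insert i I)
  then show ?case by (simp add: Lp_fun_2_add)
qed (simp_all add: Lp_fun_def)

text \<open>The mean-square inner product is taken on random fields themselves and not on classes,
  so it is only positive semidefinite.\<close>

definition L2_inner :: "'w measure \<Rightarrow> ('w \<Rightarrow> 'x::real_inner) \<Rightarrow> ('w \<Rightarrow> 'x) \<Rightarrow> real" where
  "L2_inner P X Y = (LINT \<omega>|P. inner (X \<omega>) (Y \<omega>))"

lemma L2_inner_commute: "L2_inner P X Y = L2_inner P Y X"
  by (simp add: L2_inner_def inner_commute)

lemma L2_inner_self: "L2_inner P X X = (LINT \<omega>|P. (norm (X \<omega>))\<^sup>2)"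
  by (simp add: L2_inner_def power2_norm_eq_inner)

lemma L2_inner_self_nonneg: "0 \<le> L2_inner P X X"
  by (simp add: L2_inner_def)

lemma Lp_norm_2: "Lp_norm 2 P X = sqrt (L2_inner P X X)"
  by (simp add: Lp_norm_def L2_inner_self sqrt_def)

context
  fixes P :: "'w measure" and X Y Z :: "'w \<Rightarrow> 'x::{real_inner, second_countable_topology}"
  assumes XYZ: "Lp_fun 2 P X" "Lp_fun 2 P Y" "Lp_fun 2 P Z"
begin

lemma L2_inner_add_left: "L2_inner P (\<lambda>\<omega>. X \<omega> + Y \<omega>) Z = L2_inner P X Z + L2_inner P Y Z"
  using XYZ by (simp add: L2_inner_def inner_add_left Lp_fun_2_inner_integrable)

lemma L2_inner_add_right: "L2_inner P Z (\<lambda>\<omega>. X \<omega> + Y \<omega>) = L2_inner P Z X + L2_inner P Z Y"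
  using XYZ by (simp add: L2_inner_def inner_add_right Lp_fun_2_inner_integrable)

lemma L2_inner_diff_left: "L2_inner P (\<lambda>\<omega>. X \<omega> - Y \<omega>) Z = L2_inner P X Z - L2_inner P Y Z"
  using XYZ by (simp add: L2_inner_def inner_diff_left Lp_fun_2_inner_integrable)

lemma L2_inner_diff_right: "L2_inner P Z (\<lambda>\<omega>. X \<omega> - Y \<omega>) = L2_inner P Z X - L2_inner P Z Y"
  using XYZ by (simp add: L2_inner_def inner_diff_right Lp_fun_2_inner_integrable)

end

lemma L2_inner_scale_left: "L2_inner P (\<lambda>\<omega>. c *\<^sub>R X \<omega>) Y = c * L2_inner P X Y"
  by (simp add: L2_inner_def)

lemma L2_inner_scale_right: "L2_inner P X (\<lambda>\<omega>. c *\<^sub>R Y \<omega>) = c * L2_inner P X Y"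
  by (simp add: L2_inner_def)

lemma L2_inner_sum_left:
  fixes X :: "'i \<Rightarrow> 'w \<Rightarrow> 'x::{real_inner, second_countable_topology}"
  assumes "\<And>i. i \<in> I \<Longrightarrow> Lp_fun 2 P (X i)" "Lp_fun 2 P Z"
  shows "L2_inner P (\<lambda>\<omega>. \<Sum>i\<in>I. X i \<omega>) Z = (\<Sum>i\<in>I. L2_inner P (X i) Z)"
  using assms by (simp add: L2_inner_def inner_sum_left Lp_fun_2_inner_integrable)

lemma L2_inner_sum_sum:
  fixes X :: "'i \<Rightarrow> 'w \<Rightarrow> 'x::{real_inner, second_countable_topology}"
  assumes "\<And>i. i \<in> I \<Longrightarrow> Lp_fun 2 P (X i)" "\<And>j. j \<in> J \<Longrightarrow> Lp_fun 2 P (Y j)"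
  shows "L2_inner P (\<lambda>\<omega>. \<Sum>i\<in>I. X i \<omega>) (\<lambda>\<omega>. \<Sum>j\<in>J. Y j \<omega>) = (\<Sum>i\<in>I. \<Sum>j\<in>J. L2_inner P (X i) (Y j))"
proof -
  have "L2_inner P (X i) (\<lambda>\<omega>. \<Sum>j\<in>J. Y j \<omega>) = (\<Sum>j\<in>J. L2_inner P (X i) (Y j))" if "i \<in> I" for i
    using L2_inner_sum_left[of J P Y "X i"] assms that by (simp add: L2_inner_commute[of P "X i"])
  then show ?thesis
    using assms by (simp add: L2_inner_sum_left Lp_fun_2_sum)
qed

text \<open>The discriminant argument, from nonnegativity of the quadratic form of
  \<open>s *\<^sub>R X \<omega> - t *\<^sub>R Y \<omega>\<close> alone, since the form may be
  degenerate.\<close>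

lemma L2_inner_Cauchy_Schwarz:
  fixes X Y :: "'w \<Rightarrow> 'x::{real_inner, second_countable_topology}"
  assumes X: "Lp_fun 2 P X" and Y: "Lp_fun 2 P Y"
  shows "\<bar>L2_inner P X Y\<bar> \<le> sqrt (L2_inner P X X) * sqrt (L2_inner P Y Y)"
proof -
  define a b c where "a = L2_inner P X X" "b = L2_inner P X Y" "c = L2_inner P Y Y"
  have quad: "0 \<le> s\<^sup>2 * a - 2 * s * t * b + t\<^sup>2 * c" for s t
  proof -
    let ?X = "\<lambda>\<omega>. s *\<^sub>R X \<omega>" and ?Y = "\<lambda>\<omega>. t *\<^sub>R Y \<omega>"
    have sX: "Lp_fun 2 P ?X" and tY: "Lp_fun 2 P ?Y"
      using X Y by (simp_all add: Lp_fun_2_scale)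
    have "0 \<le> L2_inner P (\<lambda>\<omega>. ?X \<omega> - ?Y \<omega>) (\<lambda>\<omega>. ?X \<omega> - ?Y \<omega>)"
      by (rule L2_inner_self_nonneg)
    also have "\<dots> = L2_inner P ?X ?X - L2_inner P ?X ?Y - (L2_inner P ?Y ?X - L2_inner P ?Y ?Y)"
      using sX tY by (simp add: L2_inner_diff_left L2_inner_diff_right Lp_fun_2_diff)
    also have "\<dots> = s\<^sup>2 * a - 2 * s * t * b + t\<^sup>2 * c"
      by (simp add: L2_inner_scale_left L2_inner_scale_right a_b_c_def L2_inner_commute[of P Y X] power2_eq_square algebra_simps)
    finally show ?thesis .
  qed
  have ac: "0 \<le> a" "0 \<le> c"
    by (simp_all add: a_b_c_def L2_inner_self_nonneg)
  have "b\<^sup>2 \<le> a * c"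
  proof (cases "c = 0")
    case True
    have "b = 0"
    proof (rule ccontr)
      assume "b \<noteq> 0"
      \<comment> \<open>For \<open>c = 0\<close> only \<open>s\<^sup>2 * a - 2 * s * t * b\<close>
        remains; \<open>s = b\<close> and \<open>t = (a + 1) / 2\<close> turn it into
        \<open>- b\<^sup>2\<close>.\<close>
      have "0 \<le> b\<^sup>2 * a - 2 * b * ((a + 1) / 2) * b"
        using quad[of b "(a + 1) / 2"] True by simp
      also have "\<dots> = - b\<^sup>2" by (simp add: power2_eq_square field_simps)
      finally show False using \<open>b \<noteq> 0\<close> by simp
    qed
    then show ?thesis using True by simp
  next
    case False
    \<comment> \<open>The minimising ratio \<open>s = c\<close>, \<open>t = b\<close> leaves
      \<open>c * (a * c - b\<^sup>2)\<close>.\<close>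
    have "0 \<le> c\<^sup>2 * a - 2 * c * b * b + b\<^sup>2 * c"
      using quad[of c b] by simp
    then have "0 \<le> c * (a * c - b\<^sup>2)"
      by (simp add: power2_eq_square algebra_simps)
    with False ac show ?thesis
      by (simp add: zero_le_mult_iff)
  qed
  then have "sqrt (b\<^sup>2) \<le> sqrt (a * c)" by (rule real_sqrt_le_mono)
  then show ?thesis by (simp add: a_b_c_def real_sqrt_mult)
qed

lemma L2_inner_sum_self_le:
  fixes X :: "'i \<Rightarrow> 'w \<Rightarrow> 'x::{real_inner, second_countable_topology}"
  assumes X: "\<And>i. i \<in> I \<Longrightarrow> Lp_fun 2 P (X i)" and B: "\<And>i. i \<in> I \<Longrightarrow> L2_inner P (X i) (X i) \<le> B\<^sup>2" and "0 \<le> B"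
  shows "L2_inner P (\<lambda>\<omega>. \<Sum>i\<in>I. X i \<omega>) (\<lambda>\<omega>. \<Sum>i\<in>I. X i \<omega>) \<le> (real (card I) * B)\<^sup>2"
proof -
  have "L2_inner P (X i) (X j) \<le> B * B" if "i \<in> I" "j \<in> I" for i j
  proof -
    have s: "sqrt (L2_inner P (X i) (X i)) \<le> B" if "i \<in> I" for i
      using B[OF that] \<open>0 \<le> B\<close> by (simp add: real_le_lsqrt)
    have "L2_inner P (X i) (X j) \<le> sqrt (L2_inner P (X i) (X i)) * sqrt (L2_inner P (X j) (X j))"
      using L2_inner_Cauchy_Schwarz[OF X[OF that(1)] X[OF that(2)]] by simp
    also have "\<dots> \<le> B * B"
      using s that \<open>0 \<le> B\<close> L2_inner_self_nonneg by (intro mult_mono) auto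
    finally show ?thesis .
  qed
  then have "(\<Sum>i\<in>I. \<Sum>j\<in>I. L2_inner P (X i) (X j)) \<le> (\<Sum>i\<in>I. \<Sum>j\<in>I. B * B)"
    by (intro sum_mono)
  then show ?thesis
    using X by (simp add: L2_inner_sum_sum power2_eq_square mult_ac)
qed

lemma Lp_fun_2_real: "Lp_fun 2 P X \<longleftrightarrow> X \<in> borel_measurable P \<and> integrable P (\<lambda>\<omega>. (X \<omega>)\<^sup>2)"
  for X :: "'w \<Rightarrow> real"
  by (simp add: Lp_fun_def)

section \<open>Second moments of Wiener processes\<close>

context
  fixes P :: "'w measure" and F :: "real \<Rightarrow> 'w measure" and B :: "real \<Rightarrow> 'w \<Rightarrow> real"
  assumes basis: "stochastic_basis P F" and wiener: "wiener_process P F B"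
begin

interpretation prob_space P
  using basis by (simp add: stochastic_basis_def)

lemma wiener_measurable: "t \<ge> 0 \<Longrightarrow> B t \<in> borel_measurable P"
  using basis wiener measurable_from_subalg[of P "F t" "B t" borel]
  by (simp add: stochastic_basis_def wiener_process_def)

lemma wiener_increment:
  assumes "0 \<le> s" "s < t"
  shows "Lp_fun 2 P (\<lambda>\<omega>. B t \<omega> - B s \<omega>)" "expectation (\<lambda>\<omega>. B t \<omega> - B s \<omega>) = 0"
    "expectation (\<lambda>\<omega>. (B t \<omega> - B s \<omega>)\<^sup>2) = t - s"
proof -
  have D: "distributed P lborel (\<lambda>\<omega>. B t \<omega> - B s \<omega>) (\<lambda>x. ennreal (normal_density 0 (sqrt (t - s)) x))"
    using wiener assms by (simp add: wiener_process_def)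
  have pos: "0 < sqrt (t - s)" using assms by simp
  show E: "expectation (\<lambda>\<omega>. B t \<omega> - B s \<omega>) = 0"
    by (rule normal_distributed_expectation[OF pos D])
  show "expectation (\<lambda>\<omega>. (B t \<omega> - B s \<omega>)\<^sup>2) = t - s"
    using normal_distributed_variance[OF pos D] E assms by simp
  have "integrable lborel (\<lambda>x. normal_density 0 (sqrt (t - s)) x * x\<^sup>2)"
    using integrable_normal_moment[OF pos, of 0 2] by simp
  then have "integrable P (\<lambda>\<omega>. (B t \<omega> - B s \<omega>)\<^sup>2)"
    using distributed_integrable[OF D, of "\<lambda>x. x\<^sup>2"] by simp
  moreover have "(\<lambda>\<omega>. B t \<omega> - B s \<omega>) \<in> borel_measurable P"
    using assms by (intro borel_measurable_diff wiener_measurable) auto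
  ultimately show "Lp_fun 2 P (\<lambda>\<omega>. B t \<omega> - B s \<omega>)"
    by (simp add: Lp_fun_2_real)
qed

text \<open>The normal law is given only for increments over \<open>s < t\<close>, and
  \<open>B 0\<close> vanishes only almost surely. Hence the separate case \<open>t = 0\<close>, and
  otherwise the comparison of \<open>B t\<close> with its increment from 0 up to a null set.\<close>

lemma wiener_moments:
  assumes "t \<ge> 0"
  shows "Lp_fun 2 P (B t)" "expectation (B t) = 0" "expectation (\<lambda>\<omega>. (B t \<omega>)\<^sup>2) = t"
proof -
  have B0: "AE \<omega> in P. B 0 \<omega> = 0"
    using wiener by (simp add: wiener_process_def)
  have m [measurable]: "B t \<in> borel_measurable P" "B 0 \<in> borel_measurable P"
    using assms by (auto intro: wiener_measurable)
  have "Lp_fun 2 P (B t) \<and> expectation (B t) = 0 \<and> expectation (\<lambda>\<omega>. (B t \<omega>)\<^sup>2) = t"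
  proof (cases "t = 0")
    case True
    have "integrable P (\<lambda>\<omega>. (B 0 \<omega>)\<^sup>2)"
      by (rule integrable_cong_AE_imp[of P "\<lambda>_. 0"]) (use B0 in \<open>auto elim: eventually_mono\<close>)
    moreover have "expectation (B 0) = 0" "expectation (\<lambda>\<omega>. (B 0 \<omega>)\<^sup>2) = 0"
      using B0 by (auto intro!: integral_eq_zero_AE elim: eventually_mono)
    ultimately show ?thesis
      using True m by (simp add: Lp_fun_2_real)
  next
    case False
    with assms have "0 < t" by simp
    note inc = wiener_increment[OF order_refl this]
    have eq: "AE \<omega> in P. B t \<omega> - B 0 \<omega> = B t \<omega>" "AE \<omega> in P. (B t \<omega> - B 0 \<omega>)\<^sup>2 = (B t \<omega>)\<^sup>2"
      using B0 by (auto elim: eventually_mono)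
    have "integrable P (\<lambda>\<omega>. (B t \<omega>)\<^sup>2)"
      by (rule integrable_cong_AE_imp[OF _ _ eq(2)]) (use inc(1) in \<open>auto simp: Lp_fun_2_real\<close>)
    moreover have "expectation (B t) = expectation (\<lambda>\<omega>. B t \<omega> - B 0 \<omega>)"
      "expectation (\<lambda>\<omega>. (B t \<omega>)\<^sup>2) = expectation (\<lambda>\<omega>. (B t \<omega> - B 0 \<omega>)\<^sup>2)"
      using eq by (auto intro!: integral_cong_AE elim: eventually_mono)
    ultimately show ?thesis
      using inc m by (simp add: Lp_fun_2_real)
  qed
  then show "Lp_fun 2 P (B t)" "expectation (B t) = 0" "expectation (\<lambda>\<omega>. (B t \<omega>)\<^sup>2) = t"
    by auto
qed

lemma wiener_integrable: "t \<ge> 0 \<Longrightarrow> integrable P (B t)"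
  using wiener_moments(1) by (auto simp: Lp_fun_2_real intro: square_integrable_imp_integrable)

text \<open>\<open>B s * B t\<close> is \<open>B s\<close> times the increment plus the square of
  \<open>B s\<close>. The increment is centred and independent of \<open>F s\<close>, so only the
  square contributes.\<close>

lemma wiener_covariance_less:
  assumes "0 \<le> s" "s < t"
  shows "expectation (\<lambda>\<omega>. B s \<omega> * B t \<omega>) = s"
proof -
  let ?I = "\<lambda>\<omega>. B t \<omega> - B s \<omega>"
  have [measurable]: "B s \<in> borel_measurable P" "?I \<in> borel_measurable P"
    using assms by (auto intro!: wiener_measurable borel_measurable_diff)
  have sub: "subalgebra P (F s)" and Fs: "B s \<in> borel_measurable (F s)"
    using basis wiener assms by (auto simp: stochastic_basis_def wiener_process_def)
  have indep: "indep_set (sets (F s)) {?I -` A \<inter> space P | A. A \<in> sets borel}"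
    using wiener assms by (simp add: wiener_process_def)
  have "indep_var borel (B s) borel ?I"
    unfolding indep_var_eq indep_sets2_eq
  proof (intro conjI ballI)
    have 1: "sigma_sets (space P) {B s -` A \<inter> space P | A. A \<in> sets borel} \<subseteq> sets (F s)"
    proof -
      have "{B s -` A \<inter> space P | A. A \<in> sets borel} \<subseteq> sets (F s)"
        using Fs sub by (auto simp: subalgebra_def dest: measurable_sets)
      then show ?thesis
        using sub sets.sigma_sets_subset[of _ "F s"] by (simp add: subalgebra_def)
    qed
    \<comment> \<open>The preimages of Borel sets already form a \<sigma>-algebra, so
      \<open>indep\<close> applies directly to its members.\<close>
    have 2: "sigma_sets (space P) {?I -` A \<inter> space P | A. A \<in> sets borel} = {?I -` A \<inter> space P | A. A \<in> sets borel}"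
    proof -
      have "sets (vimage_algebra (space P) ?I borel) = {?I -` A \<inter> space P | A. A \<in> sets borel}"
        by (rule sets_vimage_algebra2) auto
      then show ?thesis by (simp add: sets_vimage_algebra)
    qed
    show "sigma_sets (space P) {B s -` A \<inter> space P | A. A \<in> sets borel} \<subseteq> events"
      using 1 sub by (auto simp: subalgebra_def)
    show "sigma_sets (space P) {?I -` A \<inter> space P | A. A \<in> sets borel} \<subseteq> events"
      unfolding 2 by auto
    fix a b assume "a \<in> sigma_sets (space P) {B s -` A \<inter> space P | A. A \<in> sets borel}"
      "b \<in> sigma_sets (space P) {?I -` A \<inter> space P | A. A \<in> sets borel}"
    then show "prob (a \<inter> b) = prob a * prob b"
      using 1 unfolding 2 by (intro indep_setD[OF indep]) auto
  qed measurable
  moreover have int: "integrable P (B s)" "integrable P ?I"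
    using assms by (auto intro!: wiener_integrable Bochner_Integration.integrable_diff)
  ultimately have "expectation (\<lambda>\<omega>. B s \<omega> * ?I \<omega>) = 0" "integrable P (\<lambda>\<omega>. B s \<omega> * ?I \<omega>)"
    using indep_var_lebesgue_integral[of "B s" ?I] indep_var_integrable[of "B s" ?I]
      wiener_increment(2)[OF assms] by auto
  moreover have "(\<lambda>\<omega>. B s \<omega> * B t \<omega>) = (\<lambda>\<omega>. B s \<omega> * ?I \<omega> + (B s \<omega>)\<^sup>2)"
    by (simp add: power2_eq_square algebra_simps)
  ultimately show ?thesis
    using wiener_moments[OF assms(1)] by (simp add: Lp_fun_2_real)
qed

lemma wiener_covariance:
  assumes "0 \<le> s" "0 \<le> t"
  shows "expectation (\<lambda>\<omega>. B s \<omega> * B t \<omega>) = min s t"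
proof (cases s t rule: linorder_cases)
  case less
  then show ?thesis using wiener_covariance_less assms by simp
next
  case equal
  then show ?thesis using wiener_moments(3)[OF assms(1)] by (simp add: power2_eq_square)
next
  case greater
  then show ?thesis using wiener_covariance_less[of t s] assms by (simp add: mult.commute)
qed

end

lemma independent_wiener_covariance:
  assumes basis: "stochastic_basis P F" and W: "independent_wiener_processes P F W"
    and "0 \<le> s" "0 \<le> t"
  shows "(LINT \<omega>|P. W k s \<omega> * W j t \<omega>) = (if k = j then min s t else 0)"
proof -
  interpret prob_space P
    using basis by (simp add: stochastic_basis_def)
  have Wk: "wiener_process P F (W i)" for i
    using W by (simp add: independent_wiener_processes_def)
  show ?thesis
  proof (cases "k = j")
    case True
    then show ?thesis using wiener_covariance[OF basis Wk] assms(3,4) by simp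
  next
    case False
    \<comment> \<open>One evaluation time per index, \<open>s\<close> for \<open>k\<close> and
      \<open>t\<close> for every other one, reduces independence of whole paths to independence of
      real random variables.\<close>
    define \<tau> where "\<tau> i = (if i = k then s else t)" for i
    have \<tau>: "\<tau> i \<ge> 0" for i using assms by (simp add: \<tau>_def)
    have "indep_vars (\<lambda>_. borel) (\<lambda>i \<omega>. (\<lambda>t\<in>{0..}. W i t \<omega>) (\<tau> i)) UNIV"
    proof (rule indep_vars_compose2[where Y = "\<lambda>i f. f (\<tau> i)" and M' = "\<lambda>_. PiM {0..} (\<lambda>_. borel)"])
      show "indep_vars (\<lambda>_. PiM {0..} (\<lambda>_. borel)) (\<lambda>i \<omega>. \<lambda>t\<in>{0..}. W i t \<omega>) UNIV"
        using W by (simp add: independent_wiener_processes_def)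
    qed (auto intro: measurable_component_singleton \<tau>)
    then have "indep_vars (\<lambda>_. borel) (\<lambda>i. W i (\<tau> i)) UNIV"
      using \<tau> by simp
    then have "indep_vars (\<lambda>_. borel) (\<lambda>i. W i (\<tau> i)) {k, j}"
      by (rule indep_vars_subset) simp
    then have "expectation (\<lambda>\<omega>. \<Prod>i\<in>{k, j}. W i (\<tau> i) \<omega>) = (\<Prod>i\<in>{k, j}. expectation (W i (\<tau> i)))"
      by (intro indep_vars_lebesgue_integral) (auto intro: wiener_integrable[OF basis Wk] \<tau>)
    then show ?thesis
      using False wiener_moments(2)[OF basis Wk assms(3), of k] by (simp add: \<tau>_def)
  qed
qed

text \<open>For finite \<open>K\<close> the modes are orthogonal, and the covariance of the partial
  sums is \<open>min s t\<close> times a sum that is the same at all times. Comparison with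
  \<open>s = t = 1\<close> expresses the limit through \<open>Y 1\<close>, without evaluating the
  infinite sum.\<close>

lemma series_covariance:
  fixes Y :: "real \<Rightarrow> 'w \<Rightarrow> 'x::{real_inner, second_countable_topology}" and c :: "'k \<Rightarrow> 'x"
  assumes basis: "stochastic_basis P F" and W: "independent_wiener_processes P F W"
    and Y: "\<And>t. t \<ge> 0 \<Longrightarrow> Lp_fun 2 P (Y t)"
    and lim: "\<And>t. t \<ge> 0 \<Longrightarrow>
      ((\<lambda>K. Lp_norm 2 P (\<lambda>\<omega>. Y t \<omega> - (\<Sum>k\<in>K. W k t \<omega> *\<^sub>R c k))) \<longlongrightarrow> 0) (finite_subsets_at_top UNIV)"
    and st: "0 \<le> s" "0 \<le> t"
  shows "L2_inner P (Y s) (Y t) = min s t * L2_inner P (Y 1) (Y 1)"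
proof -
  have Wk: "wiener_process P F (W i)" for i
    using W by (simp add: independent_wiener_processes_def)
  define S where "S K t \<omega> = (\<Sum>k\<in>K. W k t \<omega> *\<^sub>R c k)" for K t \<omega>
  define D where "D K t \<omega> = Y t \<omega> - S K t \<omega>" for K t \<omega>
  have Wc: "Lp_fun 2 P (\<lambda>\<omega>. W k t \<omega> *\<^sub>R c k)" if "t \<ge> 0" for k t
    using wiener_moments(1)[OF basis Wk that, of k] by (auto simp: Lp_fun_def power_mult_distrib)
  then have S: "Lp_fun 2 P (S K t)" if "t \<ge> 0" for K t
    unfolding S_def using that by (intro Lp_fun_2_sum)
  then have D: "Lp_fun 2 P (D K t)" if "t \<ge> 0" for K t
    unfolding D_def using that Y by (intro Lp_fun_2_diff)
  have SS: "L2_inner P (S K s) (S K t) = min s t * (\<Sum>k\<in>K. (norm (c k))\<^sup>2)" if st: "s \<ge> 0" "t \<ge> 0" and "finite K" for s t K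
  proof -
    have "L2_inner P (S K s) (S K t) = (\<Sum>k\<in>K. \<Sum>j\<in>K. L2_inner P (\<lambda>\<omega>. W k s \<omega> *\<^sub>R c k) (\<lambda>\<omega>. W j t \<omega> *\<^sub>R c j))"
      unfolding S_def using st by (intro L2_inner_sum_sum Wc)
    also have "\<dots> = (\<Sum>k\<in>K. \<Sum>j\<in>K. (LINT \<omega>|P. W k s \<omega> * W j t \<omega>) * inner (c k) (c j))"
      by (intro sum.cong refl, subst Bochner_Integration.integral_mult_left_zero[symmetric])
        (simp only: L2_inner_def inner_scaleR_left inner_scaleR_right mult_ac)
    also have "\<dots> = (\<Sum>k\<in>K. \<Sum>j\<in>K. if k = j then min s t * inner (c k) (c j) else 0)"
      using independent_wiener_covariance[OF basis W st] by (intro sum.cong) auto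
    also have "\<dots> = (\<Sum>k\<in>K. min s t * (norm (c k))\<^sup>2)"
      using that by (simp add: power2_norm_eq_inner)
    finally show ?thesis by (simp add: sum_distrib_left)
  qed
  have Dlim: "((\<lambda>K. sqrt (L2_inner P (D K t) (D K t))) \<longlongrightarrow> 0) (finite_subsets_at_top UNIV)" if "t \<ge> 0" for t
    using lim[OF that] by (simp add: D_def[abs_def] S_def Lp_norm_2)
  have Slim: "((\<lambda>K. L2_inner P (S K s) (S K t)) \<longlongrightarrow> L2_inner P (Y s) (Y t)) (finite_subsets_at_top UNIV)"
    if st: "s \<ge> 0" "t \<ge> 0" for s t
  proof -
    \<comment> \<open>The family \<open>X\<close> is general because the expansion below pairs the
      remainder both with a fixed \<open>Y s\<close> and with another remainder.\<close>
    have zero: "((\<lambda>K. L2_inner P (X K) (D K t)) \<longlongrightarrow> 0) (finite_subsets_at_top UNIV)"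
      if "t \<ge> 0" and X: "\<And>K. Lp_fun 2 P (X K)"
        and Xlim: "((\<lambda>K. sqrt (L2_inner P (X K) (X K))) \<longlongrightarrow> l) (finite_subsets_at_top UNIV)" for X l t
    proof (rule tendsto_rabs_zero_cancel, rule tendsto_sandwich[OF _ _ tendsto_const])
      show "((\<lambda>K. sqrt (L2_inner P (X K) (X K)) * sqrt (L2_inner P (D K t) (D K t))) \<longlongrightarrow> 0) (finite_subsets_at_top UNIV)"
        using tendsto_mult[OF Xlim Dlim[OF \<open>t \<ge> 0\<close>]] by simp
    qed (use L2_inner_Cauchy_Schwarz[OF X D] that in auto)
    have "L2_inner P (S K s) (S K t) = L2_inner P (Y s) (Y t) - L2_inner P (Y s) (D K t) - L2_inner P (Y t) (D K s) + L2_inner P (D K s) (D K t)" for K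
    proof -
      have eq: "S K t = (\<lambda>\<omega>. Y t \<omega> - D K t \<omega>)" for t by (simp add: D_def)
      show ?thesis
        unfolding eq using Y D st
        by (simp add: L2_inner_diff_left L2_inner_diff_right Lp_fun_2_diff L2_inner_commute[of P "D K s" "Y t"])
    qed
    moreover have "((\<lambda>K. L2_inner P (Y s) (Y t) - L2_inner P (Y s) (D K t) - L2_inner P (Y t) (D K s) + L2_inner P (D K s) (D K t)) \<longlongrightarrow>
        L2_inner P (Y s) (Y t) - 0 - 0 + 0) (finite_subsets_at_top UNIV)"
      using Y D st Dlim by (intro tendsto_intros zero) auto
    ultimately show ?thesis by simp
  qed
  have fin: "\<forall>\<^sub>F K in finite_subsets_at_top UNIV. finite K"
    by (simp add: eventually_finite_subsets_at_top_weakI)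
  have "((\<lambda>K. min s t * L2_inner P (S K 1) (S K 1)) \<longlongrightarrow> min s t * L2_inner P (Y 1) (Y 1)) (finite_subsets_at_top UNIV)"
    by (intro tendsto_intros Slim) auto
  moreover have "\<forall>\<^sub>F K in finite_subsets_at_top UNIV. min s t * L2_inner P (S K 1) (S K 1) = L2_inner P (S K s) (S K t)"
    using fin by eventually_elim (simp add: SS st)
  ultimately have "((\<lambda>K. L2_inner P (S K s) (S K t)) \<longlongrightarrow> min s t * L2_inner P (Y 1) (Y 1)) (finite_subsets_at_top UNIV)"
    by (rule Lim_transform_eventually)
  then show ?thesis
    using tendsto_unique[OF finite_subsets_at_top_neq_bot Slim[OF st]] by blast
qed

section \<open>Quadrature errors in mean square\<close>

lemma Lp_fun_4_add:
  fixes X Y :: "'w \<Rightarrow> 'x::{real_inner, second_countable_topology}"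
  assumes "Lp_fun 4 P X" "Lp_fun 4 P Y"
  shows "Lp_fun 4 P (\<lambda>\<omega>. X \<omega> + Y \<omega>)"
proof -
  have sq: "(x + y)\<^sup>2 \<le> 2 * (x\<^sup>2 + y\<^sup>2)" for x y :: real
    using sum_squares_bound[of x y] by (simp add: power2_sum)
  \<comment> \<open>The factor is \<open>2\<^sup>2 * 2\<close>: \<open>sq\<close> is used for the
    norms and again for their squares.\<close>
  have "norm (a + b) ^ 4 \<le> 8 * (norm a ^ 4 + norm b ^ 4)" for a b :: 'x
  proof -
    have "norm (a + b) ^ 4 \<le> ((norm a + norm b)\<^sup>2)\<^sup>2"
      using power_mono[OF norm_triangle_ineq[of a b] norm_ge_zero, of 4] by simp
    also have "\<dots> \<le> (2 * ((norm a)\<^sup>2 + (norm b)\<^sup>2))\<^sup>2"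
      by (rule power_mono[OF sq]) simp
    also have "\<dots> = 4 * ((norm a)\<^sup>2 + (norm b)\<^sup>2)\<^sup>2"
      by (simp only: power_mult_distrib) simp
    also have "\<dots> \<le> 4 * (2 * (((norm a)\<^sup>2)\<^sup>2 + ((norm b)\<^sup>2)\<^sup>2))"
      by (rule mult_left_mono[OF sq]) simp
    finally show ?thesis by simp
  qed
  moreover have int: "integrable P (\<lambda>\<omega>. 8 * (norm (X \<omega>) ^ 4 + norm (Y \<omega>) ^ 4))"
    using assms by (simp add: Lp_fun_def)
  moreover have [measurable]: "X \<in> borel_measurable P" "Y \<in> borel_measurable P"
    using assms by (simp_all add: Lp_fun_def)
  ultimately have "integrable P (\<lambda>\<omega>. norm (X \<omega> + Y \<omega>) ^ 4)"
    by (intro Bochner_Integration.integrable_bound[OF int]) auto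
  then show ?thesis by (simp add: Lp_fun_def)
qed

lemma Lp_fun_4_scale:
  fixes X :: "'w \<Rightarrow> 'x::{real_inner, second_countable_topology}"
  shows "Lp_fun 4 P X \<Longrightarrow> Lp_fun 4 P (\<lambda>\<omega>. c *\<^sub>R X \<omega>)"
  by (auto simp: Lp_fun_def power_mult_distrib)

lemma Lp_fun_4_diff:
  fixes X Y :: "'w \<Rightarrow> 'x::{real_inner, second_countable_topology}"
  assumes "Lp_fun 4 P X" "Lp_fun 4 P Y"
  shows "Lp_fun 4 P (\<lambda>\<omega>. X \<omega> - Y \<omega>)"
  using Lp_fun_4_add[OF assms(1) Lp_fun_4_scale[OF assms(2), of "-1"]] by simp

text \<open>Nonnegativity of the variance of the squared norm is the instance of Jensen's inequality
  required here.\<close>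

lemma Lp_fun_4_imp_2:
  fixes X :: "'w \<Rightarrow> 'x::{real_inner, second_countable_topology}"
  assumes "prob_space P" "Lp_fun 4 P X"
  shows "Lp_fun 2 P X" "Lp_norm 2 P X \<le> Lp_norm 4 P X"
proof -
  interpret prob_space P by fact
  let ?f = "\<lambda>\<omega>. (norm (X \<omega>))\<^sup>2"
  have [measurable]: "X \<in> borel_measurable P" and i4: "integrable P (\<lambda>\<omega>. (?f \<omega>)\<^sup>2)"
    using assms(2) by (simp_all add: Lp_fun_def)
  have "?f \<in> borel_measurable P" by measurable
  from square_integrable_imp_integrable[OF this i4] have i2: "integrable P ?f" .
  then show "Lp_fun 2 P X"
    by (simp add: Lp_fun_def)
  have "(expectation ?f)\<^sup>2 \<le> expectation (\<lambda>\<omega>. (?f \<omega>)\<^sup>2)"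
    using variance_eq[OF i2 i4] variance_positive[of ?f] by simp
  then have "expectation ?f \<le> sqrt (expectation (\<lambda>\<omega>. (?f \<omega>)\<^sup>2))"
    by (rule real_le_rsqrt)
  then have "sqrt (expectation ?f) \<le> sqrt (sqrt (expectation (\<lambda>\<omega>. (?f \<omega>)\<^sup>2)))"
    by (rule real_sqrt_le_mono)
  moreover have "root 4 x = sqrt (sqrt x)" for x
    using real_root_mult_exp[of 2 2 x] by (simp add: sqrt_def)
  ultimately show "Lp_norm 2 P X \<le> Lp_norm 4 P X"
    by (simp add: Lp_norm_def sqrt_def[symmetric])
qed

text \<open>The error of the difference quotient vanishes in the fourth mean, hence in mean square,
  and Cauchy-Schwarz carries this over to the pairing with a fixed \<xi>. This makes the scalar mean
  value theorem available although paths need not be differentiable.\<close>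

lemma Lp_C1_on_weak_derivative:
  fixes f :: "real \<Rightarrow> 'w \<Rightarrow> 'x::{real_inner, second_countable_topology}"
  assumes P: "prob_space P" and f: "Lp_C1_on 4 P S f f'" and t: "t \<in> S" and \<xi>: "Lp_fun 2 P \<xi>"
  shows "((\<lambda>s. L2_inner P (f s) \<xi>) has_real_derivative L2_inner P (f' t) \<xi>) (at t within S)"
proof -
  have f4: "Lp_fun 4 P (f s)" "Lp_fun 4 P (f' s)" if "s \<in> S" for s
    using f that by (auto simp: Lp_C1_on_def Lp_continuous_on_def)
  define q where "q s \<omega> = (f s \<omega> - f t \<omega>) /\<^sub>R (s - t) - f' t \<omega>" for s \<omega>
  have q4: "Lp_fun 4 P (q s)" if "s \<in> S" for s
    unfolding q_def using f4 t that by (intro Lp_fun_4_diff Lp_fun_4_scale) auto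
  have qlim: "((\<lambda>s. Lp_norm 4 P (q s)) \<longlongrightarrow> 0) (at t within S)"
    using f t by (simp add: Lp_C1_on_def q_def[abs_def])
  have eq: "(L2_inner P (f s) \<xi> - L2_inner P (f t) \<xi>) / (s - t) - L2_inner P (f' t) \<xi> = L2_inner P (q s) \<xi>"
    if "s \<in> S" for s
  proof -
    have d: "Lp_fun 2 P (\<lambda>\<omega>. f s \<omega> - f t \<omega>)"
      using f4 t that by (intro Lp_fun_2_diff Lp_fun_4_imp_2(1)[OF P]) auto
    then show ?thesis
      unfolding q_def using f4 t that \<xi>
      by (simp add: L2_inner_diff_left L2_inner_scale_left Lp_fun_2_scale Lp_fun_4_imp_2(1)[OF P] divide_inverse mult.commute)
  qed
  have "((\<lambda>s. L2_inner P (q s) \<xi>) \<longlongrightarrow> 0) (at t within S)"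
  proof (rule tendsto_rabs_zero_cancel, rule tendsto_sandwich[OF _ _ tendsto_const])
    show "((\<lambda>s. Lp_norm 4 P (q s) * Lp_norm 2 P \<xi>) \<longlongrightarrow> 0) (at t within S)"
      using tendsto_mult_left_zero[OF qlim] by simp
    have "\<bar>L2_inner P (q s) \<xi>\<bar> \<le> Lp_norm 4 P (q s) * Lp_norm 2 P \<xi>" if "s \<in> S" for s
    proof -
      have "\<bar>L2_inner P (q s) \<xi>\<bar> \<le> Lp_norm 2 P (q s) * Lp_norm 2 P \<xi>"
        unfolding Lp_norm_2 by (rule L2_inner_Cauchy_Schwarz[OF Lp_fun_4_imp_2(1)[OF P q4[OF that]] \<xi>])
      also have "\<dots> \<le> Lp_norm 4 P (q s) * Lp_norm 2 P \<xi>"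
        using Lp_fun_4_imp_2(2)[OF P q4[OF that]]
        by (rule mult_right_mono) (simp add: Lp_norm_2 L2_inner_self_nonneg)
      finally show ?thesis .
    qed
    then show "\<forall>\<^sub>F s in at t within S. \<bar>L2_inner P (q s) \<xi>\<bar> \<le> Lp_norm 4 P (q s) * Lp_norm 2 P \<xi>"
      by (simp add: eventually_at_filter)
  qed simp
  moreover have "\<forall>\<^sub>F s in at t within S.
      L2_inner P (q s) \<xi> = (L2_inner P (f s) \<xi> - L2_inner P (f t) \<xi>) / (s - t) - L2_inner P (f' t) \<xi>"
    using eq by (simp add: eventually_at_filter)
  ultimately have "((\<lambda>s. (L2_inner P (f s) \<xi> - L2_inner P (f t) \<xi>) / (s - t) - L2_inner P (f' t) \<xi>) \<longlongrightarrow> 0) (at t within S)"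
    by (rule Lim_transform_eventually)
  then show ?thesis
    unfolding has_field_derivative_iff by (simp add: LIM_zero_iff)
qed

text \<open>The second-order difference \<open>\<xi>\<close> is paired with itself: the mean value theorem for the real function
  \<open>s \<mapsto> E\<langle>f (b - \<theta> + s) - f (a + s), \<xi>\<rangle>\<close> then plays the role of a vector-valued
  mean value inequality in the mean-square norm.\<close>

lemma second_difference_bound:
  fixes f :: "real \<Rightarrow> 'w \<Rightarrow> 'x::{real_inner, second_countable_topology}"
  assumes P: "prob_space P" and f: "Lp_C1_on 4 P {0..T} f f'"
    and L: "\<And>s t. s \<in> {0..T} \<Longrightarrow> t \<in> {0..T} \<Longrightarrow> Lp_norm 2 P (\<lambda>\<omega>. f' t \<omega> - f' s \<omega>) \<le> L * \<bar>t - s\<bar> powr (1/2)"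
    and "0 \<le> L" "0 \<le> a" "0 \<le> \<theta>" "a + \<theta> \<le> b" "b \<le> T"
  defines "\<xi> \<equiv> \<lambda>\<omega>. f b \<omega> - f (b - \<theta>) \<omega> - (f (a + \<theta>) \<omega> - f a \<omega>)"
  shows "Lp_fun 2 P \<xi>" "L2_inner P \<xi> \<xi> \<le> (\<theta> * L * sqrt (b - a))\<^sup>2"
proof -
  have f2: "Lp_fun 2 P (f t)" "Lp_fun 2 P (f' t)" if "t \<in> {0..T}" for t
    using f that by (auto simp: Lp_C1_on_def Lp_continuous_on_def intro: Lp_fun_4_imp_2(1)[OF P])
  show \<xi>: "Lp_fun 2 P \<xi>"
    unfolding \<xi>_def using assms by (intro Lp_fun_2_diff f2) auto
  let ?n = "sqrt (L2_inner P \<xi> \<xi>)" and ?B = "\<theta> * L * sqrt (b - a)"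
  have B0: "0 \<le> ?B" using assms by simp
  have "?n \<le> ?B"
  proof (cases "\<theta> = 0")
    case True
    then have "\<xi> = (\<lambda>\<omega>. 0)" by (simp add: \<xi>_def)
    then show ?thesis using True by (simp add: L2_inner_def)
  next
    case False
    with assms have \<theta>: "0 < \<theta>" by simp
    define h where "h t = L2_inner P (f t) \<xi>" for t
    have deriv: "(h has_real_derivative L2_inner P (f' t) \<xi>) (at t within {0..T})" if "t \<in> {0..T}" for t
      unfolding h_def by (rule Lp_C1_on_weak_derivative[OF P f that \<xi>])
    have deriv_at: "(h has_real_derivative L2_inner P (f' t) \<xi>) (at t)" if "0 < t" "t < T" for t
      using deriv[of t] that at_within_Icc_at[of 0 t T] by simp
    have cont: "continuous_on {0..T} h"
      using deriv by (rule DERIV_continuous_on)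
    \<comment> \<open>Both increments are traversed in parallel, so one intermediate
      \<open>s\<close> occurs in both derivatives. The points \<open>b - \<theta> + s\<close> and
      \<open>a + s\<close> then have distance \<open>b - \<theta> - a\<close> whatever
      \<open>s\<close> is, and the Hoelder bound applies.\<close>
    define g where "g s = h (b - \<theta> + s) - h (a + s)" for s
    have "continuous_on {0..\<theta>} g"
      unfolding g_def using assms
      by (intro continuous_on_diff continuous_on_compose2[OF cont] continuous_intros) auto
    moreover have "(g has_derivative (*) (L2_inner P (f' (b - \<theta> + s)) \<xi> - L2_inner P (f' (a + s)) \<xi>)) (at s)"
      if "0 < s" "s < \<theta>" for s
    proof -
      have "((\<lambda>s. h (b - \<theta> + s)) has_real_derivative L2_inner P (f' (b - \<theta> + s)) \<xi> * 1) (at s)"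
        using that assms by (intro DERIV_chain2[where f = h] deriv_at derivative_eq_intros) auto
      moreover have "((\<lambda>s. h (a + s)) has_real_derivative L2_inner P (f' (a + s)) \<xi> * 1) (at s)"
        using that assms by (intro DERIV_chain2[where f = h] deriv_at derivative_eq_intros) auto
      ultimately show ?thesis
        unfolding g_def[abs_def] has_field_derivative_def[symmetric]
        by (auto intro!: DERIV_diff)
    qed
    ultimately obtain s where s: "0 < s" "s < \<theta>"
      "g \<theta> - g 0 = (L2_inner P (f' (b - \<theta> + s)) \<xi> - L2_inner P (f' (a + s)) \<xi>) * (\<theta> - 0)"
      using mvt[of 0 \<theta> g "\<lambda>s. (*) (L2_inner P (f' (b - \<theta> + s)) \<xi> - L2_inner P (f' (a + s)) \<xi>)"] \<theta> by auto
    have mem: "b - \<theta> + s \<in> {0..T}" "a + s \<in> {0..T}"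
      using s assms by auto
    have "L2_inner P \<xi> \<xi> = h b - h (b - \<theta>) - (h (a + \<theta>) - h a)"
    proof -
      have "Lp_fun 2 P (f b)" "Lp_fun 2 P (f (b - \<theta>))" "Lp_fun 2 P (f (a + \<theta>))" "Lp_fun 2 P (f a)"
        using assms by (auto intro: f2)
      then have "L2_inner P (\<lambda>\<omega>. f b \<omega> - f (b - \<theta>) \<omega> - (f (a + \<theta>) \<omega> - f a \<omega>)) \<xi> =
          h b - h (b - \<theta>) - (h (a + \<theta>) - h a)"
        using \<xi> by (simp add: h_def L2_inner_diff_left Lp_fun_2_diff)
      then show ?thesis by (simp add: \<xi>_def)
    qed
    also have "\<dots> = g \<theta> - g 0" by (simp add: g_def)
    also have "\<dots> = \<theta> * L2_inner P (\<lambda>\<omega>. f' (b - \<theta> + s) \<omega> - f' (a + s) \<omega>) \<xi>"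
      using s(3) f2(2)[OF mem(1)] f2(2)[OF mem(2)] \<xi> by (simp add: L2_inner_diff_left)
    also have "\<dots> \<le> \<theta> * (Lp_norm 2 P (\<lambda>\<omega>. f' (b - \<theta> + s) \<omega> - f' (a + s) \<omega>) * ?n)"
      using L2_inner_Cauchy_Schwarz[OF Lp_fun_2_diff[OF f2(2)[OF mem(1)] f2(2)[OF mem(2)]] \<xi>] \<theta>
      by (intro mult_left_mono) (auto simp: Lp_norm_2)
    also have "\<dots> \<le> \<theta> * ((L * sqrt (b - a)) * ?n)"
    proof -
      have "\<bar>(b - \<theta> + s) - (a + s)\<bar> powr (1/2) = sqrt (b - \<theta> - a)"
        using assms by (simp add: powr_half_sqrt)
      moreover have "sqrt (b - \<theta> - a) \<le> sqrt (b - a)"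
        using \<theta> by simp
      ultimately have "Lp_norm 2 P (\<lambda>\<omega>. f' (b - \<theta> + s) \<omega> - f' (a + s) \<omega>) \<le> L * sqrt (b - a)"
        by (intro order_trans[OF L[OF mem(2,1)]]) (simp only: mult_left_mono[OF _ \<open>0 \<le> L\<close>])
      then show ?thesis
        using \<theta> L2_inner_self_nonneg[of P \<xi>] by (intro mult_left_mono mult_right_mono) auto
    qed
    also have "\<dots> = ?B * ?n" by simp
    \<comment> \<open>The right factor is again the norm of \<xi>, which cancels unless it is
      zero.\<close>
    finally have "?n * ?n \<le> ?B * ?n"
      using L2_inner_self_nonneg[of P \<xi>] by simp
    then show ?thesis
      using B0 L2_inner_self_nonneg[of P \<xi>] by (cases "?n = 0") (simp_all only: mult_le_cancel_right, auto)
  qed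
  then have "?n\<^sup>2 \<le> ?B\<^sup>2"
    using L2_inner_self_nonneg[of P \<xi>] by (intro power_mono) auto
  then show "L2_inner P \<xi> \<xi> \<le> ?B\<^sup>2"
    using L2_inner_self_nonneg[of P \<xi>] by simp
qed

text \<open>A single summand is in general only of order \<tau>. The midpoints are symmetric about
  the centre, so the node sum may be averaged with its reflection; each summand becomes half of
  \<xi>, the increment at the right end minus the one at the left end, of mean-square norm at most
  \<open>\<tau> * L * sqrt \<tau>\<close>. The weights \<delta> contribute one more factor
  \<tau>.\<close>

lemma trapezoid_error_bound:
  fixes f :: "real \<Rightarrow> 'w \<Rightarrow> 'x::{real_inner, second_countable_topology}"
  assumes P: "prob_space P" and f: "Lp_C1_on 4 P {0..T} f f'"
    and L: "\<And>s t. s \<in> {0..T} \<Longrightarrow> t \<in> {0..T} \<Longrightarrow> Lp_norm 2 P (\<lambda>\<omega>. f' t \<omega> - f' s \<omega>) \<le> L * \<bar>t - s\<bar> powr (1/2)"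
    and "0 \<le> L" "0 \<le> a" "0 \<le> \<tau>" "a + \<tau> \<le> T" "0 < K" and \<delta>: "real K * \<delta> = \<tau>"
  defines "R \<equiv> \<lambda>\<omega>. \<delta> *\<^sub>R (\<Sum>i<K. (1/2) *\<^sub>R (f a \<omega> + f (a + \<tau>) \<omega>) - f (a + (real i + 1/2) * \<delta>) \<omega>)"
  shows "Lp_fun 2 P R" "L2_inner P R R \<le> L\<^sup>2 * \<tau> ^ 5"
proof -
  define \<theta> where "\<theta> i = (real i + 1/2) * \<delta>" for i
  define \<xi> where "\<xi> i \<omega> = f (a + \<tau>) \<omega> - f (a + \<tau> - \<theta> i) \<omega> - (f (a + \<theta> i) \<omega> - f a \<omega>)" for i \<omega>
  have \<delta>0: "0 \<le> \<delta>"
    using assms by (metis mult_nonneg_nonneg of_nat_0_less_iff zero_le_mult_iff not_less)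
  have \<theta>: "0 \<le> \<theta> i" "\<theta> i \<le> \<tau>" if "i < K" for i
  proof -
    show "0 \<le> \<theta> i" using \<delta>0 by (simp add: \<theta>_def)
    have "(real i + 1/2) * \<delta> \<le> real K * \<delta>"
      using that \<delta>0 by (intro mult_right_mono) auto
    then show "\<theta> i \<le> \<tau>" by (simp add: \<theta>_def \<delta>)
  qed
  \<comment> \<open>The nodes sit at half-integers, so reflection sends \<open>i + 1/2\<close> to
    \<open>K - i - 1/2\<close>, the node with index \<open>K - Suc i\<close>.\<close>
  have flip: "a + \<tau> - \<theta> i = a + \<theta> (K - Suc i)" if "i < K" for i
    using that \<delta>[symmetric] by (simp add: \<theta>_def of_nat_diff algebra_simps)
  have R: "R = (\<lambda>\<omega>. (\<delta> / 2) *\<^sub>R (\<Sum>i<K. \<xi> i \<omega>))"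
  proof
    fix \<omega>
    have "(\<Sum>i<K. f (a + \<tau> - \<theta> i) \<omega>) = (\<Sum>i<K. f (a + \<theta> (K - Suc i)) \<omega>)"
      by (intro sum.cong) (auto simp: flip)
    also have "\<dots> = (\<Sum>i<K. f (a + \<theta> i) \<omega>)"
      by (rule sum.nat_diff_reindex)
    finally have rev: "(\<Sum>i<K. f (a + \<tau> - \<theta> i) \<omega>) = (\<Sum>i<K. f (a + \<theta> i) \<omega>)" .
    have "(\<Sum>i<K. \<xi> i \<omega>) = (\<Sum>i<K. f a \<omega> + f (a + \<tau>) \<omega>) - 2 *\<^sub>R (\<Sum>i<K. f (a + \<theta> i) \<omega>)"
      unfolding \<xi>_def sum_subtractf rev by (simp add: sum.distrib scaleR_2)
    then show "R \<omega> = (\<delta> / 2) *\<^sub>R (\<Sum>i<K. \<xi> i \<omega>)"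
      by (simp add: R_def \<theta>_def sum_subtractf scaleR_diff_right flip: scaleR_right.sum)
  qed
  define B where "B = \<tau> * L * sqrt \<tau>"
  have B0: "0 \<le> B" using assms by (simp add: B_def)
  have \<xi>: "Lp_fun 2 P (\<xi> i)" "L2_inner P (\<xi> i) (\<xi> i) \<le> B\<^sup>2" if i: "i < K" for i
  proof -
    note bd = second_difference_bound[OF P f L \<open>0 \<le> L\<close> \<open>0 \<le> a\<close> \<theta>(1)[OF i], of "a + \<tau>", folded \<xi>_def]
    show "Lp_fun 2 P (\<xi> i)"
      using bd(1) \<theta>(2)[OF i] assms by simp
    have "L2_inner P (\<xi> i) (\<xi> i) \<le> (\<theta> i * L * sqrt \<tau>)\<^sup>2"
      using bd(2) \<theta>(2)[OF i] assms by simp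
    also have "\<dots> \<le> B\<^sup>2"
      unfolding B_def using \<theta>[OF i] assms by (intro power_mono mult_right_mono) auto
    finally show "L2_inner P (\<xi> i) (\<xi> i) \<le> B\<^sup>2" .
  qed
  show "Lp_fun 2 P R"
    unfolding R by (intro Lp_fun_2_scale Lp_fun_2_sum \<xi>) auto
  have "L2_inner P R R = (\<delta> / 2)\<^sup>2 * L2_inner P (\<lambda>\<omega>. \<Sum>i<K. \<xi> i \<omega>) (\<lambda>\<omega>. \<Sum>i<K. \<xi> i \<omega>)"
    unfolding R by (simp add: L2_inner_scale_left L2_inner_scale_right power2_eq_square)
  also have "\<dots> \<le> (\<delta> / 2)\<^sup>2 * (real (card {..<K}) * B)\<^sup>2"
    using \<xi> B0 by (intro mult_left_mono L2_inner_sum_self_le) auto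
  also have "\<dots> = (\<tau> * B)\<^sup>2 / 4"
    by (simp add: \<delta>[symmetric] power_mult_distrib power_divide)
  also have "\<dots> = L\<^sup>2 * \<tau> ^ 5 / 4"
  proof -
    have "(\<tau> * B)\<^sup>2 = \<tau> ^ 4 * L\<^sup>2 * (sqrt \<tau>)\<^sup>2"
      by (simp add: B_def power_mult_distrib power4_eq_xxxx power2_eq_square)
    also have "\<dots> = L\<^sup>2 * \<tau> ^ 5"
      using assms by (simp add: numeral_eq_Suc)
    finally show ?thesis by simp
  qed
  also have "\<dots> \<le> L\<^sup>2 * \<tau> ^ 5" using assms by simp
  finally show "L2_inner P R R \<le> L\<^sup>2 * \<tau> ^ 5" .
qed

text \<open>Here \<open>\<delta>\<close> is the step of the auxiliary midpoint rule that stands in for the integral. Increments of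
  \<open>G\<close> over different cells of length \<open>h\<close> are uncorrelated, which gains a factor \<open>h / \<tau>\<close> over the
  triangle inequality.\<close>

lemma noise_quadrature_bound:
  fixes G :: "real \<Rightarrow> 'w \<Rightarrow> 'x::{real_inner, second_countable_topology}"
  assumes G: "\<And>t. t \<ge> 0 \<Longrightarrow> Lp_fun 2 P (G t)"
    and cov: "\<And>s t. s \<ge> 0 \<Longrightarrow> t \<ge> 0 \<Longrightarrow> L2_inner P (G s) (G t) = min s t * \<sigma>"
    and "0 \<le> \<sigma>" "0 \<le> a" "0 \<le> h" "0 < m" and \<delta>: "real m * \<delta> = h" and K: "K = M * m"
  defines "S \<equiv> \<lambda>\<omega>. \<delta> *\<^sub>R (\<Sum>i<K. G (a + (real (i div m) + 1) * h) \<omega> - G (a + (real i + 1/2) * \<delta>) \<omega>)"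
  shows "Lp_fun 2 P S" "L2_inner P S S \<le> \<sigma> * (real M * h) * h\<^sup>2"
proof -
  define c where "c i = a + (real (i div m) + 1) * h" for i
  define s where "s i = a + (real i + 1/2) * \<delta>" for i
  have \<delta>0: "0 \<le> \<delta>"
    using assms by (metis mult_nonneg_nonneg of_nat_0_less_iff zero_le_mult_iff not_less)
  have cs0: "0 \<le> c i" "0 \<le> s i" for i
    using assms \<delta>0 by (simp_all add: c_def s_def)
  \<comment> \<open>The node \<open>s i\<close> lies in the cell with number \<open>i div m\<close>,
    whose right end is \<open>c i\<close>.\<close>
  have s_le_c: "s i \<le> c i" and c_le_s: "c i - h \<le> s i" for i
  proof -
    have *: "real i = real m * real (i div m) + real (i mod m)"
      by (metis mult_div_mod_eq of_nat_add of_nat_mult)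
    have "real (i mod m) + 1/2 \<le> real m"
      using mod_less_divisor[OF \<open>0 < m\<close>, of i] by linarith
    then have "(real (i mod m) + 1/2) * \<delta> \<le> real m * \<delta>"
      using \<delta>0 by (rule mult_right_mono)
    moreover have s_eq: "s i = a + real (i div m) * h + (real (i mod m) + 1/2) * \<delta>"
      unfolding s_def * \<delta>[symmetric] by (simp add: algebra_simps)
    ultimately show "s i \<le> c i"
      using \<delta> by (simp add: c_def distrib_right)
    have "0 \<le> (real (i mod m) + 1/2) * \<delta>"
      using \<delta>0 by simp
    then show "c i - h \<le> s i"
      unfolding s_eq c_def by (simp add: distrib_right)
  qed
  have c_le: "c i \<le> s j" if "i div m < j div m" for i j
  proof -
    have "(real (i div m) + 1) * h \<le> real (j div m) * h"
      using that assms by (intro mult_right_mono) auto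
    then show ?thesis
      using c_le_s[of j] by (simp add: c_def algebra_simps)
  qed
  define X where "X i \<omega> = G (c i) \<omega> - G (s i) \<omega>" for i \<omega>
  have S: "S = (\<lambda>\<omega>. \<delta> *\<^sub>R (\<Sum>i<K. X i \<omega>))"
    by (simp add: S_def X_def c_def s_def)
  have X: "Lp_fun 2 P (X i)" for i
    unfolding X_def by (intro Lp_fun_2_diff G cs0)
  show "Lp_fun 2 P S"
    unfolding S by (intro Lp_fun_2_scale Lp_fun_2_sum X)
  have XX: "L2_inner P (X i) (X j) = \<sigma> * (min (c i) (c j) - min (c i) (s j) - (min (s i) (c j) - min (s i) (s j)))" for i j
    unfolding X_def using G cs0 by (simp add: L2_inner_diff_left L2_inner_diff_right Lp_fun_2_diff cov algebra_simps)
  have le: "L2_inner P (X i) (X j) \<le> (if j div m = i div m then \<sigma> * h else 0)" for i j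
  proof (cases "i div m" "j div m" rule: linorder_cases)
    case less
    \<comment> \<open>If the cell of \<open>i\<close> comes earlier, all four minima depend on
      \<open>i\<close> alone and cancel.\<close>
    then have "min (c i) (c j) = c i" "min (c i) (s j) = c i" "min (s i) (c j) = s i" "min (s i) (s j) = s i"
      using c_le[OF less] s_le_c[of i] s_le_c[of j] by auto
    with less show ?thesis by (simp add: XX)
  next
    case greater
    then have "min (c i) (c j) = c j" "min (c i) (s j) = s j" "min (s i) (c j) = c j" "min (s i) (s j) = s j"
      using c_le[OF greater] s_le_c[of i] s_le_c[of j] by auto
    with greater show ?thesis by (simp add: XX)
  next
    case equal
    then have "c i = c j" by (simp add: c_def)
    \<comment> \<open>In a common cell the left side is
      \<open>c i - max (s i) (s j)\<close>.\<close>
    then have "min (c i) (c j) - min (c i) (s j) - (min (s i) (c j) - min (s i) (s j)) \<le> h"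
      using s_le_c[of i] s_le_c[of j] c_le_s[of i] c_le_s[of j] by (simp add: min_def)
    then show ?thesis
      using equal \<open>0 \<le> \<sigma>\<close> by (simp add: XX mult_left_mono)
  qed
  have row: "(\<Sum>j<K. L2_inner P (X i) (X j)) \<le> real m * (\<sigma> * h)" for i
  proof -
    have "(\<Sum>j<K. L2_inner P (X i) (X j)) \<le> (\<Sum>j<K. if j div m = i div m then \<sigma> * h else 0)"
      by (intro sum_mono le)
    also have "\<dots> = real (card {j \<in> {..<K}. j div m = i div m}) * (\<sigma> * h)"
      by (simp add: sum.If_cases Int_def)
    also have "\<dots> \<le> real m * (\<sigma> * h)"
    proof (rule mult_right_mono)
      have "{j \<in> {..<K}. j div m = i div m} \<subseteq> {(i div m) * m..<(i div m) * m + m}"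
      proof
        fix j assume "j \<in> {j \<in> {..<K}. j div m = i div m}"
        then have "j = (i div m) * m + j mod m"
          by (metis (mono_tags, lifting) div_mult_mod_eq mem_Collect_eq)
        then show "j \<in> {(i div m) * m..<(i div m) * m + m}"
          using mod_less_divisor[OF \<open>0 < m\<close>, of j] by simp
      qed
      from card_mono[OF _ this] show "real (card {j \<in> {..<K}. j div m = i div m}) \<le> real m"
        by simp
    qed (use assms in simp)
    finally show ?thesis .
  qed
  have "L2_inner P S S = \<delta>\<^sup>2 * (\<Sum>i<K. \<Sum>j<K. L2_inner P (X i) (X j))"
    unfolding S using X by (simp add: L2_inner_scale_left L2_inner_scale_right L2_inner_sum_sum power2_eq_square)
  also have "\<dots> \<le> \<delta>\<^sup>2 * (\<Sum>i<K. real m * (\<sigma> * h))"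
    by (intro mult_left_mono sum_mono row) simp
  also have "\<dots> = \<sigma> * (real M * h) * h\<^sup>2"
    by (simp add: K \<delta>[symmetric] power2_eq_square)
  finally show "L2_inner P S S \<le> \<sigma> * (real M * h) * h\<^sup>2" .
qed

section \<open>Midpoint sums and lower integrals\<close>

lemma midpoint_rule_tendsto:
  fixes \<phi> :: "real \<Rightarrow> real"
  assumes cont: "continuous_on {a..a + \<tau>} \<phi>" and \<tau>: "0 < \<tau>"
  shows "(\<lambda>K. (\<tau> / real K) * (\<Sum>i<K. \<phi> (a + (real i + 1/2) * (\<tau> / real K)))) \<longlonglongrightarrow> integral {a..a + \<tau>} \<phi>"
proof (rule LIMSEQ_I)
  fix r :: real assume r: "0 < r"
  \<comment> \<open>A deviation of at most \<epsilon> from the midpoint value on every cell adds up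
    to \<open>\<epsilon> * \<tau> = r / 2\<close>.\<close>
  define \<epsilon> where "\<epsilon> = r / (2 * \<tau>)"
  have \<epsilon>: "0 < \<epsilon>" using r \<tau> by (simp add: \<epsilon>_def)
  have "uniformly_continuous_on {a..a + \<tau>} \<phi>"
    by (rule compact_uniformly_continuous[OF cont]) simp
  then obtain d where d: "0 < d"
    "\<And>x y. x \<in> {a..a + \<tau>} \<Longrightarrow> y \<in> {a..a + \<tau>} \<Longrightarrow> \<bar>y - x\<bar> < d \<Longrightarrow> \<bar>\<phi> y - \<phi> x\<bar> < \<epsilon>"
    using \<epsilon> unfolding uniformly_continuous_on_def dist_real_def by metis
  obtain K0 :: nat where K0: "\<tau> / d < K0"
    using reals_Archimedean2 by blast
  show "\<exists>K0. \<forall>K\<ge>K0. norm ((\<tau> / real K) * (\<Sum>i<K. \<phi> (a + (real i + 1/2) * (\<tau> / real K))) - integral {a..a + \<tau>} \<phi>) < r"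
  proof (intro exI[of _ "Suc K0"] allI impI)
    fix K assume "Suc K0 \<le> K"
    then have K: "0 < K" "\<tau> / d < K" using K0 by auto
    define \<delta> where "\<delta> = \<tau> / real K"
    have \<delta>: "0 < \<delta>" "real K * \<delta> = \<tau>" "\<delta> < d"
      using K \<tau> d(1) by (auto simp: \<delta>_def field_simps)
    have sub: "{a + real i * \<delta>..a + real (Suc i) * \<delta>} \<subseteq> {a..a + \<tau>}" if "i < K" for i
    proof -
      have "real (Suc i) * \<delta> \<le> real K * \<delta>"
        using that \<delta>(1) by (intro mult_right_mono) auto
      moreover have "0 \<le> real i * \<delta>" using \<delta>(1) by simp
      ultimately show ?thesis using \<delta>(2) by auto
    qed
    have split: "j \<le> K \<Longrightarrow> integral {a..a + real j * \<delta>} \<phi> =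
        (\<Sum>i<j. integral {a + real i * \<delta>..a + real (Suc i) * \<delta>} \<phi>)" for j
    proof (induction j)
      case (Suc j)
      have "\<phi> integrable_on {a..a + real (Suc j) * \<delta>}"
        using Suc.prems sub[of j] \<delta>(1)
        by (intro integrable_continuous_real continuous_on_subset[OF cont]) auto
      then have "integral {a..a + real j * \<delta>} \<phi> + integral {a + real j * \<delta>..a + real (Suc j) * \<delta>} \<phi> =
          integral {a..a + real (Suc j) * \<delta>} \<phi>"
        using \<delta>(1) by (intro Henstock_Kurzweil_Integration.integral_combine) auto
      then show ?case using Suc by simp
    qed simp
    have cell: "\<bar>\<delta> * \<phi> (a + (real i + 1/2) * \<delta>) - integral {a + real i * \<delta>..a + real (Suc i) * \<delta>} \<phi>\<bar> \<le> \<epsilon> * \<delta>"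
      if i: "i < K" for i
    proof -
      let ?I = "{a + real i * \<delta>..a + real (Suc i) * \<delta>}" and ?c = "\<phi> (a + (real i + 1/2) * \<delta>)"
      have cI: "continuous_on ?I \<phi>"
        by (rule continuous_on_subset[OF cont sub[OF i]])
      have bnd: "norm (\<phi> x - ?c) \<le> \<epsilon>" if x: "x \<in> ?I" for x
      proof -
        have c: "a + (real i + 1/2) * \<delta> \<in> ?I"
          using \<delta>(1) by (simp add: algebra_simps)
        have "\<bar>x - (a + (real i + 1/2) * \<delta>)\<bar> < d"
          using x \<delta> by (auto simp: algebra_simps abs_if)
        then show ?thesis
          using d(2)[of "a + (real i + 1/2) * \<delta>" x] x c sub[OF i] by (auto intro: less_imp_le)
      qed
      have "continuous_on ?I (\<lambda>x. \<phi> x - ?c)"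
        by (intro continuous_intros cI)
      then have "norm (integral ?I (\<lambda>x. \<phi> x - ?c)) \<le> \<epsilon> * (a + real (Suc i) * \<delta> - (a + real i * \<delta>))"
        using \<delta>(1) by (intro integral_bound ballI bnd) (auto simp: algebra_simps)
      moreover have "integral ?I (\<lambda>x. \<phi> x - ?c) = integral ?I \<phi> - \<delta> * ?c"
        using cI \<delta>(1) by (subst Henstock_Kurzweil_Integration.integral_diff)
          (auto intro!: integrable_continuous_real simp: algebra_simps)
      ultimately show ?thesis by (simp add: algebra_simps abs_minus_commute)
    qed
    have "integral {a..a + \<tau>} \<phi> = (\<Sum>i<K. integral {a + real i * \<delta>..a + real (Suc i) * \<delta>} \<phi>)"
      using split[of K] \<delta>(2) by simp
    then have "\<bar>\<delta> * (\<Sum>i<K. \<phi> (a + (real i + 1/2) * \<delta>)) - integral {a..a + \<tau>} \<phi>\<bar> =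
        \<bar>\<Sum>i<K. \<delta> * \<phi> (a + (real i + 1/2) * \<delta>) - integral {a + real i * \<delta>..a + real (Suc i) * \<delta>} \<phi>\<bar>"
      by (simp add: sum_subtractf sum_distrib_left)
    also have "\<dots> \<le> (\<Sum>i<K. \<epsilon> * \<delta>)"
      by (rule order_trans[OF sum_abs sum_mono]) (use cell in simp)
    also have "\<dots> = \<epsilon> * \<tau>" using \<delta>(2) by (simp add: algebra_simps)
    also have "\<dots> < r" using r \<tau> by (simp add: \<epsilon>_def)
    finally show "norm ((\<tau> / real K) * (\<Sum>i<K. \<phi> (a + (real i + 1/2) * (\<tau> / real K))) - integral {a..a + \<tau>} \<phi>) < r"
      by (simp add: \<delta>_def)
  qed
qed

text \<open>For arbitrary functions the integral is the supremum over simple minorants. Minorants of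
  \<open>f\<close> and of \<open>g\<close> add up to a minorant of \<open>f + g\<close>, whereas one
  of the sum need not split; this direction needs no measurability.\<close>

lemma nn_integral_superadditive:
  "(\<integral>\<^sup>+x. f x \<partial>M) + (\<integral>\<^sup>+x. g x \<partial>M) \<le> (\<integral>\<^sup>+x. f x + g x \<partial>M)"
proof -
  have *: "(\<integral>\<^sup>+x. s x \<partial>M) + (\<integral>\<^sup>+x. g x \<partial>M) \<le> (\<integral>\<^sup>+x. f x + g x \<partial>M)"
    if s: "simple_function M s" "s \<le> f" for s
  proof -
    have "(\<integral>\<^sup>+x. s x \<partial>M) + (\<integral>\<^sup>Sx. t x \<partial>M) \<le> (\<integral>\<^sup>+x. f x + g x \<partial>M)"
      if t: "simple_function M t" "t \<le> g" for t
    proof -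
      have "(\<integral>\<^sup>+x. s x \<partial>M) + (\<integral>\<^sup>Sx. t x \<partial>M) = (\<integral>\<^sup>+x. s x + t x \<partial>M)"
        using s(1) t(1) by (simp add: nn_integral_eq_simple_integral[symmetric] nn_integral_add borel_measurable_simple_function)
      also have "\<dots> \<le> (\<integral>\<^sup>+x. f x + g x \<partial>M)"
        using s(2) t(2) by (intro nn_integral_mono add_mono) (auto simp: le_fun_def)
      finally show ?thesis .
    qed
    then show ?thesis
      unfolding nn_integral_def[of M g]
      by (subst ennreal_SUP_add_right) (auto intro!: SUP_least simp: le_fun_def intro: exI[of _ "\<lambda>_. 0"])
  qed
  show ?thesis
    unfolding nn_integral_def[of M f]
    by (subst ennreal_SUP_add_left[symmetric])
      (auto intro!: SUP_least * simp: nn_integral_eq_simple_integral[symmetric] le_fun_def intro: exI[of _ "\<lambda>_. 0"])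
qed

section \<open>Energy estimate along a path\<close>

text \<open>The velocity is known to lie in \<open>V\<close> only at almost every time. Applied to
  its divergence, which is continuous in time once the gradient is, this reaches every time.\<close>

lemma continuous_AE_zero:
  fixes f :: "real \<Rightarrow> 'x::real_normed_vector"
  assumes "0 < T" and cont: "continuous_on {0..T} f" and AE: "AE t in lebesgue_on {0..T}. f t = 0"
    and t: "t \<in> {0..T}"
  shows "f t = 0"
proof -
  have c: "continuous_on {0..T} (\<lambda>t. norm (f t))"
    by (intro continuous_intros cont)
  have "integral {0..T} (\<lambda>t. norm (f t)) = (LINT t|lebesgue_on {0..T}. norm (f t))"
    using continuous_imp_integrable_real[OF c] by (simp add: lebesgue_integral_eq_integral)
  also have "\<dots> = 0"
    using AE by (intro integral_eq_zero_AE) (auto elim: eventually_mono)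
  finally have "\<forall>t\<in>{0..T}. norm (f t) = 0"
    using integral_eq_0_iff[OF c \<open>0 < T\<close>] by simp
  with t show ?thesis by simp
qed

lemma jet2_continuous_grad:
  "continuous_on A (\<lambda>t. jet2 (v t)) \<Longrightarrow> continuous_on A (\<lambda>t. grad (v t))"
  using continuous_on_fst[OF continuous_on_snd[of A "\<lambda>t. jet2 (v t)"]] by (simp add: jet2_def)

text \<open>Testing with the mean \<open>w\<close> of the two errors yields half the difference of
  their squared norms. The family \<open>X\<close> need not converge: only its pairings with
  gradients of fields in \<open>V\<close> do, which is why a lower limit of norms bounds the
  result.\<close>

lemma energy_step:
  fixes X :: "nat \<Rightarrow> l2_torus^2^2"
  assumes e: "e0 \<in> V" "e1 \<in> V" and pos: "0 < \<tau>" "0 < \<nu>"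
    and eq: "\<And>\<phi>. \<phi> \<in> V \<Longrightarrow>
      inner (e1 - e0) \<phi> + \<nu> * \<tau> * inner (grad ((1/2) *\<^sub>R (e0 + e1))) (grad \<phi>) = \<nu> * \<rho> \<phi>"
    and lim: "\<And>\<phi>. \<phi> \<in> V \<Longrightarrow> (\<lambda>m. inner (X m) (grad \<phi>)) \<longlonglongrightarrow> \<rho> \<phi>"
  shows "ennreal ((norm e1)\<^sup>2) + ennreal (\<nu> * \<tau> * (norm (grad ((1/2) *\<^sub>R (e0 + e1))))\<^sup>2)
    \<le> ennreal ((norm e0)\<^sup>2) + liminf (\<lambda>m. ennreal (\<nu> / \<tau> * (norm (X m))\<^sup>2))"
proof -
  define w where "w = (1/2) *\<^sub>R (e0 + e1)"
  have w: "w \<in> V"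
    unfolding w_def by (intro subspace_scale[OF subspace_V] subspace_add[OF subspace_V] e)
  define g where "g = \<nu> * \<tau> * (norm (grad w))\<^sup>2"
  \<comment> \<open>After doubling, the tested equation contains \<open>g\<close> twice: one copy
    stays on the left, the other is subtracted here to be absorbed by Young's inequality.\<close>
  define d where "d = 2 * \<nu> * \<rho> w - g"
  have "inner (e1 - e0) (e0 + e1) = (norm e1)\<^sup>2 - (norm e0)\<^sup>2"
    unfolding power2_norm_eq_inner inner_diff_left inner_add_right inner_commute[of e1 e0] by simp
  then have "inner (e1 - e0) w = ((norm e1)\<^sup>2 - (norm e0)\<^sup>2) / 2"
    unfolding w_def by simp
  with eq[OF w] have d: "(norm e1)\<^sup>2 + g = (norm e0)\<^sup>2 + d"
    unfolding d_def g_def w_def[symmetric] power2_norm_eq_inner by (simp add: field_simps)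
  define dm where "dm m = 2 * \<nu> * inner (X m) (grad w) - g" for m
  have "dm \<longlonglongrightarrow> d"
    unfolding dm_def d_def by (intro tendsto_intros lim w)
  then have "(\<lambda>m. ennreal (dm m)) \<longlonglongrightarrow> ennreal d"
    by (rule tendsto_ennrealI)
  then have "ennreal d = liminf (\<lambda>m. ennreal (dm m))"
    by (metis lim_imp_Liminf sequentially_bot)
  also have "\<dots> \<le> liminf (\<lambda>m. ennreal (\<nu> / \<tau> * (norm (X m))\<^sup>2))"
  proof (intro Liminf_mono always_eventually allI ennreal_leI)
    fix m
    have "2 * inner (X m) (grad w) \<le> 2 * norm (X m) * norm (grad w)"
      using norm_cauchy_schwarz[of "X m" "grad w"] by simp
    \<comment> \<open>Scaling by \<open>sqrt \<tau>\<close> gives the gradient, after multiplication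
      by \<nu>, exactly the weight it has in \<open>g\<close>.\<close>
    also have "\<dots> \<le> (norm (X m))\<^sup>2 / \<tau> + \<tau> * (norm (grad w))\<^sup>2"
      using sum_squares_bound[of "norm (X m) / sqrt \<tau>" "sqrt \<tau> * norm (grad w)"] pos
      by (simp add: power_divide power_mult_distrib)
    finally have "\<nu> * (2 * inner (X m) (grad w)) \<le> \<nu> * ((norm (X m))\<^sup>2 / \<tau> + \<tau> * (norm (grad w))\<^sup>2)"
      using pos by (intro mult_left_mono) auto
    then show "dm m \<le> \<nu> / \<tau> * (norm (X m))\<^sup>2"
      by (simp add: dm_def g_def algebra_simps)
  qed
  finally have *: "ennreal d \<le> liminf (\<lambda>m. ennreal (\<nu> / \<tau> * (norm (X m))\<^sup>2))" .
  have g0: "0 \<le> g" using pos by (simp add: g_def)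
  then have "ennreal ((norm e1)\<^sup>2) + ennreal g = ennreal ((norm e0)\<^sup>2 + d)"
    by (simp add: d flip: ennreal_plus)
  also have "\<dots> \<le> ennreal ((norm e0)\<^sup>2) + ennreal d"
  \<comment> \<open>A negative \<open>d\<close> is truncated to zero by \<open>ennreal\<close>,
    which only enlarges the right side.\<close>
  proof (cases "0 \<le> d")
    case False
    then have "ennreal ((norm e0)\<^sup>2 + d) \<le> ennreal ((norm e0)\<^sup>2)"
      by (intro ennreal_leI) simp
    then show ?thesis using False by (simp add: ennreal_neg)
  qed simp
  also have "\<dots> \<le> ennreal ((norm e0)\<^sup>2) + liminf (\<lambda>m. ennreal (\<nu> / \<tau> * (norm (X m))\<^sup>2))"
    using * by (rule add_left_mono)
  finally show ?thesis by (simp add: g_def w_def)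
qed

text \<open>The local defect of the scheme, with the time integral replaced by the midpoint rule on \<open>M * m\<close>
  cells: the trapezoidal error of \<open>f\<close> plus the quadrature error of \<open>G\<close>.\<close>

definition defect_sum ::
  "real \<Rightarrow> nat \<Rightarrow> real \<Rightarrow> (real \<Rightarrow> 'x::real_vector) \<Rightarrow> (real \<Rightarrow> 'x) \<Rightarrow> nat \<Rightarrow> 'x" where
  "defect_sum \<tau> M a f G m =
    (\<tau> / real (M * m)) *\<^sub>R (\<Sum>i<M * m.
      (1/2) *\<^sub>R (f a + f (a + \<tau>)) - f (a + (real i + 1/2) * (\<tau> / real (M * m)))) +
    (\<tau> / real (M * m)) *\<^sub>R (\<Sum>i<M * m.
      G (a + (real (i div m) + 1) * \<tau>\<^sup>2) - G (a + (real i + 1/2) * (\<tau> / real (M * m))))"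

text \<open>The \<open>m\<close> nodes of one noise cell share the same sample of \<open>G\<close>,
  and \<open>real M * \<tau> = 1\<close> makes their total weight \<open>real m * \<delta>\<close>
  equal to \<open>\<tau>\<^sup>2\<close>. The sampled part thus becomes the quadrature of the scheme
  times \<tau>.\<close>

lemma defect_sum_eq:
  fixes f G :: "real \<Rightarrow> 'x::real_vector"
  assumes "0 < m" "0 < M" "real M * \<tau> = 1"
  shows "defect_sum \<tau> M a f G m =
    \<tau> *\<^sub>R ((1/2) *\<^sub>R (f a + f (a + \<tau>)) + \<tau> *\<^sub>R (\<Sum>l = 1..M. G (a + real l * \<tau>\<^sup>2))) -
    (\<tau> / real (M * m)) *\<^sub>R (\<Sum>i<M * m. f (a + (real i + 1/2) * (\<tau> / real (M * m))) +
      G (a + (real i + 1/2) * (\<tau> / real (M * m))))"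
proof -
  define \<delta> where "\<delta> = \<tau> / real (M * m)"
  have \<delta>: "real (M * m) * \<delta> = \<tau>" "real m * \<delta> = \<tau>\<^sup>2"
    using assms by (auto simp: \<delta>_def field_simps power2_eq_square)
  have "(\<Sum>i<M * m. G (a + (real (i div m) + 1) * \<tau>\<^sup>2)) =
      (\<Sum>q<M. \<Sum>i = q * m..<q * m + m. G (a + (real (i div m) + 1) * \<tau>\<^sup>2))"
    by (rule sum.nat_group[symmetric])
  also have "\<dots> = (\<Sum>q<M. \<Sum>i = q * m..<q * m + m. G (a + real (Suc q) * \<tau>\<^sup>2))"
  proof (intro sum.cong refl)
    fix q i assume "i \<in> {q * m..<q * m + m}"
    then have "i div m = q"
      by (intro div_nat_eqI) (auto simp: mult.commute)
    then show "G (a + (real (i div m) + 1) * \<tau>\<^sup>2) = G (a + real (Suc q) * \<tau>\<^sup>2)"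
      by (simp add: add.commute)
  qed
  also have "\<dots> = real m *\<^sub>R (\<Sum>q<M. G (a + real (Suc q) * \<tau>\<^sup>2))"
    by (simp add: sum_constant_scaleR scaleR_right.sum)
  also have "(\<Sum>q<M. G (a + real (Suc q) * \<tau>\<^sup>2)) = (\<Sum>l = 1..M. G (a + real l * \<tau>\<^sup>2))"
    unfolding One_nat_def sum.atLeast1_atMost_eq ..
  finally have "\<delta> *\<^sub>R (\<Sum>i<M * m. G (a + (real (i div m) + 1) * \<tau>\<^sup>2)) =
      (real m * \<delta>) *\<^sub>R (\<Sum>l = 1..M. G (a + real l * \<tau>\<^sup>2))"
    by (simp add: mult.commute)
  also have "\<dots> = \<tau> *\<^sub>R \<tau> *\<^sub>R (\<Sum>l = 1..M. G (a + real l * \<tau>\<^sup>2))"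
    unfolding \<delta> by (simp add: power2_eq_square)
  finally have G: "\<delta> *\<^sub>R (\<Sum>i<M * m. G (a + (real (i div m) + 1) * \<tau>\<^sup>2)) =
      \<tau> *\<^sub>R \<tau> *\<^sub>R (\<Sum>l = 1..M. G (a + real l * \<tau>\<^sup>2))" .
  have "\<delta> *\<^sub>R (\<Sum>i<M * m. (1/2) *\<^sub>R (f a + f (a + \<tau>))) = \<tau> *\<^sub>R (1/2) *\<^sub>R (f a + f (a + \<tau>))"
    unfolding sum_constant_scaleR card_lessThan scaleR_scaleR[of \<delta>] using \<delta>(1) by (simp add: mult.commute)
  with G show ?thesis
    unfolding defect_sum_def \<delta>_def[symmetric] sum_subtractf sum.distrib scaleR_diff_right scaleR_add_right[of _ "sum _ _"]
      scaleR_add_right[of \<tau>]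
    by (simp add: algebra_simps)
qed

lemma defect_sum_tendsto:
  fixes f G :: "real \<Rightarrow> 'x::real_inner"
  assumes "0 < M" "0 < \<tau>" "real M * \<tau> = 1"
    and f: "continuous_on {a..a + \<tau>} f" and G: "continuous_on {a..a + \<tau>} G"
  shows "(\<lambda>m. inner (defect_sum \<tau> M a f G (Suc m)) \<psi>) \<longlonglongrightarrow>
    \<tau> * inner ((1/2) *\<^sub>R (f a + f (a + \<tau>)) + \<tau> *\<^sub>R (\<Sum>l = 1..M. G (a + real l * \<tau>\<^sup>2))) \<psi>
      - integral {a..a + \<tau>} (\<lambda>s. inner (f s + G s) \<psi>)"
proof -
  let ?\<phi> = "\<lambda>s. inner (f s + G s) \<psi>"
  let ?q = "\<lambda>K. (\<tau> / real K) * (\<Sum>i<K. ?\<phi> (a + (real i + 1/2) * (\<tau> / real K)))"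
  have "continuous_on {a..a + \<tau>} ?\<phi>"
    by (intro continuous_intros f G)
  then have "?q \<longlonglongrightarrow> integral {a..a + \<tau>} ?\<phi>"
    by (rule midpoint_rule_tendsto) fact
  \<comment> \<open>Only multiples of \<open>M\<close> refine the noise cells; \<open>Suc\<close>
    excludes the empty rule.\<close>
  moreover have "strict_mono (\<lambda>m. M * Suc m)"
    using \<open>0 < M\<close> by (auto intro!: strict_monoI)
  ultimately have lim: "(\<lambda>m. ?q (M * Suc m)) \<longlonglongrightarrow> integral {a..a + \<tau>} ?\<phi>"
    using LIMSEQ_subseq_LIMSEQ by (fastforce simp: o_def)
  have "inner (defect_sum \<tau> M a f G (Suc m)) \<psi> =
      \<tau> * inner ((1/2) *\<^sub>R (f a + f (a + \<tau>)) + \<tau> *\<^sub>R (\<Sum>l = 1..M. G (a + real l * \<tau>\<^sup>2))) \<psi> - ?q (M * Suc m)" for m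
    unfolding defect_sum_eq[OF zero_less_Suc assms(1,3)] inner_diff_left inner_scaleR_left inner_sum_left ..
  then show ?thesis
    by (simp only:) (intro tendsto_diff tendsto_const lim)
qed

lemma stokes_increment:
  fixes u z :: "real \<Rightarrow> field"
  assumes weak: "\<And>t. t \<in> {0..T} \<Longrightarrow> inner (u t) \<phi> - inner u0 \<phi> =
      - \<nu> * (LINT s|lebesgue_on {0..t}. inner (grad (u s)) \<psi>) + inner (z t) \<phi>"
    and cont: "continuous_on {0..T} (\<lambda>t. grad (u t))"
    and "0 \<le> a" "a \<le> b" "b \<le> T"
  shows "inner (u b - u a) \<phi> = - \<nu> * integral {a..b} (\<lambda>s. inner (grad (u s)) \<psi>) + inner (z b - z a) \<phi>"
proof -
  let ?\<phi> = "\<lambda>s. inner (grad (u s)) \<psi>"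
  have c: "continuous_on {0..t} ?\<phi>" if "t \<le> T" for t
    using that by (intro continuous_intros continuous_on_subset[OF cont]) (simp add: atLeastatMost_subset_iff)
  have eq: "(LINT s|lebesgue_on {0..t}. ?\<phi> s) = integral {0..t} ?\<phi>" if "t \<le> T" for t
    using continuous_imp_integrable_real[OF c[OF that]] by (simp add: lebesgue_integral_eq_integral)
  have "integral {0..a} ?\<phi> + integral {a..b} ?\<phi> = integral {0..b} ?\<phi>"
    using assms c[of b]
    by (intro Henstock_Kurzweil_Integration.integral_combine integrable_continuous_real) auto
  then have "\<nu> * integral {0..b} ?\<phi> = \<nu> * integral {0..a} ?\<phi> + \<nu> * integral {a..b} ?\<phi>"
    by (metis distrib_left)
  then show ?thesis
    using weak[of a] weak[of b] \<open>0 \<le> a\<close> \<open>a \<le> b\<close> \<open>b \<le> T\<close> by (simp add: eq inner_diff_left)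
qed

text \<open>The mean error contains the trapezoidal mean of the gradient of \<open>z\<close>, and
  \<open>J\<close> contains its negative. After cancellation the noise enters the defect only
  through the fine quadrature sum, next to the trapezoidal mean for \<open>y\<close>.\<close>

lemma error_equation:
  assumes U: "U0 \<in> Hk 1" "U1 \<in> Hk 1" and \<phi>: "\<phi> \<in> V" and "0 < \<tau>"
    and y: "y a \<in> Hk 2" "y (a + \<tau>) \<in> Hk 2" and z: "\<And>t. 0 \<le> t \<Longrightarrow> z t \<in> Hk 2" and a: "0 \<le> a"
    and J: "J = \<tau> *\<^sub>R (\<Sum>l = 1..M. z (a + real l * \<tau>\<^sup>2)) - (1/2) *\<^sub>R (z (a + \<tau>) + z a)"
    and scheme: "inner ((U1 - U0) /\<^sub>R \<tau>) \<phi> + \<nu> * inner (grad ((1/2) *\<^sub>R (U1 + U0) + J)) (grad \<phi>)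
      = (1 / \<tau>) * inner (z (a + \<tau>) - z a) \<phi>"
    and incr: "inner ((y (a + \<tau>) + z (a + \<tau>)) - (y a + z a)) \<phi> = - \<nu> * I + inner (z (a + \<tau>) - z a) \<phi>"
  defines "e0 \<equiv> y a + z a - U0" and "e1 \<equiv> y (a + \<tau>) + z (a + \<tau>) - U1"
  shows "inner (e1 - e0) \<phi> + \<nu> * \<tau> * inner (grad ((1/2) *\<^sub>R (e0 + e1))) (grad \<phi>) =
    \<nu> * (\<tau> * inner ((1/2) *\<^sub>R (grad (y a) + grad (y (a + \<tau>))) + \<tau> *\<^sub>R (\<Sum>l = 1..M. grad (z (a + real l * \<tau>\<^sup>2)))) (grad \<phi>) - I)"
proof -
  note closed = subspace_add[OF subspace_Hk] subspace_diff[OF subspace_Hk] subspace_scale[OF subspace_Hk]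
    subspace_sum[OF subspace_Hk]
  have z1: "z t \<in> Hk 1" if "0 \<le> t" for t
    by (rule Hk_2_imp_1[OF z[OF that]])
  have za: "z a \<in> Hk 1" "z (a + \<tau>) \<in> Hk 1" "z (a + real l * \<tau>\<^sup>2) \<in> Hk 1" for l
    using a \<open>0 < \<tau>\<close> by (simp_all only: z1 add_nonneg_nonneg less_imp_le mult_nonneg_nonneg of_nat_0_le_iff zero_le_power2)
  note y1 = y[THEN Hk_2_imp_1]
  have gJ: "grad J = \<tau> *\<^sub>R (\<Sum>l = 1..M. grad (z (a + real l * \<tau>\<^sup>2))) - (1/2) *\<^sub>R (grad (z (a + \<tau>)) + grad (z a))"
    unfolding J using za by (simp only: grad_diff grad_scale grad_add grad_sum closed)
  have JH: "J \<in> Hk 1"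
    unfolding J using za by (simp only: closed)
  have ge: "grad ((1/2) *\<^sub>R (e0 + e1)) =
      (1/2) *\<^sub>R ((grad (y a) + grad (z a) - grad U0) + (grad (y (a + \<tau>)) + grad (z (a + \<tau>)) - grad U1))"
    unfolding e0_def e1_def using za y1 U by (simp only: grad_diff grad_scale grad_add closed)
  have gU: "grad ((1/2) *\<^sub>R (U1 + U0) + J) = (1/2) *\<^sub>R (grad U1 + grad U0) + grad J"
    using U JH by (simp only: grad_diff grad_scale grad_add closed)
  have "\<tau> * (inner ((U1 - U0) /\<^sub>R \<tau>) \<phi> + \<nu> * inner (grad ((1/2) *\<^sub>R (U1 + U0) + J)) (grad \<phi>)) =
      inner (z (a + \<tau>) - z a) \<phi>"
    unfolding scheme using \<open>0 < \<tau>\<close> by simp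
  then have "inner (U1 - U0) \<phi> + \<nu> * \<tau> * inner (grad ((1/2) *\<^sub>R (U1 + U0) + J)) (grad \<phi>) =
      inner (z (a + \<tau>) - z a) \<phi>"
    using \<open>0 < \<tau>\<close> by (simp add: distrib_left mult.left_commute[of \<tau> \<nu>]) (simp flip: mult.assoc)
  then have "inner (e1 - e0) \<phi> = - \<nu> * I + \<nu> * \<tau> * inner ((1/2) *\<^sub>R (grad U1 + grad U0) + grad J) (grad \<phi>)"
    using incr unfolding gU e0_def e1_def by (simp add: inner_diff_left)
  then show ?thesis
    unfolding ge gJ by (simp add: inner_add_left inner_diff_left algebra_simps)
qed

section \<open>Mean-square bounds and the error estimate\<close>

text \<open>Jets are linear only on the Sobolev space, where the noise lies almost surely.
  Completeness makes an expression measurable that agrees only almost surely with a linear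
  combination of jets.\<close>

lemma measurable_AE_complete:
  assumes complete: "\<And>A B. B \<in> null_sets P \<Longrightarrow> A \<subseteq> B \<Longrightarrow> A \<in> sets P"
    and f: "f \<in> borel_measurable P" and AE: "AE \<omega> in P. f \<omega> = g \<omega>"
  shows "g \<in> borel_measurable P"
proof (rule measurableI)
  obtain N where N: "N \<in> null_sets P" "{\<omega> \<in> space P. f \<omega> \<noteq> g \<omega>} \<subseteq> N"
    using AE unfolding eventually_ae_filter by auto
  fix A :: "'b set" assume A: "A \<in> sets borel"
  have "g -` A \<inter> space P = (f -` A \<inter> space P - N) \<union> (g -` A \<inter> space P \<inter> N)"
    using N(2) by auto
  also have "\<dots> \<in> sets P"
    using N(1) by (intro sets.Un sets.Diff measurable_sets[OF f A] complete[OF N(1)]) auto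
  finally show "g -` A \<inter> space P \<in> sets P" .
qed simp

lemma Lp_norm_2_cong_AE:
  assumes complete: "\<And>A B. B \<in> null_sets P \<Longrightarrow> A \<subseteq> B \<Longrightarrow> A \<in> sets P"
    and "f \<in> borel_measurable P" "AE \<omega> in P. f \<omega> = g \<omega>"
  shows "Lp_norm 2 P f = Lp_norm 2 P g"
proof -
  have [measurable]: "f \<in> borel_measurable P" "g \<in> borel_measurable P"
    using measurable_AE_complete[OF assms] assms(2) by auto
  have "(LINT \<omega>|P. (norm (f \<omega>))\<^sup>2) = (LINT \<omega>|P. (norm (g \<omega>))\<^sup>2)"
    using assms(3) by (intro integral_cong_AE) (auto elim: eventually_mono)
  then show ?thesis by (simp add: Lp_norm_def)
qed

lemma Lp_fun_2_contraction:
  fixes p :: "'x::{real_inner, second_countable_topology} \<Rightarrow> 'z::{real_inner, second_countable_topology}"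
  assumes p: "bounded_linear p" "\<And>x. norm (p x) \<le> norm x" and X: "Lp_fun 2 P X"
  shows "Lp_fun 2 P (\<lambda>\<omega>. p (X \<omega>))"
    and "L2_inner P (\<lambda>\<omega>. p (X \<omega>)) (\<lambda>\<omega>. p (X \<omega>)) \<le> L2_inner P X X"
proof -
  have "p \<in> borel_measurable borel"
    by (intro borel_measurable_continuous_onI linear_continuous_on p)
  then have [measurable]: "(\<lambda>\<omega>. p (X \<omega>)) \<in> borel_measurable P"
    using X by (auto simp: Lp_fun_def)
  have sq: "(norm (p x))\<^sup>2 \<le> (norm x)\<^sup>2" for x
    by (intro power_mono p) simp
  have int: "integrable P (\<lambda>\<omega>. (norm (X \<omega>))\<^sup>2)"
    using X by (simp add: Lp_fun_def)
  then have int': "integrable P (\<lambda>\<omega>. (norm (p (X \<omega>)))\<^sup>2)"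
    by (rule Bochner_Integration.integrable_bound) (auto simp: sq)
  then show "Lp_fun 2 P (\<lambda>\<omega>. p (X \<omega>))"
    by (simp add: Lp_fun_def)
  show "L2_inner P (\<lambda>\<omega>. p (X \<omega>)) (\<lambda>\<omega>. p (X \<omega>)) \<le> L2_inner P X X"
    unfolding L2_inner_self by (intro integral_mono int int' sq)
qed

lemma L2_inner_add_self_le:
  fixes X Y :: "'w \<Rightarrow> 'x::{real_inner, second_countable_topology}"
  assumes "Lp_fun 2 P X" "Lp_fun 2 P Y"
  shows "L2_inner P (\<lambda>\<omega>. X \<omega> + Y \<omega>) (\<lambda>\<omega>. X \<omega> + Y \<omega>) \<le> 2 * L2_inner P X X + 2 * L2_inner P Y Y"
proof -
  have "0 \<le> L2_inner P (\<lambda>\<omega>. X \<omega> - Y \<omega>) (\<lambda>\<omega>. X \<omega> - Y \<omega>)"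
    by (rule L2_inner_self_nonneg)
  then show ?thesis
    using assms by (simp add: L2_inner_add_left L2_inner_add_right L2_inner_diff_left L2_inner_diff_right Lp_fun_2_add Lp_fun_2_diff)
qed

text \<open>The map \<open>p\<close> is later the identity on jets, for the initial value, and the
  projection to the gradient, for the defect. Being linear and a contraction, it commutes with the
  partial sums and preserves their mean-square convergence.\<close>

lemma noise_covariance:
  fixes p :: "field \<times> (l2_torus^2^2) \<times> (l2_torus^2^2^2) \<Rightarrow> 'z::{real_inner, second_countable_topology}"
  assumes basis: "stochastic_basis P F" and W: "independent_wiener_processes P F W"
    and \<Phi>: "\<forall>x. \<Phi> x \<in> Hk 2" and Z: "noise_process P F e W \<Phi> Z"
    and p: "bounded_linear p" "\<And>x. norm (p x) \<le> norm x"
  defines "Y \<equiv> \<lambda>t \<omega>. p (jet2 (Z t \<omega>))"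
  shows "t \<ge> 0 \<Longrightarrow> Lp_fun 2 P (Y t)"
    and "s \<ge> 0 \<Longrightarrow> t \<ge> 0 \<Longrightarrow> L2_inner P (Y s) (Y t) = min s t * L2_inner P (Y 1) (Y 1)"
proof -
  interpret p: bounded_linear p by (rule p)
  have complete: "A \<in> sets P" if "B \<in> null_sets P" "A \<subseteq> B" for A B
  proof -
    have "A \<in> sets (F 0)" "subalgebra P (F 0)"
      using basis that unfolding stochastic_basis_def by blast+
    then show ?thesis by (auto simp: subalgebra_def)
  qed
  have J: "Lp_fun 2 P (\<lambda>\<omega>. jet2 (Z t \<omega>))" if "t \<ge> 0" for t
    using Z that by (simp add: noise_process_def)
  show Y: "Lp_fun 2 P (Y t)" if "t \<ge> 0" for t
    unfolding Y_def by (rule Lp_fun_2_contraction(1)[OF p J[OF that]])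
  define c where "c k = jet2 (\<Phi> (e k))" for k
  have lim: "((\<lambda>K. Lp_norm 2 P (\<lambda>\<omega>. Y t \<omega> - (\<Sum>k\<in>K. W k t \<omega> *\<^sub>R p (c k)))) \<longlongrightarrow> 0) (finite_subsets_at_top UNIV)"
    if t: "t \<ge> 0" for t
  proof -
    define D where "D K \<omega> = jet2 (Z t \<omega>) - (\<Sum>k\<in>K. W k t \<omega> *\<^sub>R c k)" for K \<omega>
    have D: "Lp_fun 2 P (D K)" for K
      unfolding D_def
    proof (intro Lp_fun_2_diff Lp_fun_2_sum J t)
      fix k
      have "wiener_process P F (W k)"
        using W by (simp add: independent_wiener_processes_def)
      from wiener_moments(1)[OF basis this t] show "Lp_fun 2 P (\<lambda>\<omega>. W k t \<omega> *\<^sub>R c k)"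
        by (auto simp: Lp_fun_def power_mult_distrib)
    qed
    have "AE \<omega> in P. D K \<omega> = jet2 (Z t \<omega> - (\<Sum>k\<in>K. W k t \<omega> *\<^sub>R \<Phi> (e k)))" for K
    proof -
      have "AE \<omega> in P. Z t \<omega> \<in> Hk 2"
        using Z t unfolding noise_process_def by (auto elim: eventually_mono)
      then show ?thesis
      proof (rule eventually_mono)
        fix \<omega> assume "Z t \<omega> \<in> Hk 2"
        then show "D K \<omega> = jet2 (Z t \<omega> - (\<Sum>k\<in>K. W k t \<omega> *\<^sub>R \<Phi> (e k)))"
          using \<Phi> by (simp add: D_def c_def jet2_diff jet2_sum jet2_scale subspace_sum[OF subspace_Hk]
              subspace_scale[OF subspace_Hk])
      qed
    qed
    then have "Lp_norm 2 P (\<lambda>\<omega>. jet2 (Z t \<omega> - (\<Sum>k\<in>K. W k t \<omega> *\<^sub>R \<Phi> (e k)))) = Lp_norm 2 P (D K)" for K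
      using D by (intro Lp_norm_2_cong_AE[symmetric] complete) (auto simp: Lp_fun_def)
    moreover have "((\<lambda>K. Lp_norm 2 P (\<lambda>\<omega>. jet2 (Z t \<omega> - (\<Sum>k\<in>K. W k t \<omega> *\<^sub>R \<Phi> (e k))))) \<longlongrightarrow> 0)
        (finite_subsets_at_top UNIV)"
      using Z t unfolding noise_process_def by blast
    ultimately have Dlim: "((\<lambda>K. Lp_norm 2 P (D K)) \<longlongrightarrow> 0) (finite_subsets_at_top UNIV)"
      by simp
    have pD: "Y t \<omega> - (\<Sum>k\<in>K. W k t \<omega> *\<^sub>R p (c k)) = p (D K \<omega>)" for K \<omega>
      by (simp add: Y_def D_def p.diff p.sum p.scaleR)
    show ?thesis
      unfolding pD
    proof (rule tendsto_sandwich[OF _ _ tendsto_const Dlim])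
      show "\<forall>\<^sub>F K in finite_subsets_at_top UNIV. 0 \<le> Lp_norm 2 P (\<lambda>\<omega>. p (D K \<omega>))"
        by (simp add: Lp_norm_2 L2_inner_self_nonneg)
      show "\<forall>\<^sub>F K in finite_subsets_at_top UNIV. Lp_norm 2 P (\<lambda>\<omega>. p (D K \<omega>)) \<le> Lp_norm 2 P (D K)"
        using Lp_fun_2_contraction(2)[OF p D] by (simp add: Lp_norm_2)
    qed
  qed
  show "L2_inner P (Y s) (Y t) = min s t * L2_inner P (Y 1) (Y 1)" if "s \<ge> 0" "t \<ge> 0" for s t
    by (rule series_covariance[OF basis W Y lim that])
qed

text \<open>The factor \<open>min 0 0\<close> makes the mean square of the jet at time zero
  vanish.\<close>

lemma noise_initial:
  assumes basis: "stochastic_basis P F" and W: "independent_wiener_processes P F W"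
    and \<Phi>: "\<forall>x. \<Phi> x \<in> Hk 2" and Z: "noise_process P F e W \<Phi> Z"
  shows "AE \<omega> in P. Z 0 \<omega> = 0"
proof -
  note cov = noise_covariance[OF basis W \<Phi> Z bounded_linear_ident order_refl]
  have "(LINT \<omega>|P. (norm (jet2 (Z 0 \<omega>)))\<^sup>2) = 0"
    using cov(2)[of 0 0] by (simp add: L2_inner_self)
  moreover have "integrable P (\<lambda>\<omega>. (norm (jet2 (Z 0 \<omega>)))\<^sup>2)"
    using cov(1)[of 0] by (simp add: Lp_fun_def)
  ultimately have "AE \<omega> in P. (norm (jet2 (Z 0 \<omega>)))\<^sup>2 = 0"
    by (subst (asm) integral_nonneg_eq_0_iff_AE) auto
  then show ?thesis
    by (rule eventually_mono) (simp add: jet2_def zero_prod_def)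
qed

text \<open>The regularity of \<open>y\<close> concerns its jets, so the trapezoidal bound is
  obtained for \<open>jet1\<close> and then projected to the gradient. In the noise bound
  \<open>h = \<tau>\<^sup>2\<close> and \<open>real M * h = \<tau>\<close>, which yields
  \<open>\<sigma> * \<tau> ^ 5\<close>.\<close>

lemma defect_sum_mean_square:
  assumes P: "prob_space P"
    and y: "Lp_C1_on 4 P {0..T} (\<lambda>t \<omega>. jet1 (y t \<omega>)) (\<lambda>t \<omega>. jet1 (y' t \<omega>))"
    and L: "\<And>s t. s \<in> {0..T} \<Longrightarrow> t \<in> {0..T} \<Longrightarrow>
      Lp_norm 2 P (\<lambda>\<omega>. jet1 (y' t \<omega>) - jet1 (y' s \<omega>)) \<le> L * \<bar>t - s\<bar> powr (1/2)"
    and G: "\<And>t. t \<ge> 0 \<Longrightarrow> Lp_fun 2 P (\<lambda>\<omega>. grad (Z t \<omega>))"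
    and cov: "\<And>s t. s \<ge> 0 \<Longrightarrow> t \<ge> 0 \<Longrightarrow> L2_inner P (\<lambda>\<omega>. grad (Z s \<omega>)) (\<lambda>\<omega>. grad (Z t \<omega>)) = min s t * \<sigma>"
    and "0 \<le> L" "0 \<le> \<sigma>" "0 \<le> a" "0 < \<tau>" "a + \<tau> \<le> T" "0 < M" "real M * \<tau> = 1" "0 < m"
  defines "X \<equiv> \<lambda>\<omega>. defect_sum \<tau> M a (\<lambda>t. grad (y t \<omega>)) (\<lambda>t. grad (Z t \<omega>)) m"
  shows "Lp_fun 2 P X" "L2_inner P X X \<le> 2 * (L\<^sup>2 + \<sigma>) * \<tau> ^ 5"
proof -
  define K where "K = M * m"
  define \<delta> where "\<delta> = \<tau> / real K"
  have K: "0 < K" "real K * \<delta> = \<tau>" and m\<delta>: "real m * \<delta> = \<tau>\<^sup>2"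
    using assms by (auto simp: K_def \<delta>_def field_simps power2_eq_square)
  define J where "J \<omega> = \<delta> *\<^sub>R (\<Sum>i<K. (1/2) *\<^sub>R (jet1 (y a \<omega>) + jet1 (y (a + \<tau>) \<omega>)) -
    jet1 (y (a + (real i + 1/2) * \<delta>) \<omega>))" for \<omega>
  define S where "S \<omega> = \<delta> *\<^sub>R (\<Sum>i<K. grad (Z (a + (real (i div m) + 1) * \<tau>\<^sup>2) \<omega>) -
    grad (Z (a + (real i + 1/2) * \<delta>) \<omega>))" for \<omega>
  have J: "Lp_fun 2 P J" "L2_inner P J J \<le> L\<^sup>2 * \<tau> ^ 5"
    unfolding J_def[abs_def]
    using trapezoid_error_bound[where f = "\<lambda>t \<omega>. jet1 (y t \<omega>)" and f' = "\<lambda>t \<omega>. jet1 (y' t \<omega>)", OF P y L \<open>0 \<le> L\<close> \<open>0 \<le> a\<close> _ \<open>a + \<tau> \<le> T\<close> K] \<open>0 < \<tau>\<close> by simp_all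
  have "norm (snd x) \<le> norm x" for x :: "field \<times> (l2_torus^2^2)"
    by (cases x) (simp add: norm_snd_le)
  note contr = Lp_fun_2_contraction[OF bounded_linear_snd this J(1)]
  have R: "Lp_fun 2 P (\<lambda>\<omega>. snd (J \<omega>))" "L2_inner P (\<lambda>\<omega>. snd (J \<omega>)) (\<lambda>\<omega>. snd (J \<omega>)) \<le> L\<^sup>2 * \<tau> ^ 5"
    using contr(1) order_trans[OF contr(2) J(2)] by auto
  have S: "Lp_fun 2 P S" "L2_inner P S S \<le> \<sigma> * (real M * \<tau>\<^sup>2) * (\<tau>\<^sup>2)\<^sup>2"
    unfolding S_def[abs_def]
    using noise_quadrature_bound[OF G cov \<open>0 \<le> \<sigma>\<close> \<open>0 \<le> a\<close> _ \<open>0 < m\<close> m\<delta> K_def] by simp_all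
  have "real M * \<tau>\<^sup>2 = \<tau>"
    using \<open>real M * \<tau> = 1\<close> by (simp add: power2_eq_square flip: mult.assoc)
  with S(2) have S2: "L2_inner P S S \<le> \<sigma> * \<tau> ^ 5"
    by (simp add: mult.assoc flip: power_Suc power_mult)
  have X: "X = (\<lambda>\<omega>. snd (J \<omega>) + S \<omega>)"
    unfolding X_def defect_sum_def J_def S_def K_def[symmetric] \<delta>_def[symmetric]
    by (simp add: jet1_def snd_sum)
  show "Lp_fun 2 P X"
    unfolding X by (intro Lp_fun_2_add R S)
  have "L2_inner P X X \<le> 2 * L2_inner P (\<lambda>\<omega>. snd (J \<omega>)) (\<lambda>\<omega>. snd (J \<omega>)) + 2 * L2_inner P S S"
    unfolding X by (intro L2_inner_add_self_le R S)
  also have "\<dots> \<le> 2 * (L\<^sup>2 * \<tau> ^ 5) + 2 * (\<sigma> * \<tau> ^ 5)"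
    using R(2) S2 by simp
  finally show "L2_inner P X X \<le> 2 * (L\<^sup>2 + \<sigma>) * \<tau> ^ 5"
    by (simp add: algebra_simps)
qed

section \<open>Summation over the steps and passage to expectations\<close>

lemma divergence_zero_if_orthogonal:
  assumes "v \<in> Hk 1" and "\<And>q. q \<in> Q \<Longrightarrow> inner (divergence v) q = 0"
  shows "v \<in> V"
  using assms(2)[OF divergence_in_Q[OF assms(1)]] assms(1) by (simp add: V_def)

lemma nn_integral_cmult_le:
  assumes "0 \<le> c"
  shows "ennreal c * (\<integral>\<^sup>+x. f x \<partial>M) \<le> (\<integral>\<^sup>+x. ennreal c * f x \<partial>M)"
  unfolding nn_integral_def[of M f] SUP_mult_left_ennreal
proof (rule SUP_least)
  fix s assume "s \<in> {g. simple_function M g \<and> g \<le> f}"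
  then have s: "simple_function M s" "\<And>x. s x \<le> f x"
    by (auto simp: le_fun_def)
  have "ennreal c * integral\<^sup>S M s = (\<integral>\<^sup>+x. ennreal c * s x \<partial>M)"
    using s(1) by (simp add: nn_integral_eq_simple_integral[symmetric] nn_integral_cmult
        borel_measurable_simple_function)
  also have "\<dots> \<le> (\<integral>\<^sup>+x. ennreal c * f x \<partial>M)"
    by (intro nn_integral_mono mult_left_mono s) simp
  finally show "ennreal c * integral\<^sup>S M s \<le> (\<integral>\<^sup>+x. ennreal c * f x \<partial>M)" .
qed

lemma nn_integral_sum_superadditive:
  "(\<Sum>i<(n::nat). \<integral>\<^sup>+x. f i x \<partial>M) \<le> (\<integral>\<^sup>+x. (\<Sum>i<n. f i x) \<partial>M)"
proof (induction n)
  case (Suc n)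
  have "(\<Sum>i<Suc n. \<integral>\<^sup>+x. f i x \<partial>M) \<le> (\<integral>\<^sup>+x. (\<Sum>i<n. f i x) \<partial>M) + (\<integral>\<^sup>+x. f n x \<partial>M)"
    using Suc by (simp add: add_right_mono)
  also have "\<dots> \<le> (\<integral>\<^sup>+x. (\<Sum>i<n. f i x) + f n x \<partial>M)"
    by (rule nn_integral_superadditive)
  finally show ?case by simp
qed simp

text \<open>Subtraction in \<open>ennreal\<close> is truncated, so the telescoping is done by an
  induction that keeps the sum of \<open>g\<close> on the left.\<close>

lemma energy_sum:
  fixes a g r :: "nat \<Rightarrow> ennreal"
  assumes "a 0 = 0" and step: "\<And>n. n < N \<Longrightarrow> a (Suc n) + g n \<le> a n + r n" and "n \<le> N"
  shows "a n + (\<Sum>k<n. g k) \<le> (\<Sum>k<n. r k)"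
  using \<open>n \<le> N\<close>
proof (induction n)
  case (Suc n)
  have "a (Suc n) + (\<Sum>k<Suc n. g k) = (a (Suc n) + g n) + (\<Sum>k<n. g k)"
    by (simp add: ac_simps)
  also have "\<dots> \<le> (a n + r n) + (\<Sum>k<n. g k)"
    using Suc.prems by (intro add_right_mono step) simp
  also have "\<dots> = (a n + (\<Sum>k<n. g k)) + r n" by (simp add: ac_simps)
  also have "\<dots> \<le> (\<Sum>k<n. r k) + r n"
    using Suc by (intro add_right_mono) simp
  finally show ?case by simp
qed (simp add: assms)

text \<open>No probability enters: on one path the weak equation and the scheme give an energy
  inequality at each step, and these are summed from a vanishing initial error.\<close>

lemma pathwise_error_estimate:
  fixes u z :: "real \<Rightarrow> field" and U :: "nat \<Rightarrow> field" and p :: "nat \<Rightarrow> l2_torus"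
  assumes pos: "0 < T" "0 < \<nu>" "0 < N" and \<tau>: "\<tau> = T / real N" and M: "real M * \<tau> = 1"
    and y: "\<And>t. t \<in> {0..T} \<Longrightarrow> u t - z t \<in> Hk 2" and ycont: "continuous_on {0..T} (\<lambda>t. jet2 (u t - z t))"
    and z: "\<And>t. t \<ge> 0 \<Longrightarrow> z t \<in> Hk 2" and zcont: "continuous_on {0..} (\<lambda>t. jet2 (z t))"
    and z0: "z 0 = 0" and uinit: "uinit \<in> V"
    and uV: "AE t in lebesgue_on {0..T}. u t \<in> V"
    and weak: "\<And>t \<phi>. t \<in> {0..T} \<Longrightarrow> \<phi> \<in> V \<Longrightarrow> inner (u t) \<phi> - inner uinit \<phi> =
      - \<nu> * (LINT s|lebesgue_on {0..t}. inner (grad (u s)) (grad \<phi>)) + inner (z t) \<phi>"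
    and U0: "U 0 = uinit"
    and U: "\<And>n. n < N \<Longrightarrow> U (Suc n) \<in> Hk 1"
    and scheme: "\<And>n \<phi> q. n < N \<Longrightarrow> \<phi> \<in> Hk 1 \<Longrightarrow> q \<in> Q \<Longrightarrow>
      inner ((U (Suc n) - U n) /\<^sub>R \<tau>) \<phi>
        + \<nu> * inner (grad ((1/2) *\<^sub>R (U (Suc n) + U n) + noise_correction (\<lambda>t _. z t) \<tau> M n \<omega>)) (grad \<phi>)
        - inner (p (Suc n)) (divergence \<phi>)
          = (1/\<tau>) * inner (z (real (Suc n) * \<tau>) - z (real n * \<tau>)) \<phi> \<and>
      inner (divergence (U (Suc n))) q = 0"
    and "n \<le> N"
  shows "ennreal ((norm (u (real n * \<tau>) - U n))\<^sup>2)
    + (\<Sum>k<n. ennreal (\<nu> * \<tau>) * ennreal ((norm (grad ((1/2) *\<^sub>R (u (real k * \<tau>) + u (real (Suc k) * \<tau>))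
        - (1/2) *\<^sub>R (U k + U (Suc k)))))\<^sup>2))
    \<le> (\<Sum>k<n. liminf (\<lambda>m. ennreal (\<nu> / \<tau> *
        (norm (defect_sum \<tau> M (real k * \<tau>) (\<lambda>t. grad (u t - z t)) (\<lambda>t. grad (z t)) (Suc m)))\<^sup>2)))"
proof -
  have \<tau>0: "0 < \<tau>" using pos \<tau> by simp
  have M0: "0 < M" using M by (cases M) auto
  have N\<tau>: "real N * \<tau> = T" using pos \<tau> by simp
  have gy: "continuous_on {0..T} (\<lambda>t. grad (u t - z t))"
    by (rule jet2_continuous_grad[OF ycont])
  have gz: "continuous_on {0..T} (\<lambda>t. grad (z t))"
    by (rule jet2_continuous_grad[OF continuous_on_subset[OF zcont]]) auto
  have y1: "u t - z t \<in> Hk 1" and z1: "z t \<in> Hk 1" and gu: "grad (u t) = grad (u t - z t) + grad (z t)"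
    if "t \<in> {0..T}" for t
  proof -
    show 1: "u t - z t \<in> Hk 1" "z t \<in> Hk 1"
      using that by (auto intro: Hk_2_imp_1[OF y] Hk_2_imp_1[OF z] simp del: One_nat_def)
    show "grad (u t) = grad (u t - z t) + grad (z t)"
      using grad_add[OF 1] by simp
  qed
  have u1: "u t \<in> Hk 1" if "t \<in> {0..T}" for t
    using subspace_add[OF subspace_Hk y1[OF that] z1[OF that]] by simp
  have gucont: "continuous_on {0..T} (\<lambda>t. grad (u t))"
    by (subst continuous_on_cong[OF refl gu]) (auto intro: continuous_on_add gy gz)
  have uV: "u t \<in> V" if "t \<in> {0..T}" for t
  proof -
    have "continuous_on {0..T} (\<lambda>t. \<Sum>i\<in>UNIV. grad (u t) $ i $ i)"
      by (intro continuous_intros gucont)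
    moreover have "AE t in lebesgue_on {0..T}. (\<Sum>i\<in>UNIV. grad (u t) $ i $ i) = 0"
      using uV by (rule eventually_mono) (simp add: V_iff)
    ultimately have "(\<Sum>i\<in>UNIV. grad (u t) $ i $ i) = 0"
      using continuous_AE_zero[OF \<open>0 < T\<close>] that by blast
    with u1[OF that] show ?thesis by (simp add: V_iff)
  qed
  \<comment> \<open>At time zero the integral and the noise vanish, and the difference of the two
    initial values, which lies in \<open>V\<close>, is tested with itself.\<close>
  have u_init: "u 0 = uinit"
  proof -
    have V: "u 0 - uinit \<in> V"
      using pos uV uinit by (intro subspace_diff[OF subspace_V]) auto
    have "inner (u 0 - uinit) (u 0 - uinit) = - \<nu> * integral {0..0} (\<lambda>s. inner (grad (u s)) (grad (u 0 - uinit)))"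
      using weak[OF _ V, of 0] pos z0 continuous_imp_integrable_real[of 0 0 "\<lambda>s. inner (grad (u s)) (grad (u 0 - uinit))"]
      by (simp add: inner_diff_left lebesgue_integral_eq_integral)
    then show ?thesis by simp
  qed
  have zero_in_Q: "0 \<in> Q" by (simp add: Q_def torus_integral_eq_inner)
  have UV: "U n \<in> V" if "n \<le> N" for n
  proof (cases n)
    case 0
    then show ?thesis using U0 uinit by simp
  next
    case (Suc k)
    then have "k < N" using that by simp
    from scheme[OF this subspace_0[OF subspace_Hk]] U[OF this] Suc show ?thesis
      by (intro divergence_zero_if_orthogonal) auto
  qed
  have mem: "real n * \<tau> \<in> {0..T}" if "n \<le> N" for n
    using that \<tau>0 N\<tau> by (metis atLeastAtMost_iff mult_nonneg_nonneg mult_right_mono less_imp_le of_nat_0_le_iff of_nat_le_iff)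
  define e where "e n = u (real n * \<tau>) - U n" for n
  have eV: "e n \<in> V" if "n \<le> N" for n
    unfolding e_def using that by (intro subspace_diff[OF subspace_V] uV mem UV)
  define X where "X k m = defect_sum \<tau> M (real k * \<tau>) (\<lambda>t. grad (u t - z t)) (\<lambda>t. grad (z t)) (Suc m)" for k m
  have step: "ennreal ((norm (e (Suc n)))\<^sup>2) + ennreal (\<nu> * \<tau> * (norm (grad ((1/2) *\<^sub>R (e n + e (Suc n)))))\<^sup>2)
      \<le> ennreal ((norm (e n))\<^sup>2) + liminf (\<lambda>m. ennreal (\<nu> / \<tau> * (norm (X n m))\<^sup>2))" if n: "n < N" for n
  proof -
    define a where "a = real n * \<tau>"
    have b: "real (Suc n) * \<tau> = a + \<tau>" by (simp add: a_def distrib_right)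
    have a: "0 \<le> a" "a \<in> {0..T}" "a + \<tau> \<in> {0..T}" "a + \<tau> \<le> T"
      using mem[of n] mem[of "Suc n"] n unfolding a_def[symmetric] b by auto
    define \<rho> where "\<rho> \<phi> = \<tau> * inner ((1/2) *\<^sub>R (grad (u a - z a) + grad (u (a + \<tau>) - z (a + \<tau>)))
      + \<tau> *\<^sub>R (\<Sum>l = 1..M. grad (z (a + real l * \<tau>\<^sup>2)))) (grad \<phi>)
      - integral {a..a + \<tau>} (\<lambda>s. inner (grad (u s)) (grad \<phi>))" for \<phi>
    show ?thesis
    proof (rule energy_step[where \<rho> = \<rho>])
      show "e n \<in> V" "e (Suc n) \<in> V" using n by (auto intro: eV)
      fix \<phi> assume \<phi>: "\<phi> \<in> V"
      then have \<phi>1: "\<phi> \<in> Hk 1" "divergence \<phi> = 0" by (auto simp: V_def)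
      have sub: "{a..a + \<tau>} \<subseteq> {0..T}" using a by auto
      have "integral {a..a + \<tau>} (\<lambda>s. inner (grad (u s)) (grad \<phi>)) =
          integral {a..a + \<tau>} (\<lambda>s. inner (grad (u s - z s) + grad (z s)) (grad \<phi>))"
        using sub gu by (intro Henstock_Kurzweil_Integration.integral_cong) auto
      then show "(\<lambda>m. inner (X n m) (grad \<phi>)) \<longlonglongrightarrow> \<rho> \<phi>"
        unfolding X_def \<rho>_def a_def[symmetric]
        using defect_sum_tendsto[OF M0 \<tau>0 M continuous_on_subset[OF gy sub] continuous_on_subset[OF gz sub], of "grad \<phi>"]
        by simp
      have incr: "inner (u (a + \<tau>) - u a) \<phi> =
          - \<nu> * integral {a..a + \<tau>} (\<lambda>s. inner (grad (u s)) (grad \<phi>)) + inner (z (a + \<tau>) - z a) \<phi>"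
        using \<tau>0 a by (intro stokes_increment[OF weak[OF _ \<phi>] gucont]) auto
      \<comment> \<open>A divergence-free test field removes the pressure; \<open>q = 0\<close> is
        admissible.\<close>
      have sch: "inner ((U (Suc n) - U n) /\<^sub>R \<tau>) \<phi>
        + \<nu> * inner (grad ((1/2) *\<^sub>R (U (Suc n) + U n) + noise_correction (\<lambda>t _. z t) \<tau> M n \<omega>)) (grad \<phi>)
          = (1/\<tau>) * inner (z (a + \<tau>) - z a) \<phi>"
        using scheme[OF n \<phi>1(1) zero_in_Q] unfolding \<phi>1(2) b a_def[symmetric] by simp
      have J: "noise_correction (\<lambda>t _. z t) \<tau> M n \<omega> =
          \<tau> *\<^sub>R (\<Sum>l = 1..M. z (a + real l * \<tau>\<^sup>2)) - (1/2) *\<^sub>R (z (a + \<tau>) + z a)"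
        unfolding noise_correction_def noise_average_def b a_def[symmetric] ..
      have UH: "U n \<in> Hk 1" "U (Suc n) \<in> Hk 1"
        using UV[of n] UV[of "Suc n"] n by (auto simp: V_def)
      show "inner (e (Suc n) - e n) \<phi> + \<nu> * \<tau> * inner (grad ((1/2) *\<^sub>R (e n + e (Suc n)))) (grad \<phi>) = \<nu> * \<rho> \<phi>"
        using error_equation[where y = "\<lambda>t. u t - z t", OF UH \<phi> \<tau>0 y[OF a(2)] y[OF a(3)] z a(1) J sch] incr
        unfolding e_def \<rho>_def b a_def[symmetric] by simp
    qed (use \<tau>0 pos in auto)
  qed
  have w: "(1/2) *\<^sub>R (u (real k * \<tau>) + u (real (Suc k) * \<tau>)) - (1/2) *\<^sub>R (U k + U (Suc k)) =
      (1/2) *\<^sub>R (e k + e (Suc k))" for k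
    unfolding e_def by (simp add: algebra_simps)
  have nt: "ennreal (\<nu> * \<tau>) * ennreal (x\<^sup>2) = ennreal (\<nu> * \<tau> * x\<^sup>2)" for x
    using pos \<tau>0 by (simp add: ennreal_mult)
  have "ennreal ((norm (e n))\<^sup>2) + (\<Sum>k<n. ennreal (\<nu> * \<tau> * (norm (grad ((1/2) *\<^sub>R (e k + e (Suc k)))))\<^sup>2))
      \<le> (\<Sum>k<n. liminf (\<lambda>m. ennreal (\<nu> / \<tau> * (norm (X k m))\<^sup>2)))"
    by (rule energy_sum[where N = N and a = "\<lambda>n. ennreal ((norm (e n))\<^sup>2)"])
      (use step \<open>n \<le> N\<close> in \<open>simp_all add: e_def u_init U0\<close>)
  then show ?thesis
    unfolding w nt X_def unfolding e_def .
qed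

theorem theorem4p1:
  fixes P :: "'w measure" and F :: "real \<Rightarrow> 'w measure"
    and e :: "'k::countable \<Rightarrow> 'u::{real_inner, polish_space}"
    and W :: "'k \<Rightarrow> real \<Rightarrow> 'w \<Rightarrow> real"
    and \<Phi> :: "'u \<Rightarrow> field"
    and Z :: "real \<Rightarrow> 'w \<Rightarrow> field"
    and u0 :: "'w \<Rightarrow> field"
    and u y y' :: "real \<Rightarrow> 'w \<Rightarrow> field"
    and T \<nu> :: real
  assumes "T > 0" and "\<nu> > 0"
    and "stochastic_basis P F"
    and "orthonormal_basis e"
    and "independent_wiener_processes P F W"
    and "\<forall>x. \<Phi> x \<in> Hk 2" and "hilbert_schmidt e (\<lambda>x. jet2 (\<Phi> x))"
    and "\<forall>k. divergence (\<Phi> (e k)) = 0"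
    and "noise_process P F e W \<Phi> Z"
    and "(\<lambda>\<omega>. jet1 (u0 \<omega>)) \<in> borel_measurable (F 0)" and "AE \<omega> in P. u0 \<omega> \<in> V"
    and "stokes_velocity P F T \<nu> Z u0 u"
    and "y = (\<lambda>t \<omega>. u t \<omega> - Z t \<omega>)"
    and "L2_C_H2 P T y"
    and "C1_L4_V P T y y'"
    and "Lp_hoelder_on 2 P {0..T} (1/2) (\<lambda>t \<omega>. jet1 (y' t \<omega>))"
  shows "\<exists>C>0. \<forall>N M :: nat. \<forall>\<tau> un pn.
    N > 0 \<longrightarrow> \<tau> = T / real N \<longrightarrow> real M = 1 / \<tau> \<longrightarrow> crank_nicolson P \<nu> Z u0 \<tau> M N un pn \<longrightarrow>
      (MAX n\<in>{0..N}. \<integral>\<^sup>+\<omega>. ennreal ((norm (u (real n * \<tau>) \<omega> - un n \<omega>))\<^sup>2) \<partial>P) \<le> ennreal (C * \<tau> ^ 3) \<and>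
      ennreal (\<nu> * \<tau>) * (\<Sum>n<N. \<integral>\<^sup>+\<omega>. ennreal ((norm (grad
          ((1/2) *\<^sub>R (u (real n * \<tau>) \<omega> + u (real (Suc n) * \<tau>) \<omega>) - (1/2) *\<^sub>R (un n \<omega> + un (Suc n) \<omega>))))\<^sup>2) \<partial>P)
        \<le> ennreal (C * \<tau> ^ 3)"
proof -
  note basis = assms(3) and W = assms(5) and \<Phi> = assms(6) and Z = assms(9)
  interpret prob_space P
    using basis by (simp add: stochastic_basis_def)
  have y: "y t \<omega> = u t \<omega> - Z t \<omega>" for t \<omega>
    by (simp add: assms(13))
  have C1: "Lp_C1_on 4 P {0..T} (\<lambda>t \<omega>. jet1 (y t \<omega>)) (\<lambda>t \<omega>. jet1 (y' t \<omega>))"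
    using assms(15) by (simp add: C1_L4_V_def)
  obtain L0 where L0: "\<And>s t. s \<in> {0..T} \<Longrightarrow> t \<in> {0..T} \<Longrightarrow>
      Lp_norm 2 P (\<lambda>\<omega>. jet1 (y' t \<omega>) - jet1 (y' s \<omega>)) \<le> L0 * \<bar>t - s\<bar> powr (1/2)"
    using assms(16) unfolding Lp_hoelder_on_def by blast
  \<comment> \<open>The Hoelder condition does not fix the sign of its constant, while the bounds
    need a nonnegative one.\<close>
  define L where "L = \<bar>L0\<bar>"
  have L: "Lp_norm 2 P (\<lambda>\<omega>. jet1 (y' t \<omega>) - jet1 (y' s \<omega>)) \<le> L * \<bar>t - s\<bar> powr (1/2)"
    if "s \<in> {0..T}" "t \<in> {0..T}" for s t
    by (rule order_trans[OF L0[OF that]]) (simp add: L_def mult_right_mono)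
  have proj: "bounded_linear (\<lambda>x :: field \<times> (l2_torus^2^2) \<times> (l2_torus^2^2^2). fst (snd x))"
    by (intro bounded_linear_compose[OF bounded_linear_fst bounded_linear_snd])
  have proj_le: "norm (fst (snd x)) \<le> norm x" for x :: "field \<times> (l2_torus^2^2) \<times> (l2_torus^2^2^2)"
  proof -
    obtain a b c where "x = (a, b, c)" by (cases x) auto
    then show ?thesis
      using norm_fst_le[of b c] norm_snd_le[of "(b, c)" a] by simp
  qed
  note cov = noise_covariance[OF basis W \<Phi> Z proj proj_le, unfolded jet2_def fst_conv snd_conv]
  define \<sigma> where "\<sigma> = L2_inner P (\<lambda>\<omega>. grad (Z 1 \<omega>)) (\<lambda>\<omega>. grad (Z 1 \<omega>))"
  have \<sigma>0: "0 \<le> \<sigma>" by (simp add: \<sigma>_def L2_inner_self_nonneg)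
  define C1 where "C1 = 2 * (L\<^sup>2 + \<sigma>)"
  have C10: "0 \<le> C1" using \<sigma>0 by (simp add: C1_def)
  \<comment> \<open>One step contributes \<open>\<nu> * C1 * \<tau> ^ 4\<close>, and there are
    \<open>T / \<tau>\<close> steps; the summand 1 makes \<open>C\<close> positive even if
    \<open>C1\<close> is zero.\<close>
  define C where "C = T * \<nu> * C1 + 1"
  have "0 < C" using assms(1,2) C10 by (simp add: C_def add_nonneg_pos)
  moreover have "(MAX n\<in>{0..N}. \<integral>\<^sup>+\<omega>. ennreal ((norm (u (real n * \<tau>) \<omega> - un n \<omega>))\<^sup>2) \<partial>P) \<le> ennreal (C * \<tau> ^ 3) \<and>
      ennreal (\<nu> * \<tau>) * (\<Sum>n<N. \<integral>\<^sup>+\<omega>. ennreal ((norm (grad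
          ((1/2) *\<^sub>R (u (real n * \<tau>) \<omega> + u (real (Suc n) * \<tau>) \<omega>) - (1/2) *\<^sub>R (un n \<omega> + un (Suc n) \<omega>))))\<^sup>2) \<partial>P)
        \<le> ennreal (C * \<tau> ^ 3)"
    if N: "N > 0" and \<tau>: "\<tau> = T / real N" and M: "real M = 1 / \<tau>" and cn: "crank_nicolson P \<nu> Z u0 \<tau> M N un pn"
    for N M :: nat and \<tau> :: real and un pn
  proof -
    have \<tau>0: "0 < \<tau>" and N\<tau>: "real N * \<tau> = T" using assms(1) N \<tau> by auto
    have M1: "real M * \<tau> = 1" using M \<tau>0 by simp
    have M0: "0 < M" using M1 by (cases M) auto
    define X where "X k m \<omega> = defect_sum \<tau> M (real k * \<tau>) (\<lambda>t. grad (y t \<omega>)) (\<lambda>t. grad (Z t \<omega>)) (Suc m)" for k m \<omega>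
    have X: "Lp_fun 2 P (X k m)" "L2_inner P (X k m) (X k m) \<le> C1 * \<tau> ^ 5" if k: "k < N" for k m
    proof -
      have "real (Suc k) * \<tau> \<le> real N * \<tau>"
        using k \<tau>0 by (intro mult_right_mono) auto
      then have "real k * \<tau> + \<tau> \<le> T" by (simp add: N\<tau> distrib_right)
      from defect_sum_mean_square[OF prob_space_axioms C1 L cov(1) cov(2)[folded \<sigma>_def] _ \<sigma>0 _ \<tau>0 this M0 M1 zero_less_Suc]
      show "Lp_fun 2 P (X k m)" "L2_inner P (X k m) (X k m) \<le> C1 * \<tau> ^ 5"
        using \<tau>0 by (simp_all add: X_def[abs_def] C1_def L_def)
    qed
    define r where "r k m \<omega> = ennreal (\<nu> / \<tau> * (norm (X k m \<omega>))\<^sup>2)" for k m \<omega>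
    have [measurable]: "r k m \<in> borel_measurable P" if "k < N" for k m
    proof -
      have [measurable]: "X k m \<in> borel_measurable P"
        using X(1)[OF that] by (simp add: Lp_fun_def)
      show ?thesis unfolding r_def by measurable
    qed
    have \<rho>: "(\<integral>\<^sup>+\<omega>. liminf (\<lambda>m. r k m \<omega>) \<partial>P) \<le> ennreal (\<nu> * C1 * \<tau> ^ 4)" if k: "k < N" for k
    proof -
      have "(\<integral>\<^sup>+\<omega>. r k m \<omega> \<partial>P) \<le> ennreal (\<nu> * C1 * \<tau> ^ 4)" for m
      proof -
        have int: "integrable P (\<lambda>\<omega>. \<nu> / \<tau> * (norm (X k m \<omega>))\<^sup>2)"
          using X(1)[OF k] by (simp add: Lp_fun_def)
        have "(\<integral>\<^sup>+\<omega>. r k m \<omega> \<partial>P) = ennreal (\<nu> / \<tau> * L2_inner P (X k m) (X k m))"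
          unfolding r_def using \<tau>0 assms(2) by (subst nn_integral_eq_integral[OF int]) (auto simp: L2_inner_self)
        also have "\<dots> \<le> ennreal (\<nu> / \<tau> * (C1 * \<tau> ^ 5))"
          using \<tau>0 assms(2) by (intro ennreal_leI mult_left_mono X k) auto
        also have "\<nu> / \<tau> * (C1 * \<tau> ^ 5) = \<nu> * C1 * \<tau> ^ 4"
          using \<tau>0 by (simp add: field_simps flip: power_Suc)
        finally show ?thesis .
      qed
      then have "liminf (\<lambda>m. \<integral>\<^sup>+\<omega>. r k m \<omega> \<partial>P) \<le> liminf (\<lambda>m :: nat. ennreal (\<nu> * C1 * \<tau> ^ 4))"
        by (intro Liminf_mono always_eventually allI)
      then have "liminf (\<lambda>m. \<integral>\<^sup>+\<omega>. r k m \<omega> \<partial>P) \<le> ennreal (\<nu> * C1 * \<tau> ^ 4)"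
        by (simp add: Liminf_const)
      \<comment> \<open>Fatou's lemma applies because the bound is uniform in the number of
        midpoints and \<open>r\<close> is measurable.\<close>
      moreover have "(\<integral>\<^sup>+\<omega>. liminf (\<lambda>m. r k m \<omega>) \<partial>P) \<le> liminf (\<lambda>m. \<integral>\<^sup>+\<omega>. r k m \<omega> \<partial>P)"
        using k by (intro nn_integral_liminf) simp
      ultimately show ?thesis by (rule order_trans[rotated])
    qed
    have total: "(\<integral>\<^sup>+\<omega>. (\<Sum>k<n. liminf (\<lambda>m. r k m \<omega>)) \<partial>P) \<le> ennreal (C * \<tau> ^ 3)" if n: "n \<le> N" for n
    proof -
      have "(\<integral>\<^sup>+\<omega>. (\<Sum>k<n. liminf (\<lambda>m. r k m \<omega>)) \<partial>P) = (\<Sum>k<n. \<integral>\<^sup>+\<omega>. liminf (\<lambda>m. r k m \<omega>) \<partial>P)"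
        using n by (intro nn_integral_sum borel_measurable_liminf) auto
      also have "\<dots> \<le> (\<Sum>k<n. ennreal (\<nu> * C1 * \<tau> ^ 4))"
        using n by (intro sum_mono \<rho>) auto
      also have "\<dots> = ennreal (real n * (\<nu> * C1 * \<tau> ^ 4))"
        using assms(2) C10 \<tau>0 by (simp add: ennreal_mult ennreal_of_nat_eq_real_of_nat)
      also have "\<dots> \<le> ennreal (C * \<tau> ^ 3)"
      proof (rule ennreal_leI)
        have "real n * (\<nu> * C1 * \<tau> ^ 4) \<le> real N * (\<nu> * C1 * \<tau> ^ 4)"
          using n assms(2) C10 \<tau>0 by (intro mult_right_mono) auto
        also have "\<dots> = real N * \<tau> * (\<nu> * C1 * \<tau> ^ 3)"
          by (simp add: numeral_eq_Suc)
        also have "\<dots> = T * \<nu> * C1 * \<tau> ^ 3" by (simp add: N\<tau>)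
        also have "\<dots> \<le> C * \<tau> ^ 3"
          using \<tau>0 by (simp add: C_def distrib_right)
        finally show "real n * (\<nu> * C1 * \<tau> ^ 4) \<le> C * \<tau> ^ 3" .
      qed
      finally show ?thesis .
    qed
    define a where "a n \<omega> = ennreal ((norm (u (real n * \<tau>) \<omega> - un n \<omega>))\<^sup>2)" for n \<omega>
    define g where "g n \<omega> = ennreal ((norm (grad
          ((1/2) *\<^sub>R (u (real n * \<tau>) \<omega> + u (real (Suc n) * \<tau>) \<omega>) - (1/2) *\<^sub>R (un n \<omega> + un (Suc n) \<omega>))))\<^sup>2)" for n \<omega>
    have path: "AE \<omega> in P. \<forall>n\<le>N. a n \<omega> + (\<Sum>k<n. ennreal (\<nu> * \<tau>) * g k \<omega>) \<le> (\<Sum>k<n. liminf (\<lambda>m. r k m \<omega>))"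
    proof -
      have ay: "AE \<omega> in P. (\<forall>t\<in>{0..T}. u t \<omega> - Z t \<omega> \<in> Hk 2) \<and> continuous_on {0..T} (\<lambda>t. jet2 (u t \<omega> - Z t \<omega>))"
        using assms(14) unfolding L2_C_H2_def y by blast
      have az: "AE \<omega> in P. (\<forall>t\<ge>0. Z t \<omega> \<in> Hk 2) \<and> continuous_on {0..} (\<lambda>t. jet2 (Z t \<omega>))"
        using Z unfolding noise_process_def by blast
      have au: "AE \<omega> in P. AE t in lebesgue_on {0..T}. u t \<omega> \<in> V"
        using assms(12) unfolding stokes_velocity_def by (auto elim: eventually_mono)
      have aw: "AE \<omega> in P. \<forall>t\<in>{0..T}. \<forall>\<phi>\<in>V. inner (u t \<omega>) \<phi> - inner (u0 \<omega>) \<phi> =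
          - \<nu> * (LINT s|lebesgue_on {0..t}. inner (grad (u s \<omega>)) (grad \<phi>)) + inner (Z t \<omega>) \<phi>"
        using assms(12) unfolding stokes_velocity_def by blast
      show ?thesis
        using ay az au aw noise_initial[OF basis W \<Phi> Z] assms(11) cn[unfolded crank_nicolson_def]
      proof eventually_elim
        case (elim \<omega>)
        show ?case
          unfolding a_def g_def r_def X_def y
        proof (intro allI impI, rule pathwise_error_estimate[where z = "\<lambda>t. Z t \<omega>" and uinit = "u0 \<omega>" and p = "\<lambda>n. pn n \<omega>"
              and u = "\<lambda>t. u t \<omega>" and U = "\<lambda>n. un n \<omega>" and \<omega> = \<omega>])
        qed (use elim assms(1,2) N \<tau> M0 M1 in \<open>auto simp: noise_correction_def noise_average_def\<close>)
      qed
    qed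
    have "(\<integral>\<^sup>+\<omega>. a n \<omega> \<partial>P) \<le> ennreal (C * \<tau> ^ 3)" if n: "n \<le> N" for n
    proof (rule order_trans[OF nn_integral_mono_AE total[OF n]])
      show "AE \<omega> in P. a n \<omega> \<le> (\<Sum>k<n. liminf (\<lambda>m. r k m \<omega>))"
        using path
      proof eventually_elim
        case (elim \<omega>)
        have "a n \<omega> \<le> a n \<omega> + (\<Sum>k<n. ennreal (\<nu> * \<tau>) * g k \<omega>)" by simp
        with elim n show ?case using order_trans by blast
      qed
    qed
    then have "(MAX n\<in>{0..N}. \<integral>\<^sup>+\<omega>. a n \<omega> \<partial>P) \<le> ennreal (C * \<tau> ^ 3)"
      by (intro Max.boundedI) auto
    moreover have "ennreal (\<nu> * \<tau>) * (\<Sum>n<N. \<integral>\<^sup>+\<omega>. g n \<omega> \<partial>P) \<le> ennreal (C * \<tau> ^ 3)"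
    proof -
      have "ennreal (\<nu> * \<tau>) * (\<Sum>n<N. \<integral>\<^sup>+\<omega>. g n \<omega> \<partial>P) = (\<Sum>n<N. ennreal (\<nu> * \<tau>) * (\<integral>\<^sup>+\<omega>. g n \<omega> \<partial>P))"
        by (rule sum_distrib_left)
      \<comment> \<open>Factor and sum are moved inside the integral, the direction that holds for
        arbitrary \<open>g\<close>; the integrand is then compared almost surely with a measurable
        one.\<close>
      also have "\<dots> \<le> (\<Sum>n<N. \<integral>\<^sup>+\<omega>. ennreal (\<nu> * \<tau>) * g n \<omega> \<partial>P)"
        using assms(2) \<tau>0 by (intro sum_mono nn_integral_cmult_le) simp
      also have "\<dots> \<le> (\<integral>\<^sup>+\<omega>. (\<Sum>n<N. ennreal (\<nu> * \<tau>) * g n \<omega>) \<partial>P)"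
        by (rule nn_integral_sum_superadditive)
      also have "\<dots> \<le> (\<integral>\<^sup>+\<omega>. (\<Sum>k<N. liminf (\<lambda>m. r k m \<omega>)) \<partial>P)"
      proof (rule nn_integral_mono_AE)
        show "AE \<omega> in P. (\<Sum>n<N. ennreal (\<nu> * \<tau>) * g n \<omega>) \<le> (\<Sum>k<N. liminf (\<lambda>m. r k m \<omega>))"
          using path
        proof eventually_elim
          case (elim \<omega>)
          have "(\<Sum>k<N. ennreal (\<nu> * \<tau>) * g k \<omega>) \<le> a N \<omega> + (\<Sum>k<N. ennreal (\<nu> * \<tau>) * g k \<omega>)" by simp
          with elim show ?case using order_trans by blast
        qed
      qed
      also have "\<dots> \<le> ennreal (C * \<tau> ^ 3)" by (rule total) simp
      finally show ?thesis .
    qed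
    ultimately show ?thesis
      unfolding a_def g_def by blast
  qed
  ultimately show ?thesis by blast
qed

end
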